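(* Let $\kappa,\tau,a\in\mathbb{R}$ and let $H>0$ with $4H^2+\kappa>0$. Put $J_{\max}:=(\sqrt{4H^2+\kappa}-2H)/\kappa$ (understood as the limit $1/(4H)$ if $\kappa=0$). The surfaces in $\mathbb{E}(\kappa,\tau)$ of constant mean curvature $H$ which are invariant under the group $G_a$ of screw motions of pitch $a$ form a continuous one-parameter family $$\mathcal{F}_{a,H}=\big\{J\mapsto\Sigma_{a,H,J}\;:\; J\in(-\infty,J_{\max}]\text{ if }\kappa\le 0,\ \text{resp. } J\in[-\tfrac{2H}{\kappa},J_{\max}]\text{ if }\kappa>0\big\}$$ parameterized by the energy $J$. All surfaces are cylindrically bounded. The geometry of the surface $\Sigma_{a,H,J}$ with profile curve $\gamma=(r,h,\sigma)$ depends on $J$ as follows. (1) $J=J_{\max}$: the profile curve is a vertical straight line and the surface is a vertical round cylinder of radius $r=\mathrm{arct}_\kappa(2H)$. (2) $J\in(0,J_{\max})$: along the profile curve $h$ is increasing and $r$ and $\sigma$ are periodic. The surface is topologically an embedded cylinder if $a=0$, or an immersed plane if $a\ne0$ (an unduloid type surface). (3) $J=0$: the profile curve is homeomorphic to a semi-circle touching the screw motion axis and $h$ is increasing. The surface is topologically a doubly punctured sphere if $a=0$, or an immersed incomplete strip if $a\neq0$ (a sphere type surface). (4) $J<0$: along the profile curve $\sigma$ is increasing and $r$, $h'$ and $\sigma \bmod 2\pi$ are periodic. Regarding $h$ as a function of $\sigma$, let $\Delta:=h(\sigma+2\pi)-h(\sigma)$ be the vertical period. (a) If $\Delta>0$,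 the surface is topologically an immersed cylinder ($a=0$) or an immersed plane ($a\ne0$) (a nodoid type I surface). (b) If $\Delta=0$, the profile curve is a simple loop, and the surface is topologically an embedded or immersed torus or cylinder (a tube). (c) If $\Delta<0$, the surface is topologically an immersed cylinder ($a=0$) or an immersed plane ($a\neq0$) (a nodoid type II surface).
   Context: Generalized trigonometric functions: $\mathrm{sn}_\kappa(r)=\frac{1}{\sqrt\kappa}\sin(\sqrt\kappa r)$, $r$, $\frac1{\sqrt{-\kappa}}\sinh(\sqrt{-\kappa}r)$ and $\mathrm{cs}_\kappa(r)=\cos(\sqrt\kappa r)$, $1$, $\cosh(\sqrt{-\kappa}r)$ for $\kappa>0$, $\kappa=0$, $\kappa<0$ respectively; $\mathrm{ct}_\kappa=\mathrm{cs}_\kappa/\mathrm{sn}_\kappa$. Let $I_\kappa=(0,\pi/\sqrt\kappa)$ for $\kappa>0$ and $I_\kappa=(0,\infty)$ for $\kappa\le0$; $\mathrm{arct}_\kappa$ is the inverse of $\mathrm{ct}_\kappa$ on $I_\kappa$. $\mathbb{E}(\kappa,\tau)$ is the simply connected homogeneous 3-manifold with a Riemannian fibration with geodesic fibers over the simply connected surface of constant curvature $\kappa$, with bundle curvature $\tau$ (for $\kappa=4\tau^2$ this is $\mathbb{R}^3$ or $\mathbb{S}^3(\kappa)$). It is represented by geodesic polar coordinates $(r,\theta,z)$, $r\in I_\kappa$, $\theta\in[0,2\pi]$ (an angle mod $2\pi$), $z\in\mathbb{R}$, with metric $g=dr^2+\mathrm{sn}_\kappa^2(r)\,d\theta^2+\big(4\tau\,\mathrm{sn}_\kappa^2(\tfrac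 r2)\,d\theta-dz\big)^2$. For $\kappa\le0$ this is $\mathbb{E}(\kappa,\tau)$ without the fiber over $r=0$; for $\kappa>0$ it models the fiber-wise universal covering without the two fibers over the poles $r=0$, $r=\pi/\sqrt\kappa$. The screw motion axis is the fiber over $r=0$. Screw motions of pitch $a$: $L_{a,\varphi}(r,\theta,z)=(r,\theta+\varphi,z+a\varphi)$, $G_a=\{L_{a,\varphi}:\varphi\in\mathbb{R}\}$. With $h=z-a\theta$, the orbit space is described by $(r,h)\in I_\kappa\times\mathbb{R}$ with metric $g_a=dr^2+W(r)^{-2}dh^2$, $W(r)=\sqrt{\frac{\mathrm{sn}_\kappa^2(r)+(4\tau\,\mathrm{sn}_\kappa^2(r/2)-a)^2}{\mathrm{sn}_\kappa^2(r)}}$. A curve $\gamma=(r,h)$ generates the $G_a$-invariant surface $\Sigma_\gamma=\{(r(t),\varphi,h(t)+a\varphi)\}$. For a unit-speed curve $\gamma$, $\sigma$ is the angle between $\partial/\partial r$ and $\gamma'$, and $\Sigma_\gamma$ has constant mean curvature $H$ iff $$r'=\cos\sigma,\quad h'=W(r)\sin\sigma,\quad 2H=\mathrm{ct}_\kappa(r)\sin\sigma+\sigma'.$$ Along solutions the energy $J=\frac{2H}{\kappa}(\mathrm{cs}_\kappa(r)-1)+\mathrm{sn}_\kappa(r)\sin\sigma$ (for $\kappa=0$: $J=-Hr^2+r\sin\sigma$) is constant. $\Sigma_{a,H,J}$ denotes the surface generated by the (maximal) solution curve with energy $J$, which is considered up to vertical translation $h\mapsto h+\mathrm{const}$ and reparametrization.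 For $\kappa>0$, solutions with $J<-\frac{2H}\kappa$ are not listed separately: changing the axis ($r\mapsto\pi/\sqrt\kappa-r$, $\sigma\mapsto\sigma+\pi$, energy $J\mapsto -J-\frac{4H}{\kappa}$) puts them in one-to-one correspondence with those with $J>-\frac{2H}\kappa$. *)

theory Defs
  imports "HOL-Analysis.Analysis"
begin

definition sn :: "real \<Rightarrow> real \<Rightarrow> real" where
  "sn \<kappa> r = (if \<kappa> > 0 then sin (sqrt \<kappa> * r) / sqrt \<kappa>
             else if \<kappa> = 0 then r
             else sinh (sqrt (- \<kappa>) * r) / sqrt (- \<kappa>))"

definition cs :: "real \<Rightarrow> real \<Rightarrow> real" where
  "cs \<kappa> r = (if \<kappa> > 0 then cos (sqrt \<kappa> * r)
             else if \<kappa> = 0 then 1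
             else cosh (sqrt (- \<kappa>) * r))"

definition ct :: "real \<Rightarrow> real \<Rightarrow> real" where
  "ct \<kappa> r = cs \<kappa> r / sn \<kappa> r"

definition I :: "real \<Rightarrow> real set" where
  "I \<kappa> = (if \<kappa> > 0 then {0<..<pi / sqrt \<kappa>} else {0<..})"

definition arct :: "real \<Rightarrow> real \<Rightarrow> real" where
  "arct \<kappa> x = the_inv_into (I \<kappa>) (ct \<kappa>) x"


section \<open>The ambient space in geodesic polar coordinates\<close>

text \<open>
  Coordinates are \<^term>\<open>vector [r, \<theta>, z] :: real^3\<close>. The coordinate \<^term>\<open>\<theta>\<close> is an angle
  mod \<^term>\<open>2 * pi\<close>; \<^term>\<open>pt\<close> maps coordinates to the point they describe, the circle being
  realised as the unit circle in the complex plane.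
\<close>

definition pt :: "real^3 \<Rightarrow> real \<times> complex \<times> real" where
  "pt x = (x$1, cis (x$2), x$3)"

definition metric :: "real \<Rightarrow> real \<Rightarrow> real^3 \<Rightarrow> real^3 \<Rightarrow> real^3 \<Rightarrow> real" where
  "metric \<kappa> \<tau> x u v =
     u$1 * v$1 + (sn \<kappa> (x$1))\<^sup>2 * (u$2 * v$2)
     + (4 * \<tau> * (sn \<kappa> (x$1 / 2))\<^sup>2 * u$2 - u$3) * (4 * \<tau> * (sn \<kappa> (x$1 / 2))\<^sup>2 * v$2 - v$3)"

text \<open>The derivative of \<^term>\<open>\<lambda>x. metric \<kappa> \<tau> x v w\<close> in direction \<^term>\<open>u\<close>.\<close>

definition metric_deriv :: "real \<Rightarrow> real \<Rightarrow> real^3 \<Rightarrow> real^3 \<Rightarrow> real^3 \<Rightarrow> real^3 \<Rightarrow> real" where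
  "metric_deriv \<kappa> \<tau> x u v w = deriv (\<lambda>s. metric \<kappa> \<tau> (x + s *\<^sub>R u) v w) 0"

text \<open>
  Koszul formula: the inner product of the Levi-Civita derivative of \<^term>\<open>v\<close> in direction
  \<^term>\<open>u\<close> with \<^term>\<open>w\<close>, for vector fields \<^term>\<open>u\<close>, \<^term>\<open>v\<close>, \<^term>\<open>w\<close> with constant
  coordinates.
\<close>

definition christoffel :: "real \<Rightarrow> real \<Rightarrow> real^3 \<Rightarrow> real^3 \<Rightarrow> real^3 \<Rightarrow> real^3 \<Rightarrow> real" where
  "christoffel \<kappa> \<tau> x u v w =
     (metric_deriv \<kappa> \<tau> x u v w + metric_deriv \<kappa> \<tau> x v u w - metric_deriv \<kappa> \<tau> x w u v) / 2"


section \<open>Mean curvature of a parametrised surface\<close>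

definition pd1 :: "(real \<times> real \<Rightarrow> 'a::real_normed_vector) \<Rightarrow> real \<times> real \<Rightarrow> 'a" where
  "pd1 Y p = vector_derivative (\<lambda>s. Y (s, snd p)) (at (fst p))"

definition pd2 :: "(real \<times> real \<Rightarrow> 'a::real_normed_vector) \<Rightarrow> real \<times> real \<Rightarrow> 'a" where
  "pd2 Y p = vector_derivative (\<lambda>s. Y (fst p, s)) (at (snd p))"

text \<open>The unit normal for which (first partial, second partial, normal) is positively oriented.\<close>

definition is_unit_normal ::
  "real \<Rightarrow> real \<Rightarrow> (real \<times> real \<Rightarrow> real^3) \<Rightarrow> real \<times> real \<Rightarrow> real^3 \<Rightarrow> bool" where
  "is_unit_normal \<kappa> \<tau> Y p N \<longleftrightarrow>
     metric \<kappa> \<tau> (Y p) N N = 1 \<and> metric \<kappa> \<tau> (Y p) N (pd1 Y p) = 0 \<and>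
     metric \<kappa> \<tau> (Y p) N (pd2 Y p) = 0 \<and>
     det (vector [pd1 Y p, pd2 Y p, N] :: real^3^3) > 0"

definition mean_curvature ::
  "real \<Rightarrow> real \<Rightarrow> (real \<times> real \<Rightarrow> real^3) \<Rightarrow> real \<times> real \<Rightarrow> real^3 \<Rightarrow> real" where
  "mean_curvature \<kappa> \<tau> Y p N =
     (let g = metric \<kappa> \<tau> (Y p); \<Gamma> = christoffel \<kappa> \<tau> (Y p);
          A = pd1 Y p; B = pd2 Y p;
          b11 = g (pd1 (pd1 Y) p) N + \<Gamma> A A N;
          b12 = g (pd1 (pd2 Y) p) N + \<Gamma> A B N;
          b22 = g (pd2 (pd2 Y) p) N + \<Gamma> B B N
      in (b11 * g B B - 2 * b12 * g A B + b22 * g A A)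
           / (2 * (g A A * g B B - (g A B)\<^sup>2)))"


section \<open>Screw motions, generating curves and invariant surfaces\<close>

text \<open>
  A generating curve is \<^term>\<open>\<gamma> = (\<lambda>t. (r t, h t))\<close>, defined on a parameter interval \<^term>\<open>D\<close>;
  values outside \<^term>\<open>D\<close> are irrelevant.
\<close>

definition screw :: "real \<Rightarrow> real \<Rightarrow> real^3 \<Rightarrow> real^3" where
  "screw a \<phi> x = vector [x$1, x$2 + \<phi>, x$3 + a * \<phi>]"

definition gen_coord :: "real \<Rightarrow> (real \<Rightarrow> real \<times> real) \<Rightarrow> real \<times> real \<Rightarrow> real^3" where
  "gen_coord a \<gamma> p = screw a (snd p) (vector [fst (\<gamma> (fst p)), 0, snd (\<gamma> (fst p))])"

definition gen_point :: "real \<Rightarrow> (real \<Rightarrow> real \<times> real) \<Rightarrow> real \<times> real \<Rightarrow> real \<times> complex \<times> real" where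
  "gen_point a \<gamma> p = pt (gen_coord a \<gamma> p)"

definition gen_surface :: "real \<Rightarrow> real set \<Rightarrow> (real \<Rightarrow> real \<times> real) \<Rightarrow> (real \<times> complex \<times> real) set" where
  "gen_surface a D \<gamma> = gen_point a \<gamma> ` (D \<times> UNIV)"

definition W :: "real \<Rightarrow> real \<Rightarrow> real \<Rightarrow> real \<Rightarrow> real" where
  "W \<kappa> \<tau> a r =
     sqrt (((sn \<kappa> r)\<^sup>2 + (4 * \<tau> * (sn \<kappa> (r / 2))\<^sup>2 - a)\<^sup>2) / (sn \<kappa> r)\<^sup>2)"

definition open_interval :: "real set \<Rightarrow> bool" where
  "open_interval D \<longleftrightarrow> open D \<and> is_interval D \<and> D \<noteq> {}"

text \<open>Unit speed refers to the orbit metric \<open>dr\<^sup>2 + dh\<^sup>2 / W(r)\<^sup>2\<close>.\<close>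

definition unit_speed_curve :: "real \<Rightarrow> real \<Rightarrow> real \<Rightarrow> real set \<Rightarrow> (real \<Rightarrow> real \<times> real) \<Rightarrow> bool" where
  "unit_speed_curve \<kappa> \<tau> a D \<gamma> \<longleftrightarrow>
     open_interval D \<and> \<gamma> ` D \<subseteq> I \<kappa> \<times> UNIV \<and>
     \<gamma> C1_differentiable_on D \<and> (\<lambda>t. vector_derivative \<gamma> (at t)) C1_differentiable_on D \<and>
     (\<forall>t\<in>D. (fst (vector_derivative \<gamma> (at t)))\<^sup>2
            + (snd (vector_derivative \<gamma> (at t)))\<^sup>2 / (W \<kappa> \<tau> a (fst (\<gamma> t)))\<^sup>2 = 1)"

text \<open>
  The sign convention is the one of the generating equations: the normal projects to the normal
  on the left of \<^term>\<open>\<gamma>\<close> in the oriented \<open>(r, h)\<close>-plane. Reversing \<^term>\<open>\<gamma>\<close> changes the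
  sign of the mean curvature.
\<close>

definition has_cmc :: "real \<Rightarrow> real \<Rightarrow> real \<Rightarrow> real \<Rightarrow> real set \<Rightarrow> (real \<Rightarrow> real \<times> real) \<Rightarrow> bool" where
  "has_cmc \<kappa> \<tau> a H D \<gamma> \<longleftrightarrow>
     (\<forall>p \<in> D \<times> UNIV. \<exists>N. is_unit_normal \<kappa> \<tau> (gen_coord a \<gamma>) p N \<and>
                         mean_curvature \<kappa> \<tau> (gen_coord a \<gamma>) p N = H)"

definition is_solution ::
  "real \<Rightarrow> real \<Rightarrow> real \<Rightarrow> real \<Rightarrow> real set \<Rightarrow> (real \<Rightarrow> real \<times> real) \<Rightarrow> (real \<Rightarrow> real) \<Rightarrow> bool" where
  "is_solution \<kappa> \<tau> a H D \<gamma> \<sigma> \<longleftrightarrow>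
     open_interval D \<and>
     (\<forall>t\<in>D. fst (\<gamma> t) \<in> I \<kappa> \<and>
        ((\<lambda>s. fst (\<gamma> s)) has_real_derivative cos (\<sigma> t)) (at t) \<and>
        ((\<lambda>s. snd (\<gamma> s)) has_real_derivative W \<kappa> \<tau> a (fst (\<gamma> t)) * sin (\<sigma> t)) (at t) \<and>
        (\<exists>\<sigma>'. (\<sigma> has_real_derivative \<sigma>') (at t) \<and>
              2 * H = ct \<kappa> (fst (\<gamma> t)) * sin (\<sigma> t) + \<sigma>'))"

definition is_maximal_solution ::
  "real \<Rightarrow> real \<Rightarrow> real \<Rightarrow> real \<Rightarrow> real set \<Rightarrow> (real \<Rightarrow> real \<times> real) \<Rightarrow> (real \<Rightarrow> real) \<Rightarrow> bool" where
  "is_maximal_solution \<kappa> \<tau> a H D \<gamma> \<sigma> \<longleftrightarrow>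
     is_solution \<kappa> \<tau> a H D \<gamma> \<sigma> \<and>
     (\<forall>D' \<gamma>' \<sigma>'. is_solution \<kappa> \<tau> a H D' \<gamma>' \<sigma>' \<and> D \<subseteq> D' \<and> (\<forall>t\<in>D. \<gamma>' t = \<gamma> t \<and> \<sigma>' t = \<sigma> t)
        \<longrightarrow> D' = D)"

definition energy :: "real \<Rightarrow> real \<Rightarrow> real \<Rightarrow> real \<Rightarrow> real" where
  "energy \<kappa> H r \<sigma> =
     (if \<kappa> = 0 then - H * r\<^sup>2 + r * sin \<sigma>
      else 2 * H / \<kappa> * (cs \<kappa> r - 1) + sn \<kappa> r * sin \<sigma>)"

definition J_max :: "real \<Rightarrow> real \<Rightarrow> real" where
  "J_max \<kappa> H = (if \<kappa> = 0 then 1 / (4 * H) else (sqrt (4 * H\<^sup>2 + \<kappa>) - 2 * H) / \<kappa>)"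

definition J_range :: "real \<Rightarrow> real \<Rightarrow> real set" where
  "J_range \<kappa> H = (if \<kappa> > 0 then {- 2 * H / \<kappa>..J_max \<kappa> H} else {..J_max \<kappa> H})"

text \<open>
  \<^term>\<open>(D, \<gamma>, \<sigma>)\<close> is a profile curve of the surface with pitch \<^term>\<open>a\<close>, mean curvature
  \<^term>\<open>H\<close> and energy \<^term>\<open>J\<close>; the surface itself is \<^term>\<open>gen_surface a D \<gamma>\<close>.
\<close>

definition profile ::
  "real \<Rightarrow> real \<Rightarrow> real \<Rightarrow> real \<Rightarrow> real \<Rightarrow> real set \<Rightarrow> (real \<Rightarrow> real \<times> real) \<Rightarrow> (real \<Rightarrow> real) \<Rightarrow> bool"
  where
  "profile \<kappa> \<tau> a H J D \<gamma> \<sigma> \<longleftrightarrow>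
     is_maximal_solution \<kappa> \<tau> a H D \<gamma> \<sigma> \<and> (\<forall>t\<in>D. energy \<kappa> H (fst (\<gamma> t)) (\<sigma> t) = J)"

text \<open>
  Equality up to vertical translation and (orientation preserving, unit speed)
  reparametrisation; the angle is determined mod \<^term>\<open>2 * pi\<close> only.
\<close>

definition same_profile ::
  "real set \<Rightarrow> (real \<Rightarrow> real \<times> real) \<Rightarrow> (real \<Rightarrow> real) \<Rightarrow>
   real set \<Rightarrow> (real \<Rightarrow> real \<times> real) \<Rightarrow> (real \<Rightarrow> real) \<Rightarrow> bool" where
  "same_profile D \<gamma> \<sigma> D' \<gamma>' \<sigma>' \<longleftrightarrow>
     (\<exists>c b. \<exists>k::int. D' = (\<lambda>t. t + c) ` D \<and>
        (\<forall>t\<in>D. \<gamma>' (t + c) = \<gamma> t + (0, b) \<and> \<sigma>' (t + c) = \<sigma> t + 2 * pi * k))"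


section \<open>Topological type of an invariant surface\<close>

text \<open>
  The abstract surface underlying \<^term>\<open>gen_surface a D \<gamma>\<close> is the profile curve (an interval,
  or a circle if the curve closes up) times the group of screw motions (a circle if
  \<^term>\<open>a = 0\<close>, since a rotation by \<^term>\<open>2 * pi\<close> is the identity, and a line otherwise). That
  is, parameters \<open>(t, \<phi>)\<close> and \<open>(t', \<phi>')\<close> are identified iff \<^term>\<open>t' - t\<close> is a
  period of the curve and \<^term>\<open>\<phi>\<close>, \<^term>\<open>\<phi>'\<close> define the same screw motion; coincidences of
  image points beyond these are self-intersections.
\<close>

definition same_parameter ::
  "real \<Rightarrow> real set \<Rightarrow> (real \<Rightarrow> real \<times> real) \<Rightarrow> real \<times> real \<Rightarrow> real \<times> real \<Rightarrow> bool" where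
  "same_parameter a D \<gamma> p p' \<longleftrightarrow>
     (\<exists>T. fst p' = fst p + T \<and> (\<forall>s. s + T \<in> D \<longleftrightarrow> s \<in> D) \<and> (\<forall>s\<in>D. \<gamma> (s + T) = \<gamma> s)) \<and>
     (\<forall>x. pt (screw a (snd p) x) = pt (screw a (snd p') x))"

definition C1_immersion :: "('a::real_normed_vector) set \<Rightarrow> ('a \<Rightarrow> 'b::real_normed_vector) \<Rightarrow> bool" where
  "C1_immersion U Y \<longleftrightarrow>
     (\<exists>Y' :: 'a \<Rightarrow> ('a \<Rightarrow>\<^sub>L 'b). continuous_on U Y' \<and>
        (\<forall>p\<in>U. (Y has_derivative blinfun_apply (Y' p)) (at p) \<and> inj (blinfun_apply (Y' p))))"

text \<open>
  \<^term>\<open>F\<close> is the induced immersion of the abstract surface \<^term>\<open>S\<close>. The quotient map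
  \<^term>\<open>q\<close> is a covering, so \<^term>\<open>S\<close> inherits its differentiable structure from the
  parameter domain.
\<close>

definition generating_immersion ::
  "real \<Rightarrow> real set \<Rightarrow> (real \<Rightarrow> real \<times> real) \<Rightarrow> 's::topological_space set \<Rightarrow>
   ('s \<Rightarrow> real \<times> complex \<times> real) \<Rightarrow> bool" where
  "generating_immersion a D \<gamma> S F \<longleftrightarrow>
     C1_immersion (D \<times> UNIV) (gen_coord a \<gamma>) \<and>
     (\<exists>q. covering_space (D \<times> UNIV) q S \<and>
        (\<forall>p \<in> D \<times> UNIV. F (q p) = gen_point a \<gamma> p) \<and>
        (\<forall>p \<in> D \<times> UNIV. \<forall>p' \<in> D \<times> UNIV. q p = q p' \<longleftrightarrow> same_parameter a D \<gamma> p p'))"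

definition is_immersed ::
  "real \<Rightarrow> real set \<Rightarrow> (real \<Rightarrow> real \<times> real) \<Rightarrow> 's::topological_space set \<Rightarrow> bool" where
  "is_immersed a D \<gamma> S \<longleftrightarrow> (\<exists>F. generating_immersion a D \<gamma> S F)"

definition is_embedded ::
  "real \<Rightarrow> real set \<Rightarrow> (real \<Rightarrow> real \<times> real) \<Rightarrow> 's::topological_space set \<Rightarrow> bool" where
  "is_embedded a D \<gamma> S \<longleftrightarrow>
     (\<exists>F G. generating_immersion a D \<gamma> S F \<and> homeomorphism S (gen_surface a D \<gamma>) F G)"

definition cylinder :: "(complex \<times> real) set" where
  "cylinder = sphere 0 1 \<times> UNIV"

definition plane :: "(real \<times> real) set" where
  "plane = UNIV"

definition torus :: "(complex \<times> complex) set" where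
  "torus = sphere 0 1 \<times> sphere 0 1"

definition strip :: "(real \<times> real) set" where
  "strip = {0<..<1} \<times> UNIV"

definition doubly_punctured_sphere :: "(real^3) set" where
  "doubly_punctured_sphere = sphere 0 1 - {axis 3 1, - axis 3 1}"

definition semicircle :: "(real \<times> real) set" where
  "semicircle = {p. norm p = 1 \<and> fst p \<ge> 0}"


section \<open>Completeness of the induced metric\<close>

text \<open>
  Curves \<^term>\<open>c\<close> in the parameter domain; the length is the integral of the speed, which has to
  exist because the derivative of a piecewise \<open>C\<^sup>1\<close> function in the sense of the library need
  not be bounded near the exceptional points.
\<close>

definition path_length ::
  "real \<Rightarrow> real \<Rightarrow> real \<Rightarrow> real set \<Rightarrow> (real \<Rightarrow> real \<times> real) \<Rightarrow> real \<times> real \<Rightarrow> real \<times> real \<Rightarrow> real \<Rightarrow> bool"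
  where
  "path_length \<kappa> \<tau> a D \<gamma> p p' l \<longleftrightarrow>
     (\<exists>c. c piecewise_C1_differentiable_on {0..1} \<and> c 0 = p \<and> c 1 = p' \<and>
        c ` {0..1} \<subseteq> D \<times> UNIV \<and>
        ((\<lambda>s. let v = vector_derivative (\<lambda>s. gen_coord a \<gamma> (c s)) (at s)
              in sqrt (metric \<kappa> \<tau> (gen_coord a \<gamma> (c s)) v v)) has_integral l) {0..1})"

definition riem_dist ::
  "real \<Rightarrow> real \<Rightarrow> real \<Rightarrow> real set \<Rightarrow> (real \<Rightarrow> real \<times> real) \<Rightarrow> real \<times> real \<Rightarrow> real \<times> real \<Rightarrow> real"
  where
  "riem_dist \<kappa> \<tau> a D \<gamma> p p' = Inf {l. path_length \<kappa> \<tau> a D \<gamma> p p' l}"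

text \<open>
  Used only for \<^term>\<open>a \<noteq> 0\<close> and profile curves without periods, where the parameter domain is
  the abstract surface itself.
\<close>

definition complete_surface :: "real \<Rightarrow> real \<Rightarrow> real \<Rightarrow> real set \<Rightarrow> (real \<Rightarrow> real \<times> real) \<Rightarrow> bool" where
  "complete_surface \<kappa> \<tau> a D \<gamma> \<longleftrightarrow>
     (\<forall>x :: nat \<Rightarrow> real \<times> real.
        range x \<subseteq> D \<times> UNIV \<and>
        (\<forall>e>0. \<exists>n0. \<forall>m\<ge>n0. \<forall>n\<ge>n0. riem_dist \<kappa> \<tau> a D \<gamma> (x m) (x n) < e)
        \<longrightarrow> (\<exists>p \<in> D \<times> UNIV. (\<lambda>n. riem_dist \<kappa> \<tau> a D \<gamma> (x n) p) \<longlonglongrightarrow> 0))"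

end

theory Submission
  imports Defs
begin

text \<open>
  Let \<open>v = 2 sn(r/2)\<^sup>2 = (1 - cs r) / \<kappa>\<close> be the generalised versine of the radius, which for
  \<open>\<kappa> = 0\<close> is \<open>r\<^sup>2 / 2\<close>. The energy is \<open>J = sn r sin \<sigma> - 2 H v\<close> for every \<open>\<kappa>\<close>. Along a solution
  \<open>v' = sn r cos \<sigma>\<close>, and the energy turns the second derivative into a linear expression:
  \<open>v'' = (1 - 2 H J) - (4 H\<^sup>2 + \<kappa>) v\<close>. So the generating equations hide a harmonic oscillator of
  frequency \<open>\<omega> = sqrt (4 H\<^sup>2 + \<kappa>)\<close>, and up to a shift of time
  \<open>v(t) = (1 - 2 H J + B cos (\<omega> t)) / \<omega>\<^sup>2\<close> with \<open>B\<^sup>2 = 1 - 4 H J - \<kappa> J\<^sup>2\<close>. The pitch and the bundle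
  curvature only enter the height, which is a quadrature. The upper bound \<open>J \<le> J\<^sub>m\<^sub>a\<^sub>x\<close> comes
  from \<open>B\<^sup>2 \<ge> 0\<close>, and in the listed range \<open>v\<close> reaches the axis \<open>v = 0\<close> exactly for \<open>J = 0\<close>.

  This gives existence, continuity in \<open>J\<close> (lemmas \<open>explicit_solution\<close>, \<open>continuous_on_explicit\<close>) and
  uniqueness (lemma \<open>rigidity\<close>): every solution is a piece of a shifted explicit one, so every maximal
  solution is a shifted explicit one. Conversely, the angle of a unit speed curve is a lift of its unit
  tangent, and a computation of the mean curvature shows that it obeys the generating equations
  (lemma \<open>cmc_curve_is_solution\<close>). For \<open>\<kappa> > 0\<close> and \<open>J < -2 H / \<kappa>\<close> the isometry exchanging the two
  axes leads back to the range that is listed.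

  The geometry is read off from the explicit solution. For \<open>J \<ge> 0\<close> the product
  \<open>sn r sin \<sigma> = J + 2 H v\<close> is positive, hence the height increases; this excludes periods of the
  curve and self-intersections when the orbits are circles. For \<open>J = 0\<close> a factor \<open>v\<close> cancels in the
  derivative of the height, so the curve extends to two end points on the axis; the end points are at
  finite distance, and a lower bound of lengths by differences of radii shows that the surface is
  incomplete. For \<open>J < 0\<close> the angle increases; it gains exactly \<open>2 \<pi>\<close> in one cycle of \<open>v\<close>
  (lemma \<open>angle_cycle\<close>), so the vertical period is the gain of height in one cycle. If it vanishes,
  the height is an odd cycle-periodic function whose derivative has a single zero in half a cycle, and
  Rolle's theorem shows that the loop is simple (lemmas \<open>height_zero_free\<close>, \<open>height_zero_cycle\<close>).

  The topological types follow from the product of the covering \<open>t \<mapsto> cis t\<close> of the circle by the line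
  with itself and with identity maps.
\<close>

section \<open>Generalised trigonometric functions and the versine\<close>

text \<open>
  The generalised versine \<open>(1 - cs r) / \<kappa>\<close>, written in a form that is also correct for \<open>\<kappa> = 0\<close>.
\<close>

definition vers :: "real \<Rightarrow> real \<Rightarrow> real" where
  "vers \<kappa> r = 2 * (sn \<kappa> (r / 2))\<^sup>2"

text \<open>
  The inverse of the versine. The formulas are explicit because continuity up to \<open>q = 0\<close>, that is, up to
  the axis, is needed for the sphere type surfaces.
\<close>

definition rad :: "real \<Rightarrow> real \<Rightarrow> real" where
  "rad \<kappa> q = (if \<kappa> > 0 then arccos (1 - \<kappa> * q) / sqrt \<kappa>
               else if \<kappa> = 0 then sqrt (2 * q)
               else arcosh (1 - \<kappa> * q) / sqrt (- \<kappa>))"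

lemma cs_vers: "cs \<kappa> r = 1 - \<kappa> * vers \<kappa> r"
proof -
  consider "\<kappa> > 0" | "\<kappa> = 0" | "\<kappa> < 0" by linarith
  then show ?thesis
  proof cases
    case 1
    then show ?thesis
      using cos_double_sin[of "sqrt \<kappa> * r / 2"]
      by (simp add: cs_def vers_def sn_def power_divide)
  next
    case 2
    then show ?thesis by (simp add: cs_def)
  next
    case 3
    have "cosh (sqrt (- \<kappa>) * r) = 1 + 2 * (sinh (sqrt (- \<kappa>) * r / 2))\<^sup>2"
      using cosh_double[of "sqrt (- \<kappa>) * r / 2"] cosh_square_eq[of "sqrt (- \<kappa>) * r / 2"] by simp
    with 3 show ?thesis by (simp add: cs_def vers_def sn_def power_divide)
  qed
qed

lemma DERIV_sn [derivative_intros]: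
  assumes "(f has_real_derivative f') (at x within S)"
  shows "((\<lambda>x. sn \<kappa> (f x)) has_real_derivative cs \<kappa> (f x) * f') (at x within S)"
proof -
  have 1: "(sn \<kappa> has_real_derivative cs \<kappa> y) (at y)" for y
  proof -
    consider "\<kappa> > 0" | "\<kappa> = 0" | "\<kappa> < 0" by linarith
    then show ?thesis
    proof cases
      case 1
      have "((\<lambda>y. sin (sqrt \<kappa> * y) / sqrt \<kappa>) has_real_derivative cos (sqrt \<kappa> * y)) (at y)"
        using 1 by (auto intro!: derivative_eq_intros simp: mult.assoc)
      with 1 show ?thesis by (simp add: sn_def[abs_def] cs_def)
    next
      case 2
      then show ?thesis by (simp add: sn_def[abs_def] cs_def)
    next
      case 3
      have "((\<lambda>y. sinh (sqrt (- \<kappa>) * y) / sqrt (- \<kappa>)) has_real_derivative cosh (sqrt (- \<kappa>) * y)) (at y)"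
        using 3 by (auto intro!: derivative_eq_intros simp: mult.assoc)
      with 3 show ?thesis by (simp add: sn_def[abs_def] cs_def)
    qed
  qed
  show ?thesis using DERIV_chain2[OF 1 assms] .
qed

lemma DERIV_cs [derivative_intros]:
  assumes "(f has_real_derivative f') (at x within S)"
  shows "((\<lambda>x. cs \<kappa> (f x)) has_real_derivative - \<kappa> * sn \<kappa> (f x) * f') (at x within S)"
proof -
  have 1: "(cs \<kappa> has_real_derivative - \<kappa> * sn \<kappa> y) (at y)" for y
  proof -
    consider "\<kappa> > 0" | "\<kappa> = 0" | "\<kappa> < 0" by linarith
    then show ?thesis
    proof cases
      case 1
      have *: "\<kappa> * (sin (sqrt \<kappa> * y) / sqrt \<kappa>) = sqrt \<kappa> * sin (sqrt \<kappa> * y)"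
        using 1 by (simp add: field_simps)
      have "((\<lambda>y. cos (sqrt \<kappa> * y)) has_real_derivative - \<kappa> * (sin (sqrt \<kappa> * y) / sqrt \<kappa>)) (at y)"
        unfolding minus_mult_left[symmetric] * by (auto intro!: derivative_eq_intros)
      with 1 show ?thesis by (simp add: sn_def cs_def[abs_def])
    next
      case 2
      then show ?thesis by (simp add: sn_def cs_def[abs_def])
    next
      case 3
      have *: "- \<kappa> * (sinh (sqrt (- \<kappa>) * y) / sqrt (- \<kappa>)) = sqrt (- \<kappa>) * sinh (sqrt (- \<kappa>) * y)"
      proof -
        have "- \<kappa> / sqrt (- \<kappa>) = sqrt (- \<kappa>)" using 3 by (intro real_div_sqrt) simp
        then show ?thesis by (metis times_divide_eq_left times_divide_eq_right)
      qed
      have "((\<lambda>y. cosh (sqrt (- \<kappa>) * y)) has_real_derivative - \<kappa> * (sinh (sqrt (- \<kappa>) * y) / sqrt (- \<kappa>))) (at y)"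
        unfolding * by (auto intro!: derivative_eq_intros)
      with 3 show ?thesis by (simp add: sn_def cs_def[abs_def])
    qed
  qed
  show ?thesis using DERIV_chain2[OF 1 assms] .
qed

lemma sn_double: "sn \<kappa> r = 2 * sn \<kappa> (r / 2) * cs \<kappa> (r / 2)"
  using sin_double[of "sqrt \<kappa> * r / 2"] sinh_double[of "sqrt (- \<kappa>) * r / 2"]
  by (auto simp: sn_def cs_def)

lemma cs_sn_squared: "(cs \<kappa> r)\<^sup>2 + \<kappa> * (sn \<kappa> r)\<^sup>2 = 1"
  by (auto simp: sn_def cs_def power_divide cosh_square_eq)

lemma DERIV_vers [derivative_intros]:
  assumes "(f has_real_derivative f') (at x within S)"
  shows "((\<lambda>x. vers \<kappa> (f x)) has_real_derivative sn \<kappa> (f x) * f') (at x within S)"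
proof -
  have 1: "(vers \<kappa> has_real_derivative sn \<kappa> y) (at y)" for y
    unfolding vers_def[abs_def] using sn_double[of \<kappa> y] by (auto intro!: derivative_eq_intros)
  show ?thesis using DERIV_chain2[OF 1 assms] .
qed

text \<open>
  This identity and \<open>cs_vers\<close> make the orbit system algebraic in the versine: \<open>cs\<close> and \<open>sn\<^sup>2\<close> are
  polynomials in it.
\<close>

lemma sn_squared: "(sn \<kappa> r)\<^sup>2 = vers \<kappa> r * (2 - \<kappa> * vers \<kappa> r)"
proof -
  have "(sn \<kappa> r)\<^sup>2 = 4 * (sn \<kappa> (r/2))\<^sup>2 * (1 - \<kappa> * (sn \<kappa> (r/2))\<^sup>2)"
    using cs_sn_squared[of \<kappa> "r/2"] by (subst sn_double) (simp add: power_mult_distrib eq_diff_eq)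
  then show ?thesis by (simp add: vers_def algebra_simps power2_eq_square)
qed

lemma sn_pos: "r \<in> I \<kappa> \<Longrightarrow> 0 < sn \<kappa> r"
  by (auto simp: I_def sn_def field_simps split: if_splits intro!: divide_pos_pos sin_gt_zero)

lemma half_in_I: "r \<in> I \<kappa> \<Longrightarrow> r / 2 \<in> I \<kappa>"
proof -
  have "0 < pi / sqrt \<kappa>" if "0 < \<kappa>" using that by simp
  then show "r \<in> I \<kappa> \<Longrightarrow> r / 2 \<in> I \<kappa>" unfolding I_def by (smt (verit) field_sum_of_halves greaterThanLessThan_iff greaterThan_iff)
qed

lemma vers_pos: "r \<in> I \<kappa> \<Longrightarrow> 0 < vers \<kappa> r"
  using sn_pos[OF half_in_I, of r \<kappa>] by (simp add: vers_def)

lemma rad_vers: "r \<in> I \<kappa> \<Longrightarrow> rad \<kappa> (vers \<kappa> r) = r"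
proof -
  assume r: "r \<in> I \<kappa>"
  consider "\<kappa> > 0" | "\<kappa> = 0" | "\<kappa> < 0" by linarith
  then show ?thesis
  proof cases
    case 1
    have "arccos (cos (sqrt \<kappa> * r)) = sqrt \<kappa> * r"
      using r 1 by (intro arccos_cos) (auto simp: I_def field_simps)
    then show ?thesis using 1 cs_vers[of \<kappa> r] by (simp add: rad_def cs_def)
  next
    case 2
    then show ?thesis using r by (simp add: rad_def vers_def sn_def I_def power_divide)
  next
    case 3
    have "arcosh (cosh (sqrt (- \<kappa>) * r)) = sqrt (- \<kappa>) * r"
      using r 3 by (intro arcosh_cosh_real) (auto simp: I_def)
    then show ?thesis using 3 cs_vers[of \<kappa> r] by (simp add: rad_def cs_def)
  qed
qed

lemma rad_in_I: assumes "0 < q" "\<kappa> * q < 2" shows "rad \<kappa> q \<in> I \<kappa>"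
proof -
  consider "\<kappa> > 0" | "\<kappa> = 0" | "\<kappa> < 0" by linarith
  then show ?thesis
  proof cases
    case 1
    have "0 < \<kappa> * q" using 1 assms by simp
    then have "0 < arccos (1 - \<kappa> * q)" "arccos (1 - \<kappa> * q) < pi"
      using arccos_lt_bounded[of "1 - \<kappa> * q"] assms by auto
    then show ?thesis using 1 by (auto simp: rad_def I_def field_simps)
  next
    case 2
    then show ?thesis using assms by (simp add: rad_def I_def)
  next
    case 3
    have "\<kappa> * q < 0" using 3 assms by (simp add: mult_neg_pos)
    then have "arcosh 1 < arcosh (1 - \<kappa> * q)" by (subst arcosh_less_iff_real) auto
    then show ?thesis using 3 by (auto simp: rad_def I_def)
  qed
qed

lemma vers_rad: assumes "0 \<le> q" "\<kappa> * q \<le> 2" shows "vers \<kappa> (rad \<kappa> q) = q"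
proof -
  consider "\<kappa> > 0" | "\<kappa> = 0" | "\<kappa> < 0" by linarith
  then show ?thesis
  proof cases
    case 1
    then have "0 \<le> \<kappa> * q" using assms by simp
    then have "cs \<kappa> (rad \<kappa> q) = 1 - \<kappa> * q" using 1 assms by (simp add: rad_def cs_def)
    then show ?thesis using 1 by (simp add: cs_vers)
  next
    case 2
    then show ?thesis using assms by (simp add: rad_def vers_def sn_def power_divide)
  next
    case 3
    then have "\<kappa> * q \<le> 0" using assms by (simp add: mult_nonpos_nonneg)
    then have "cs \<kappa> (rad \<kappa> q) = 1 - \<kappa> * q" using 3 by (simp add: rad_def cs_def)
    then show ?thesis using 3 by (simp add: cs_vers)
  qed
qed

lemma continuous_on_rad: "continuous_on {q. 0 \<le> q \<and> \<kappa> * q \<le> 2} (rad \<kappa>)"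
proof -
  consider "\<kappa> > 0" | "\<kappa> = 0" | "\<kappa> < 0" by linarith
  then show ?thesis
  proof cases
    case 1
    then show ?thesis unfolding rad_def[abs_def]
      by (auto intro!: continuous_intros)
  next
    case 2
    then show ?thesis unfolding rad_def[abs_def] by (auto intro!: continuous_intros)
  next
    case 3
    then show ?thesis unfolding rad_def[abs_def]
      by (auto intro!: continuous_intros mult_nonpos_nonneg)
  qed
qed

lemma open_I: "open (I \<kappa>)" by (auto simp: I_def)

lemma rad_0: "rad \<kappa> 0 = 0"
  by (simp add: rad_def)

lemma rad_mono: assumes "0 \<le> p" "p \<le> q" "\<kappa> * q \<le> 2" shows "rad \<kappa> p \<le> rad \<kappa> q"
proof -
  consider "\<kappa> > 0" | "\<kappa> = 0" | "\<kappa> < 0" by linarith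
  then show ?thesis
  proof cases
    case 1
    then have "0 \<le> \<kappa> * p" "\<kappa> * p \<le> \<kappa> * q" using assms by auto
    then show ?thesis using 1 assms by (auto simp: rad_def intro!: divide_right_mono arccos_le_arccos)
  next
    case 2
    then show ?thesis using assms by (simp add: rad_def)
  next
    case 3
    then have "\<kappa> * q \<le> \<kappa> * p" "\<kappa> * p \<le> 0" using assms by (auto simp: mult_nonpos_nonneg)
    then have "arcosh (1 - \<kappa> * p) \<le> arcosh (1 - \<kappa> * q)"
      using arcosh_less_iff_real[of "1 - \<kappa> * p" "1 - \<kappa> * q"] by (smt (verit))
    then show ?thesis using 3 by (auto simp: rad_def divide_right_mono)
  qed
qed

lemma DERIV_rad:
  assumes "0 < q" "\<kappa> * q < 2"
  shows "(rad \<kappa> has_real_derivative 1 / sn \<kappa> (rad \<kappa> q)) (at q)"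
proof -
  let ?S = "{q. 0 < q \<and> \<kappa> * q < 2}"
  have o: "open ?S" by (intro open_Collect_conj open_Collect_less continuous_intros)
  have s: "sn \<kappa> (rad \<kappa> q) > 0" using sn_pos rad_in_I assms by blast
  have c: "isCont (rad \<kappa>) q"
  proof -
    have "continuous_on ?S (rad \<kappa>)" by (rule continuous_on_subset[OF continuous_on_rad]) auto
    then show ?thesis using o assms by (auto simp: continuous_on_eq_continuous_at)
  qed
  obtain e where e: "e > 0" "ball q e \<subseteq> ?S" using o assms open_contains_ball by blast
  have "(rad \<kappa> has_real_derivative inverse (sn \<kappa> (rad \<kappa> q))) (at q)"
  proof (rule DERIV_inverse_function[where f = "vers \<kappa>" and a = "q - e" and b = "q + e"])
    show "(vers \<kappa> has_real_derivative sn \<kappa> (rad \<kappa> q)) (at (rad \<kappa> q))"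
      using DERIV_vers[OF DERIV_ident] by simp
    show "vers \<kappa> (rad \<kappa> y) = y" if "q - e < y" "y < q + e" for y
    proof -
      have "y \<in> ?S" using e that by (auto simp: subset_iff dist_real_def abs_less_iff)
      then show ?thesis by (simp add: vers_rad)
    qed
  qed (use s c e in auto)
  then show ?thesis by (simp add: inverse_eq_divide)
qed

lemma energy_vers: "energy \<kappa> H r \<sigma> = sn \<kappa> r * sin \<sigma> - 2 * H * vers \<kappa> r"
proof (cases "\<kappa> = 0")
  case True
  then show ?thesis by (simp add: energy_def sn_def vers_def power_divide)
next
  case False
  then show ?thesis by (simp add: energy_def cs_vers)
qed

text \<open>
  The derivative of \<open>ct\<close> is \<open>- 1 / sn\<^sup>2\<close>.
\<close>

lemma ct_inj: "inj_on (ct \<kappa>) (I \<kappa>)"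
proof (rule inj_onI)
  fix x y assume x: "x \<in> I \<kappa>" and y: "y \<in> I \<kappa>" and e: "ct \<kappa> x = ct \<kappa> y"
  have D: "(ct \<kappa> has_real_derivative - 1 / (sn \<kappa> r)\<^sup>2) (at r)" if "r \<in> I \<kappa>" for r
  proof -
    have "((\<lambda>r. cs \<kappa> r / sn \<kappa> r) has_real_derivative
        (- \<kappa> * sn \<kappa> r * 1 * sn \<kappa> r - cs \<kappa> r * (cs \<kappa> r * 1)) / (sn \<kappa> r * sn \<kappa> r)) (at r)"
      using sn_pos[OF that] by (intro derivative_intros) auto
    moreover have "- \<kappa> * sn \<kappa> r * 1 * sn \<kappa> r - cs \<kappa> r * (cs \<kappa> r * 1) = -1"
      using cs_sn_squared[of \<kappa> r] by (simp add: power2_eq_square)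
    ultimately show ?thesis unfolding ct_def[abs_def] power2_eq_square by simp
  qed
  have F: False if "u < v" "u \<in> I \<kappa>" "v \<in> I \<kappa>" "ct \<kappa> u = ct \<kappa> v" for u v
  proof -
    have "ct \<kappa> v < ct \<kappa> u"
    proof (rule DERIV_neg_imp_decreasing[OF \<open>u < v\<close>])
      fix r assume "u \<le> r" "r \<le> v"
      then have "r \<in> I \<kappa>" using that by (auto simp: I_def split: if_splits)
      then show "\<exists>d. (ct \<kappa> has_real_derivative d) (at r) \<and> d < 0" using D sn_pos by fastforce
    qed
    then show False using that by simp
  qed
  show "x = y" using F[of x y] F[of y x] x y e by (metis linorder_neqE_linordered_idom)
qed



lemma W_eq: assumes "r \<in> I \<kappa>"
  shows "W \<kappa> \<tau> a r = sqrt ((sn \<kappa> r)\<^sup>2 + (2 * \<tau> * vers \<kappa> r - a)\<^sup>2) / sn \<kappa> r"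
  using sn_pos[OF assms] by (simp add: W_def vers_def real_sqrt_divide algebra_simps)

lemma W_squared: assumes "r \<in> I \<kappa>"
  shows "(W \<kappa> \<tau> a r)\<^sup>2 = 1 + (2 * \<tau> * vers \<kappa> r - a)\<^sup>2 / (sn \<kappa> r)\<^sup>2"
  using sn_pos[OF assms] by (simp add: W_eq[OF assms] power_divide add_divide_distrib)

lemma W_pos: assumes "r \<in> I \<kappa>" shows "0 < W \<kappa> \<tau> a r"
  using sn_pos[OF assms] by (auto simp: W_eq[OF assms] intro!: divide_pos_pos add_pos_nonneg)

lemma DERIV_W: assumes "r \<in> I \<kappa>"
  shows "(W \<kappa> \<tau> a has_real_derivative
     (2 * \<tau> * vers \<kappa> r - a) * (2 * \<tau> - (2 * \<tau> * vers \<kappa> r - a) * cs \<kappa> r / (sn \<kappa> r)\<^sup>2)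
        / (sn \<kappa> r * W \<kappa> \<tau> a r)) (at r)"
proof -
  let ?f = "\<lambda>r. sqrt (1 + (2 * \<tau> * vers \<kappa> r - a)\<^sup>2 / (sn \<kappa> r)\<^sup>2)"
  have eq: "W \<kappa> \<tau> a s = ?f s" if "s \<in> I \<kappa>" for s
    using W_squared[OF that] W_pos[OF that] by (metis real_sqrt_abs abs_of_pos)
  have "(?f has_real_derivative (2 * \<tau> * vers \<kappa> r - a) * (2 * \<tau> - (2 * \<tau> * vers \<kappa> r - a) * cs \<kappa> r / (sn \<kappa> r)\<^sup>2)
        / (sn \<kappa> r * ?f r)) (at r)"
  proof -
    let ?p = "2 * \<tau> * vers \<kappa> r - a" and ?s = "sn \<kappa> r" and ?c = "cs \<kappa> r"
    let ?X = "1 + ?p\<^sup>2 / ?s\<^sup>2"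
    have s: "?s > 0" by (rule sn_pos[OF assms])
    have X: "((\<lambda>r. 1 + (2 * \<tau> * vers \<kappa> r - a)\<^sup>2 / (sn \<kappa> r)\<^sup>2) has_real_derivative
        (2 * ?p * (2 * \<tau> * ?s) * ?s\<^sup>2 - ?p\<^sup>2 * (2 * ?s * ?c)) / (?s\<^sup>2 * ?s\<^sup>2)) (at r)"
      using s by (auto intro!: derivative_eq_intros)
    have "?X > 0" by (simp add: add_pos_nonneg)
    from DERIV_chain2[OF DERIV_real_sqrt[OF this] X] have "(?f has_real_derivative
        (2 * ?p * (2 * \<tau> * ?s) * ?s\<^sup>2 - ?p\<^sup>2 * (2 * ?s * ?c)) / (?s\<^sup>2 * ?s\<^sup>2) / (2 * ?f r)) (at r)"
      by (simp only: divide_inverse inverse_mult_distrib ac_simps)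
    moreover have "(2 * ?p * (2 * \<tau> * ?s) * ?s\<^sup>2 - ?p\<^sup>2 * (2 * ?s * ?c)) / (?s\<^sup>2 * ?s\<^sup>2)
        = 2 * (?p * (2 * \<tau> - ?p * ?c / ?s\<^sup>2) / ?s)"
      using s by (simp add: divide_simps) (simp add: algebra_simps power2_eq_square power4_eq_xxxx)
    ultimately have "(?f has_real_derivative
        2 * (?p * (2 * \<tau> - ?p * ?c / ?s\<^sup>2) / ?s) / (2 * ?f r)) (at r)"
      by (simp only:)
    then show ?thesis
      by (simp only: mult_divide_mult_cancel_left_if divide_divide_eq_left) simp
  qed
  then have "(?f has_real_derivative
     (2 * \<tau> * vers \<kappa> r - a) * (2 * \<tau> - (2 * \<tau> * vers \<kappa> r - a) * cs \<kappa> r / (sn \<kappa> r)\<^sup>2)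
        / (sn \<kappa> r * W \<kappa> \<tau> a r)) (at r)"
    unfolding eq[OF assms] .
  then show ?thesis
    by (rule has_field_derivative_transform_within_open[OF _ open_I assms]) (use eq in metis)
qed

section \<open>Mean curvature of an invariant surface\<close>

lemma vector_3_axis:
  "(vector [x, y, z] :: real^3) = x *\<^sub>R axis 1 1 + y *\<^sub>R axis 2 1 + z *\<^sub>R axis 3 1"
  by (simp add: vec_eq_iff forall_3 axis_def)

lemma has_vector_derivative_vector_3:
  assumes "(f has_real_derivative f') (at t)" "(g has_real_derivative g') (at t)"
    "(h has_real_derivative h') (at t)"
  shows "((\<lambda>t. vector [f t, g t, h t] :: real^3) has_vector_derivative vector [f', g', h']) (at t)"
  unfolding vector_3_axis
  using assms by (auto intro!: derivative_eq_intros simp: has_real_derivative_iff_has_vector_derivative)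

lemma gen_coord_eq: "gen_coord a \<gamma> p = vector [fst (\<gamma> (fst p)), snd p, snd (\<gamma> (fst p)) + a * snd p]"
  by (simp add: gen_coord_def screw_def)

lemma metric_eq:
  "metric \<kappa> \<tau> x u v = u$1 * v$1 + (sn \<kappa> (x$1))\<^sup>2 * (u$2 * v$2)
     + (2 * \<tau> * vers \<kappa> (x$1) * u$2 - u$3) * (2 * \<tau> * vers \<kappa> (x$1) * v$2 - v$3)"
  by (simp add: metric_def vers_def mult.assoc)

lemma metric_deriv_eq:
  "metric_deriv \<kappa> \<tau> x u v w =
     u$1 * (2 * sn \<kappa> (x$1) * cs \<kappa> (x$1) * (v$2 * w$2)
       + 2 * \<tau> * sn \<kappa> (x$1) * v$2 * (2 * \<tau> * vers \<kappa> (x$1) * w$2 - w$3)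
       + 2 * \<tau> * sn \<kappa> (x$1) * w$2 * (2 * \<tau> * vers \<kappa> (x$1) * v$2 - v$3))"
  unfolding metric_deriv_def metric_eq
  by (rule DERIV_imp_deriv) (auto intro!: derivative_eq_intros simp: algebra_simps)

text \<open>
  Here \<open>c\<close>, \<open>d\<close> are the cosine and sine of the angle, \<open>s\<close> is \<open>sn\<close>, \<open>w\<close> is \<open>W\<close>, \<open>p\<close> is the twist
  \<open>2 \<tau> v - a\<close>, and \<open>n\<close>, \<open>k\<close>, \<open>m\<close> are the \<open>dr\<close>-, \<open>d\<theta>\<close>- and fibre components of a normal. Orthogonality
  leaves a multiple \<open>e\<close> of one vector, the length gives \<open>e = 1\<close> or \<open>e = -1\<close>, and the orientation
  selects the sign.
\<close>

lemma unit_normal_algebra: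
  fixes c d m n k w s p :: real
  assumes "c\<^sup>2 + d\<^sup>2 = 1" "0 < s" "0 < w" "w\<^sup>2 = 1 + p\<^sup>2 / s\<^sup>2"
    "n * c = m * w * d" "s\<^sup>2 * k + m * p = 0" "n\<^sup>2 + s\<^sup>2 * k\<^sup>2 + m\<^sup>2 = 1"
    "- c * m * w\<^sup>2 - w * d * n > 0"
  shows "n = - d" "m = - c / w" "k = c * p / (w * s\<^sup>2)"
proof -
  define e where "e = n * d + m * w * c"
  have k: "k = - m * p / s\<^sup>2" using assms(2,6) by (simp add: field_simps)
  have "n\<^sup>2 + (m * w)\<^sup>2 = 1"
    using assms(2,7) unfolding k power_mult_distrib assms(4) by (simp add: field_simps power2_eq_square)
  moreover have n: "n = d * e"
  proof -
    have "n = n * (c\<^sup>2 + d\<^sup>2)" using assms by simp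
    also have "\<dots> = c * (n * c) + n * d\<^sup>2" by (simp add: power2_eq_square algebra_simps)
    also have "\<dots> = d * e" unfolding assms(5) by (simp add: e_def power2_eq_square algebra_simps)
    finally show ?thesis .
  qed
  moreover have m: "m * w = c * e"
  proof -
    have "m * w = m * w * (c\<^sup>2 + d\<^sup>2)" using assms by simp
    also have "\<dots> = m * w * c\<^sup>2 + d * (m * w * d)" by (simp add: power2_eq_square algebra_simps)
    also have "\<dots> = c * e" unfolding assms(5)[symmetric] by (simp add: e_def power2_eq_square algebra_simps)
    finally show ?thesis .
  qed
  ultimately have "e\<^sup>2 * (c\<^sup>2 + d\<^sup>2) = 1" by (simp add: power_mult_distrib algebra_simps)
  then have "e\<^sup>2 = 1" using assms by simp
  moreover have "- w * e > 0" using assms(8) by (simp add: e_def power2_eq_square algebra_simps)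
  then have "e < 0" using assms(3) by (simp add: mult_less_0_iff)
  ultimately have "e = -1" by (auto simp: power2_eq_1_iff)
  then show "n = - d" "m = - c / w" using n m assms(3) by (simp_all add: field_simps)
  then show "k = c * p / (w * s\<^sup>2)" using k by simp
qed

text \<open>
  The quotient of the second and first fundamental forms. The notation is that of the previous lemma, except
  that \<open>k\<close> is now the derivative of the twist and \<open>l\<close> the \<open>d\<theta>\<close>-component of the normal; \<open>C\<close> is \<open>cs\<close>,
  \<open>x\<close> the derivative of the angle and \<open>wr\<close> the derivative of \<open>W\<close>. All terms containing \<open>k\<close> cancel, and
  the area factor \<open>w\<^sup>2 s\<^sup>2\<close> divides out.
\<close>

lemma mean_curvature_algebra:
  fixes c d s w p k C x :: real
  assumes "c\<^sup>2 + d\<^sup>2 = 1" "0 < s" "0 < w" "w\<^sup>2 = 1 + p\<^sup>2 / s\<^sup>2"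
    "wr = (p * k - p\<^sup>2 * C / s) / (s\<^sup>2 * w)" "n = - d" "m = - c / w" "l = c * p / (w * s\<^sup>2)"
    "b11 = - (d * x) * n - (wr * c * d + w * (c * x)) * m - c * (w * d) * k * l"
    "b12 = (c * (2 * s * C * l + k * m + k * l * p) + n * k * (w * d)) / 2"
    "b22 = - n * (s * C + k * p)"
  shows "(b11 * (s\<^sup>2 + p\<^sup>2) - 2 * b12 * (- (w * d * p)) + b22 * (c\<^sup>2 + (w * d)\<^sup>2))
     / (2 * ((c\<^sup>2 + (w * d)\<^sup>2) * (s\<^sup>2 + p\<^sup>2) - (- (w * d * p))\<^sup>2)) = (x + C / s * d) / 2"
proof -
  have w2: "w\<^sup>2 * s\<^sup>2 = s\<^sup>2 + p\<^sup>2" using assms(2,4) by (simp add: field_simps)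
  have c2: "c\<^sup>2 = 1 - d\<^sup>2" using assms(1) by simp
  have den: "(c\<^sup>2 + (w * d)\<^sup>2) * (s\<^sup>2 + p\<^sup>2) - (- (w * d * p))\<^sup>2 = w\<^sup>2 * s\<^sup>2"
  proof -
    have "(c\<^sup>2 + (w * d)\<^sup>2) * (s\<^sup>2 + p\<^sup>2) - (- (w * d * p))\<^sup>2 = c\<^sup>2 * (s\<^sup>2 + p\<^sup>2) + w\<^sup>2 * s\<^sup>2 * d\<^sup>2"
      by (simp add: power2_eq_square algebra_simps)
    also have "\<dots> = w\<^sup>2 * s\<^sup>2" unfolding w2[symmetric] c2 by (simp add: algebra_simps)
    finally show ?thesis .
  qed
  have b11: "b11 = x + c\<^sup>2 * d * ((p * k - p\<^sup>2 * C / s) / (w\<^sup>2 * s\<^sup>2) - k * p / s\<^sup>2)"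
  proof -
    have "b11 = (c\<^sup>2 + d\<^sup>2) * x + c\<^sup>2 * d * ((p * k - p\<^sup>2 * C / s) / (w\<^sup>2 * s\<^sup>2) - k * p / s\<^sup>2)"
      unfolding assms(5-9) using assms(2,3) by (simp add: divide_simps) (simp add: algebra_simps power2_eq_square)
    then show ?thesis using assms(1) by simp
  qed
  have b12: "2 * b12 * w = c\<^sup>2 * (2 * C * p / s - k + k * p\<^sup>2 / s\<^sup>2) - d\<^sup>2 * k * w\<^sup>2"
    unfolding assms(6-8,10) using assms(2,3) by (simp add: divide_simps) (simp add: algebra_simps power2_eq_square)
  have e1: "b11 * (s\<^sup>2 + p\<^sup>2) = x * (w\<^sup>2 * s\<^sup>2) + c\<^sup>2 * d * (p * k - p\<^sup>2 * C / s - k * p * w\<^sup>2)"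
    unfolding b11 w2[symmetric] using assms(2,3) by (simp add: divide_simps)
  have "b11 * (s\<^sup>2 + p\<^sup>2) - 2 * b12 * (- (w * d * p)) + b22 * (c\<^sup>2 + (w * d)\<^sup>2)
     = b11 * (s\<^sup>2 + p\<^sup>2) + d * p * (2 * b12 * w) + b22 * (c\<^sup>2 + (w * d)\<^sup>2)"
    by (simp add: algebra_simps)
  also have "\<dots> = (x + C / s * d) * (w\<^sup>2 * s\<^sup>2)"
    unfolding e1 b12 assms(11) assms(6) power_mult_distrib c2 assms(4)
    using assms(2) by (simp add: divide_simps) (simp add: algebra_simps power2_eq_square)
  finally show ?thesis unfolding den using assms(2,3) by simp
qed

lemma pd1_gen_coord:
  assumes "((\<lambda>s. fst (\<gamma> s)) has_real_derivative r') (at t)"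
    "((\<lambda>s. snd (\<gamma> s)) has_real_derivative h') (at t)"
  shows "pd1 (gen_coord a \<gamma>) (t, \<phi>) = vector [r', 0, h']"
  unfolding pd1_def gen_coord_eq
  by (rule vector_derivative_at, rule has_vector_derivative_vector_3)
     (use assms in \<open>auto intro!: derivative_eq_intros\<close>)

lemma pd2_gen_coord: "pd2 (gen_coord a \<gamma>) p = vector [0, 1, a]"
  unfolding pd2_def gen_coord_eq
  by (rule vector_derivative_at, rule has_vector_derivative_vector_3)
     (auto intro!: derivative_eq_intros)

text \<open>
  The normal is determined by its three equations and the orientation, so the mean curvature can be
  computed from the explicit components. It is half of \<open>\<sigma>' + ct sin \<sigma>\<close>, which is where the third
  generating equation comes from.
\<close>

lemma mean_curvature_gen_coord:
  assumes "open D" "t \<in> D"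
    and r: "\<And>s. s \<in> D \<Longrightarrow> ((\<lambda>s. fst (\<gamma> s)) has_real_derivative cos (\<sigma> s)) (at s)"
    and h: "\<And>s. s \<in> D \<Longrightarrow> ((\<lambda>s. snd (\<gamma> s)) has_real_derivative W \<kappa> \<tau> a (fst (\<gamma> s)) * sin (\<sigma> s)) (at s)"
    and I: "fst (\<gamma> t) \<in> I \<kappa>" and \<sigma>: "(\<sigma> has_real_derivative \<sigma>') (at t)"
  shows "\<exists>N. is_unit_normal \<kappa> \<tau> (gen_coord a \<gamma>) (t, \<phi>) N"
    and "is_unit_normal \<kappa> \<tau> (gen_coord a \<gamma>) (t, \<phi>) N \<Longrightarrow>
      mean_curvature \<kappa> \<tau> (gen_coord a \<gamma>) (t, \<phi>) N = (\<sigma>' + ct \<kappa> (fst (\<gamma> t)) * sin (\<sigma> t)) / 2"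
proof -
  let ?Y = "gen_coord a \<gamma>"
  define s where "s = sn \<kappa> (fst (\<gamma> t))"
  define C where "C = cs \<kappa> (fst (\<gamma> t))"
  define w where "w = W \<kappa> \<tau> a (fst (\<gamma> t))"
  define P where "P = 2 * \<tau> * vers \<kappa> (fst (\<gamma> t))"
  define p where "p = P - a"
  define c where "c = cos (\<sigma> t)"
  define d where "d = sin (\<sigma> t)"
  define k where "k = 2 * \<tau> * s"
  define wr where "wr = (p * k - p\<^sup>2 * C / s) / (s\<^sup>2 * w)"
  have pos: "0 < s" "0 < w" using sn_pos[OF I] W_pos[OF I] by (auto simp: s_def w_def)
  have cd: "c\<^sup>2 + d\<^sup>2 = 1" by (simp add: c_def d_def)
  have w2: "w\<^sup>2 = 1 + p\<^sup>2 / s\<^sup>2" using W_squared[OF I] by (simp add: w_def p_def s_def P_def)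
  have W': "(W \<kappa> \<tau> a has_real_derivative wr) (at (fst (\<gamma> t)))"
    using DERIV_W[OF I, of \<tau> a]
    by (rule DERIV_cong) (use pos in \<open>simp add: wr_def k_def p_def P_def flip: s_def w_def C_def\<close>,
        simp add: field_simps power2_eq_square)
  have A: "pd1 ?Y (s', \<phi>) = vector [cos (\<sigma> s'), 0, W \<kappa> \<tau> a (fst (\<gamma> s')) * sin (\<sigma> s')]" if "s' \<in> D" for s'
    by (rule pd1_gen_coord[OF r[OF that] h[OF that]])
  have A2: "pd1 (pd1 ?Y) (t, \<phi>) = vector [- (d * \<sigma>'), 0, wr * c * d + w * (c * \<sigma>')]"
  proof -
    have "((\<lambda>s. vector [cos (\<sigma> s), 0, W \<kappa> \<tau> a (fst (\<gamma> s)) * sin (\<sigma> s)] :: real^3)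
        has_vector_derivative vector [- (d * \<sigma>'), 0, wr * c * d + w * (c * \<sigma>')]) (at t)"
      using DERIV_chain2[OF W' r[OF assms(2)]]
      by (intro has_vector_derivative_vector_3)
         (auto intro!: derivative_eq_intros \<sigma> simp: c_def d_def w_def)
    from has_vector_derivative_transform_within_open[OF this assms(1,2)]
    show ?thesis unfolding pd1_def[of "pd1 ?Y"] by (auto intro!: vector_derivative_at simp: A)
  qed
  have B1: "pd1 (pd2 ?Y) q = 0" "pd2 (pd2 ?Y) q = 0" for q
    by (auto simp: pd1_def pd2_def[of "pd2 ?Y"] pd2_gen_coord intro!: vector_derivative_at)
  have Y1: "?Y (t, \<phi>) $ 1 = fst (\<gamma> t)" by (simp add: gen_coord_eq)
  have m: "metric \<kappa> \<tau> (?Y (t, \<phi>)) u v = u$1 * v$1 + s\<^sup>2 * (u$2 * v$2) + (P * u$2 - u$3) * (P * v$2 - v$3)" for u v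
    by (simp add: metric_eq Y1 s_def P_def)
  have md: "metric_deriv \<kappa> \<tau> (?Y (t, \<phi>)) u v w' =
     u$1 * (2 * s * C * (v$2 * w'$2) + k * v$2 * (P * w'$2 - w'$3) + k * w'$2 * (P * v$2 - v$3))" for u v w'
    by (simp add: metric_deriv_eq Y1 s_def P_def C_def k_def)
  note A' = A[OF assms(2), folded c_def d_def w_def]
  have un: "is_unit_normal \<kappa> \<tau> ?Y (t, \<phi>) N \<longleftrightarrow>
      (N$1)\<^sup>2 + s\<^sup>2 * (N$2)\<^sup>2 + (P * N$2 - N$3)\<^sup>2 = 1 \<and> N$1 * c = (P * N$2 - N$3) * w * d \<and>
      s\<^sup>2 * N$2 + (P * N$2 - N$3) * p = 0 \<and>
      - c * (P * N$2 - N$3) + c * p * N$2 - w * d * N$1 > 0" for N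
    unfolding is_unit_normal_def m A' pd2_gen_coord det_3
    by (simp add: power2_eq_square algebra_simps p_def)
  have un2: "is_unit_normal \<kappa> \<tau> ?Y (t, \<phi>) N \<longleftrightarrow>
      (N$1)\<^sup>2 + s\<^sup>2 * (N$2)\<^sup>2 + (P * N$2 - N$3)\<^sup>2 = 1 \<and> N$1 * c = (P * N$2 - N$3) * w * d \<and>
      s\<^sup>2 * N$2 + (P * N$2 - N$3) * p = 0 \<and>
      - c * (P * N$2 - N$3) * w\<^sup>2 - w * d * N$1 > 0" for N
  proof -
    have "- c * (P * N$2 - N$3) * w\<^sup>2 = - c * (P * N$2 - N$3) + c * p * N$2"
      if "s\<^sup>2 * N$2 + (P * N$2 - N$3) * p = 0"
    proof -
      have "(P * N$2 - N$3) * (p\<^sup>2 / s\<^sup>2) = - p * N$2"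
        using that pos(1) by (simp add: field_simps power2_eq_square) algebra
      then have "c * ((P * N$2 - N$3) * (p\<^sup>2 / s\<^sup>2)) = c * (- p * N$2)" by simp
      then show ?thesis unfolding w2 distrib_left by (simp add: mult.assoc)
    qed
    then show ?thesis unfolding un by (auto simp: p_def algebra_simps)
  qed
  show "\<exists>N. is_unit_normal \<kappa> \<tau> ?Y (t, \<phi>) N"
  proof
    let ?l = "c * p / (w * s\<^sup>2)"
    let ?N = "vector [- d, ?l, P * ?l + c / w] :: real^3"
    have "d\<^sup>2 + s\<^sup>2 * ?l\<^sup>2 + (c / w)\<^sup>2 = d\<^sup>2 + c\<^sup>2 * (1 + p\<^sup>2 / s\<^sup>2) / w\<^sup>2"
      using pos by (simp add: field_simps power2_eq_square)
    also have "\<dots> = 1" using pos cd unfolding w2[symmetric] by (simp add: add.commute)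
    finally have 1: "d\<^sup>2 + s\<^sup>2 * ?l\<^sup>2 + (c / w)\<^sup>2 = 1" .
    have 2: "c * (c / w) * w\<^sup>2 + w * d * d = w * (c\<^sup>2 + d\<^sup>2)" using pos by (simp add: power2_eq_square algebra_simps)
    show "is_unit_normal \<kappa> \<tau> ?Y (t, \<phi>) ?N"
      unfolding un2 using 1 2 cd pos by (simp add: field_simps)
  qed
  assume "is_unit_normal \<kappa> \<tau> ?Y (t, \<phi>) N"
  note un3 = this[unfolded un2]
  define M where "M = P * N$2 - N$3"
  have N: "N$1 = - d" "M = - c / w" "N$2 = c * p / (w * s\<^sup>2)"
    by (rule unit_normal_algebra[OF cd pos w2, of "N$1" M "N$2"]; use un3 in \<open>simp add: M_def\<close>)+
  have G: "c * c + (- (w * d)) * (- (w * d)) = c\<^sup>2 + (w * d)\<^sup>2" by (simp add: power2_eq_square)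
  have ct: "ct \<kappa> (fst (\<gamma> t)) = C / s" by (simp add: ct_def C_def s_def)
  show "mean_curvature \<kappa> \<tau> ?Y (t, \<phi>) N = (\<sigma>' + ct \<kappa> (fst (\<gamma> t)) * sin (\<sigma> t)) / 2"
    unfolding ct d_def[symmetric]
    unfolding mean_curvature_algebra[OF cd pos w2 wr_def N(1,2,3) refl refl refl, symmetric]
    unfolding mean_curvature_def Let_def christoffel_def m md A' A2 B1 pd2_gen_coord
    by (intro arg_cong2[where f = "(/)"] arg_cong2[where f = "(+)"] arg_cong2[where f = "(-)"] arg_cong2[where f = "(*)"] refl)
       (simp_all add: M_def p_def power2_eq_square field_simps)
qed

section \<open>Linear differential equations on an interval\<close>

text \<open>
  The antiderivative that vanishes at \<open>0\<close>, pulled back to the unit interval. In this form it is valid for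
  both signs of \<open>t\<close>, and joint continuity in \<open>t\<close> and a parameter of \<open>f\<close> follows from the continuity of
  integrals over a fixed interval.
\<close>

definition prim :: "(real \<Rightarrow> real) \<Rightarrow> real \<Rightarrow> real" where
  "prim f t = t * integral {0..1} (\<lambda>u. f (u * t))"

lemma prim_0 [simp]: "prim f 0 = 0" by (simp add: prim_def)

lemma open_interval_closed_subinterval:
  fixes D :: "real set"
  assumes "open D" "is_interval D" "x \<in> D" "y \<in> D"
  obtains a b where "a < x" "x < b" "a < y" "y < b" "{a..b} \<subseteq> D"
proof -
  obtain e where e: "e > 0" "cball (min x y) e \<subseteq> D"
    using assms open_contains_cball[of D] by (metis min_def)
  obtain d where d: "d > 0" "cball (max x y) d \<subseteq> D"
    using assms open_contains_cball[of D] by (metis max_def)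
  have "min x y - e \<in> cball (min x y) e" "max x y + d \<in> cball (max x y) d"
    using e d by (simp_all add: dist_real_def)
  then have "min x y - e \<in> D" "max x y + d \<in> D" using e d by blast+
  note mem_is_interval_1_I[OF assms(2) this]
  then have "{min x y - e..max x y + d} \<subseteq> D" by (metis atLeastAtMost_iff subsetI)
  then show ?thesis using that[of "min x y - e" "max x y + d"] e d by auto
qed

lemma DERIV_prim:
  assumes D: "open D" "is_interval D" "0 \<in> D" "t \<in> D" and f: "continuous_on D f"
  shows "(prim f has_real_derivative f t) (at t)"
proof -
  obtain a b where ab: "a < 0" "0 < b" "a < t" "t < b" "{a..b} \<subseteq> D"
    using open_interval_closed_subinterval[OF D] .
  have fc: "continuous_on {a..b} f" using f ab(5) continuous_on_subset by blast
  define F where "F x = integral {a..x} f" for x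
  have F: "(F has_vector_derivative f x) (at x within {a..b})" if "x \<in> {a..b}" for x
    unfolding F_def using integral_has_vector_derivative[OF fc that] .
  have eq: "prim f x = F x - F 0" if x: "x \<in> {a..b}" for x
  proof -
    have sub: "(\<lambda>u. u * x) ` {0..1} \<subseteq> {a..b}"
    proof (clarsimp)
      fix u :: real assume u: "0 \<le> u" "u \<le> 1"
      show "a \<le> u * x \<and> u * x \<le> b"
      proof (cases "x \<ge> 0")
        case True
        then have "0 \<le> u * x" "u * x \<le> x" using u by (simp_all add: mult_left_le_one_le)
        then show ?thesis using ab x by simp
      next
        case False
        then have "u * x \<le> 0" "1 * x \<le> u * x" using u by (simp_all add: mult_nonneg_nonpos mult_right_mono_neg)
        then show ?thesis using ab x by simp
      qed
    qed
    have "((\<lambda>u. F (u * x)) has_vector_derivative x * f (u * x)) (at u within {0..1})" if "u \<in> {0..1}" for u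
    proof -
      have 1: "((\<lambda>u. u * x) has_vector_derivative x) (at u within {0..1})"
        by (auto intro!: derivative_eq_intros simp flip: has_real_derivative_iff_has_vector_derivative)
      have 2: "(F has_vector_derivative f (u * x)) (at (u * x) within (\<lambda>u. u * x) ` {0..1})"
        using F[of "u * x"] sub that by (meson has_vector_derivative_within_subset image_subset_iff)
      show ?thesis using vector_diff_chain_within[OF 1 2] by (simp add: o_def)
    qed
    then have "((\<lambda>u. x * f (u * x)) has_integral F (1 * x) - F (0 * x)) {0..1}"
      by (intro fundamental_theorem_of_calculus) auto
    then have "integral {0..1} (\<lambda>u. x * f (u * x)) = F x - F 0" by (auto dest: integral_unique)
    then show ?thesis unfolding prim_def integral_mult_right .
  qed
  have "(F has_vector_derivative f t) (at t)"
    using F[of t] ab(3,4) by (simp add: at_within_Icc_at)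
  then have "(F has_real_derivative f t) (at t)"
    by (simp only: has_real_derivative_iff_has_vector_derivative)
  from DERIV_diff[OF this DERIV_const, of "F 0"] have "((\<lambda>x. F x - F 0) has_real_derivative f t) (at t)"
    by (simp only: diff_zero)
  then show ?thesis
    by (rule has_field_derivative_transform_within_open[of _ _ _ "{a<..<b}"]) (use ab eq in auto)
qed

lemma continuous_on_prim:
  assumes f: "continuous_on {(J, t). J \<in> A \<and> t \<in> D J} (\<lambda>(J, t). f J t)"
    and D: "\<And>J t u. J \<in> A \<Longrightarrow> t \<in> D J \<Longrightarrow> 0 \<le> u \<Longrightarrow> u \<le> 1 \<Longrightarrow> u * t \<in> D J"
  shows "continuous_on {(J, t). J \<in> A \<and> t \<in> D J} (\<lambda>(J, t). prim (f J) t)"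
proof -
  let ?S = "{(J, t). J \<in> A \<and> t \<in> D J}"
  have c: "continuous_on (?S \<times> cbox 0 1) (\<lambda>(p, u :: real). f (fst p) (u * snd p))"
  proof -
    have "continuous_on (?S \<times> cbox 0 1) (\<lambda>q. (\<lambda>(J, t). f J t) (fst (fst q), snd q * snd (fst q)))"
      by (rule continuous_on_compose2[OF f]) (auto intro!: continuous_intros D)
    then show ?thesis by (simp add: case_prod_beta)
  qed
  have "continuous_on ?S (\<lambda>p. snd p * integral (cbox 0 1) (\<lambda>u. f (fst p) (u * snd p)))"
    by (intro continuous_intros integral_continuous_on_param c)
  then show ?thesis by (simp add: prim_def case_prod_beta cbox_interval)
qed

lemma prim_odd: "(\<And>s. f (- s) = f s) \<Longrightarrow> prim f (- t) = - prim f t"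
  by (simp add: prim_def)

text \<open>
  A curve on the unit circle with angular velocity \<open>\<theta>\<close> and an angle with derivative \<open>\<theta>\<close> stay together,
  because the square of their distance has derivative zero.
\<close>

lemma circle_lift_unique:
  fixes c s \<sigma> \<theta> :: "real \<Rightarrow> real"
  assumes "convex D" "t0 \<in> D" "t \<in> D" "c t0 = cos (\<sigma> t0)" "s t0 = sin (\<sigma> t0)"
    and c: "\<And>t. t \<in> D \<Longrightarrow> (c has_real_derivative - s t * \<theta> t) (at t)"
    and s: "\<And>t. t \<in> D \<Longrightarrow> (s has_real_derivative c t * \<theta> t) (at t)"
    and \<sigma>: "\<And>t. t \<in> D \<Longrightarrow> (\<sigma> has_real_derivative \<theta> t) (at t)"
  shows "c t = cos (\<sigma> t)" "s t = sin (\<sigma> t)"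
proof -
  define F where "F t = (c t - cos (\<sigma> t))\<^sup>2 + (s t - sin (\<sigma> t))\<^sup>2" for t
  have "(F has_real_derivative 0) (at t within D)" if "t \<in> D" for t
  proof (rule has_field_derivative_at_within)
    have 1: "((\<lambda>t. c t - cos (\<sigma> t)) has_real_derivative - s t * \<theta> t + sin (\<sigma> t) * \<theta> t) (at t)"
      by (auto intro!: derivative_eq_intros c[OF that] \<sigma>[OF that])
    have 2: "((\<lambda>t. s t - sin (\<sigma> t)) has_real_derivative c t * \<theta> t - cos (\<sigma> t) * \<theta> t) (at t)"
      by (auto intro!: derivative_eq_intros s[OF that] \<sigma>[OF that])
    show "(F has_real_derivative 0) (at t)"
      unfolding F_def power2_eq_square
      by (rule DERIV_cong[OF DERIV_add[OF DERIV_mult[OF 1 1] DERIV_mult[OF 2 2]]]) algebra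
  qed
  then obtain k where "\<forall>t\<in>D. F t = k"
    using has_field_derivative_zero_constant[OF assms(1)] by blast
  then have "F t = F t0" using assms by metis
  also have "\<dots> = 0" using assms by (simp add: F_def)
  finally show "c t = cos (\<sigma> t)" "s t = sin (\<sigma> t)"
    by (simp_all add: F_def sum_power2_eq_zero_iff)
qed

text \<open>
  The squared distance in the phase plane to the explicit solution is conserved.
\<close>

lemma harmonic_oscillator_unique:
  fixes y z :: "real \<Rightarrow> real"
  assumes "convex D" "t0 \<in> D" "t \<in> D"
    and y: "\<And>t. t \<in> D \<Longrightarrow> (y has_real_derivative w * z t) (at t)"
    and z: "\<And>t. t \<in> D \<Longrightarrow> (z has_real_derivative - w * y t) (at t)"
    and i: "y t0 = R * cos (w * (t0 + c))" "z t0 = - R * sin (w * (t0 + c))"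
  shows "y t = R * cos (w * (t + c))" "z t = - R * sin (w * (t + c))"
proof -
  define F where "F t = (y t - R * cos (w * (t + c)))\<^sup>2 + (z t + R * sin (w * (t + c)))\<^sup>2" for t
  have "(F has_real_derivative 0) (at t within D)" if "t \<in> D" for t
  proof (rule has_field_derivative_at_within)
    have 1: "((\<lambda>t. y t - R * cos (w * (t + c))) has_real_derivative w * z t + R * (sin (w * (t + c)) * w)) (at t)"
      by (auto intro!: derivative_eq_intros y[OF that])
    have 2: "((\<lambda>t. z t + R * sin (w * (t + c))) has_real_derivative - w * y t + R * (cos (w * (t + c)) * w)) (at t)"
      by (auto intro!: derivative_eq_intros z[OF that])
    show "(F has_real_derivative 0) (at t)"
      unfolding F_def power2_eq_square
      by (rule DERIV_cong[OF DERIV_add[OF DERIV_mult[OF 1 1] DERIV_mult[OF 2 2]]]) algebra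
  qed
  then obtain k where "\<forall>t\<in>D. F t = k"
    using has_field_derivative_zero_constant[OF assms(1)] by blast
  then have "F t = F t0" using assms(2,3) by metis
  also have "\<dots> = 0" using i by (simp add: F_def)
  finally show "y t = R * cos (w * (t + c))" "z t = - R * sin (w * (t + c))"
    by (simp_all add: F_def sum_power2_eq_zero_iff)
qed

lemma polar_angle:
  fixes x y R :: real
  assumes "x\<^sup>2 + y\<^sup>2 = R\<^sup>2" "0 \<le> R"
  obtains \<theta> where "- pi < \<theta>" "\<theta> \<le> pi" "x = R * cos \<theta>" "y = - R * sin \<theta>"
proof -
  let ?z = "Complex x (- y)"
  have n: "norm ?z = R" using assms by (simp add: complex_norm)
  have "rcis R (Arg ?z) = ?z" using rcis_cmod_Arg[of ?z] n by (simp only:)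
  from arg_cong[OF this, of Re] arg_cong[OF this, of Im]
  have "x = R * cos (Arg ?z)" "- y = R * sin (Arg ?z)"
    by (simp_all only: Re_rcis Im_rcis complex.sel)
  then show ?thesis using that[of "Arg ?z"] Arg_bounded[of ?z] by simp
qed

lemma is_solutionD:
  assumes "is_solution \<kappa> \<tau> a H D \<gamma> \<sigma>"
  shows "open D" "is_interval D" "convex D" "D \<noteq> {}"
    and "t \<in> D \<Longrightarrow> fst (\<gamma> t) \<in> I \<kappa>"
    and "t \<in> D \<Longrightarrow> ((\<lambda>s. fst (\<gamma> s)) has_real_derivative cos (\<sigma> t)) (at t)"
    and "t \<in> D \<Longrightarrow> ((\<lambda>s. snd (\<gamma> s)) has_real_derivative W \<kappa> \<tau> a (fst (\<gamma> t)) * sin (\<sigma> t)) (at t)"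
    and "t \<in> D \<Longrightarrow> (\<sigma> has_real_derivative 2 * H - ct \<kappa> (fst (\<gamma> t)) * sin (\<sigma> t)) (at t)"
proof -
  show "t \<in> D \<Longrightarrow> (\<sigma> has_real_derivative 2 * H - ct \<kappa> (fst (\<gamma> t)) * sin (\<sigma> t)) (at t)"
  proof -
    assume "t \<in> D"
    then obtain d where d: "(\<sigma> has_real_derivative d) (at t)" "2 * H = ct \<kappa> (fst (\<gamma> t)) * sin (\<sigma> t) + d"
      using assms by (auto simp: is_solution_def)
    then have "d = 2 * H - ct \<kappa> (fst (\<gamma> t)) * sin (\<sigma> t)" by linarith
    with d(1) show ?thesis by simp
  qed
qed (use assms in \<open>auto simp: is_solution_def open_interval_def is_interval_convex\<close>)

lemma is_solutionI:
  assumes "open_interval D"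
    and "\<And>t. t \<in> D \<Longrightarrow> fst (\<gamma> t) \<in> I \<kappa>"
    and "\<And>t. t \<in> D \<Longrightarrow> ((\<lambda>s. fst (\<gamma> s)) has_real_derivative cos (\<sigma> t)) (at t)"
    and "\<And>t. t \<in> D \<Longrightarrow> ((\<lambda>s. snd (\<gamma> s)) has_real_derivative W \<kappa> \<tau> a (fst (\<gamma> t)) * sin (\<sigma> t)) (at t)"
    and "\<And>t. t \<in> D \<Longrightarrow> (\<sigma> has_real_derivative 2 * H - ct \<kappa> (fst (\<gamma> t)) * sin (\<sigma> t)) (at t)"
  shows "is_solution \<kappa> \<tau> a H D \<gamma> \<sigma>"
  unfolding is_solution_def
proof (intro conjI ballI assms(1))
  fix t assume t: "t \<in> D"
  show "fst (\<gamma> t) \<in> I \<kappa>" "((\<lambda>s. fst (\<gamma> s)) has_real_derivative cos (\<sigma> t)) (at t)"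
    "((\<lambda>s. snd (\<gamma> s)) has_real_derivative W \<kappa> \<tau> a (fst (\<gamma> t)) * sin (\<sigma> t)) (at t)"
    by (rule assms(2-4)[OF t])+
  have "2 * H = ct \<kappa> (fst (\<gamma> t)) * sin (\<sigma> t) + (2 * H - ct \<kappa> (fst (\<gamma> t)) * sin (\<sigma> t))" by simp
  with assms(5)[OF t] show "\<exists>\<sigma>'. (\<sigma> has_real_derivative \<sigma>') (at t) \<and> 2 * H = ct \<kappa> (fst (\<gamma> t)) * sin (\<sigma> t) + \<sigma>'"
    by blast
qed

lemma energy_constant:
  assumes "is_solution \<kappa> \<tau> a H D \<gamma> \<sigma>"
  obtains J where "\<And>t. t \<in> D \<Longrightarrow> energy \<kappa> H (fst (\<gamma> t)) (\<sigma> t) = J"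
proof -
  note S = is_solutionD[OF assms]
  have "((\<lambda>t. energy \<kappa> H (fst (\<gamma> t)) (\<sigma> t)) has_real_derivative 0) (at t within D)" if t: "t \<in> D" for t
  proof (rule has_field_derivative_at_within)
    let ?r = "fst (\<gamma> t)" and ?\<sigma>' = "2 * H - ct \<kappa> (fst (\<gamma> t)) * sin (\<sigma> t)"
    have "((\<lambda>t. sn \<kappa> (fst (\<gamma> t)) * sin (\<sigma> t) - 2 * H * vers \<kappa> (fst (\<gamma> t))) has_real_derivative
        cs \<kappa> ?r * cos (\<sigma> t) * sin (\<sigma> t) + cos (\<sigma> t) * ?\<sigma>' * sn \<kappa> ?r - 2 * H * (sn \<kappa> ?r * cos (\<sigma> t))) (at t)"
      using DERIV_diff[OF DERIV_mult[OF DERIV_sn[OF S(6)[OF t]] DERIV_chain2[OF DERIV_sin S(8)[OF t]]]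
          DERIV_cmult[OF DERIV_vers[OF S(6)[OF t]], of "2 * H"]]
      by (rule DERIV_cong) simp
    then show "((\<lambda>t. energy \<kappa> H (fst (\<gamma> t)) (\<sigma> t)) has_real_derivative 0) (at t)"
      unfolding energy_vers
    proof (rule DERIV_cong)
      have "cs \<kappa> ?r = ct \<kappa> ?r * sn \<kappa> ?r" using sn_pos[OF S(5)[OF t]] by (simp add: ct_def)
      then show "cs \<kappa> ?r * cos (\<sigma> t) * sin (\<sigma> t) + cos (\<sigma> t) * ?\<sigma>' * sn \<kappa> ?r - 2 * H * (sn \<kappa> ?r * cos (\<sigma> t)) = 0"
        by algebra
    qed
  qed
  then obtain k where "\<forall>t\<in>D. energy \<kappa> H (fst (\<gamma> t)) (\<sigma> t) = k"
    using has_field_derivative_zero_constant[OF S(3), of "\<lambda>t. energy \<kappa> H (fst (\<gamma> t)) (\<sigma> t)"] by blast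
  then show ?thesis by (intro that) blast
qed

section \<open>The energy range and the oscillating versine\<close>

text \<open>
  The discriminant condition says that the oscillator below has a real frequency.
\<close>

locale cmc =
  fixes \<kappa> H :: real
  assumes H_pos: "0 < H" and disc_pos: "0 < 4 * H\<^sup>2 + \<kappa>"
begin

definition freq :: real where "freq = sqrt (4 * H\<^sup>2 + \<kappa>)"

definition amp :: "real \<Rightarrow> real" where "amp J = sqrt (1 - 4 * H * J - \<kappa> * J\<^sup>2)"

text \<open>
  The versine of the radius of the explicit solution with energy \<open>J\<close>; it is largest at time \<open>0\<close>.
\<close>

definition Q :: "real \<Rightarrow> real \<Rightarrow> real" where
  "Q J t = (1 - 2 * H * J + amp J * cos (freq * t)) / freq\<^sup>2"

definition Q' :: "real \<Rightarrow> real \<Rightarrow> real" where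
  "Q' J t = - amp J * sin (freq * t) / freq"

text \<open>
  For \<open>J = 0\<close> the versine vanishes at the end points, where the curve runs into the axis.
\<close>

definition lifetime :: "real \<Rightarrow> real set" where
  "lifetime J = (if J = 0 then {- pi / freq<..<pi / freq} else UNIV)"

lemma freq_pos: "0 < freq" using disc_pos by (simp add: freq_def)

lemma freq_squared: "freq\<^sup>2 = 4 * H\<^sup>2 + \<kappa>" using disc_pos by (simp add: freq_def)

lemma kappa_factor: "(freq - 2 * H) * (freq + 2 * H) = \<kappa>"
  using freq_squared by (simp add: power2_eq_square algebra_simps)

text \<open>
  This expression for \<open>J\<^sub>m\<^sub>a\<^sub>x\<close> has no singular case at \<open>\<kappa> = 0\<close>.
\<close>

lemma J_max_eq: "J_max \<kappa> H = 1 / (freq + 2 * H)"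
proof (cases "\<kappa> = 0")
  case True
  then have "freq = 2 * H" using H_pos unfolding freq_def by (simp add: real_sqrt_mult)
  then show ?thesis using True by (simp add: J_max_def)
next
  case False
  then have "J_max \<kappa> H = (freq - 2 * H) / ((freq - 2 * H) * (freq + 2 * H))"
    by (simp add: J_max_def kappa_factor flip: freq_def)
  moreover have "freq - 2 * H \<noteq> 0" using False kappa_factor by auto
  ultimately show ?thesis by simp
qed

lemma J_range_le: "J \<in> J_range \<kappa> H \<Longrightarrow> (freq + 2 * H) * J \<le> 1"
  using freq_pos H_pos by (auto simp: J_range_def J_max_eq field_simps split: if_splits)

text \<open>
  For \<open>\<kappa> > 0\<close> this is the left end of the energy range, for \<open>\<kappa> \<le> 0\<close> it follows from the upper bound
  \<open>J \<le> J\<^sub>m\<^sub>a\<^sub>x\<close>. It is the one inequality through which the lower end of the range enters.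
\<close>

lemma J_range_ge: assumes "J \<in> J_range \<kappa> H" shows "0 \<le> 2 * H + \<kappa> * J"
proof (cases "\<kappa> > 0")
  case True
  then have "- 2 * H / \<kappa> \<le> J" using assms by (simp add: J_range_def)
  then have "(- 2 * H / \<kappa>) * \<kappa> \<le> J * \<kappa>" using True by (intro mult_right_mono) auto
  then show ?thesis using True by (simp add: mult.commute)
next
  case False
  then have "J \<le> 1 / (freq + 2 * H)" using assms by (simp add: J_range_def flip: J_max_eq)
  then have "\<kappa> * (1 / (freq + 2 * H)) \<le> \<kappa> * J"
    using False by (intro mult_left_mono_neg) simp_all
  moreover have "\<kappa> * (1 / (freq + 2 * H)) = freq - 2 * H"
  proof -
    have "\<kappa> * (1 / (freq + 2 * H)) = (freq - 2 * H) * (freq + 2 * H) * (1 / (freq + 2 * H))"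
      by (simp only: kappa_factor)
    also have "\<dots> = freq - 2 * H"
    proof -
      have "freq + 2 * H \<noteq> 0" using freq_pos H_pos by linarith
      then show ?thesis by (simp only: times_divide_eq_right mult_1_right nonzero_mult_div_cancel_right not_False_eq_True)
    qed
    finally show ?thesis .
  qed
  ultimately show ?thesis using freq_pos by linarith
qed

lemma J_range_gt: "J \<in> J_range \<kappa> H \<Longrightarrow> 0 < 4 * H + \<kappa> * J"
  using J_range_ge[of J] H_pos by linarith

lemma J_range_less: assumes "J \<in> J_range \<kappa> H" shows "0 < 1 - 2 * H * J"
proof (cases "J \<le> 0")
  case True
  then have "2 * H * J \<le> 0" using H_pos by (simp add: mult_nonneg_nonpos)
  then show ?thesis by linarith
next
  case False
  then have "0 < freq * J" using freq_pos by simp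
  then show ?thesis using J_range_le[OF assms] by (simp add: algebra_simps)
qed

text \<open>
  The second factor is positive on the whole range (lemma \<open>amp_factor_pos\<close>), so the amplitude degenerates
  only at \<open>J\<^sub>m\<^sub>a\<^sub>x\<close>.
\<close>

lemma amp_factor: "1 - 4 * H * J - \<kappa> * J\<^sup>2 = (1 - (freq + 2 * H) * J) * (1 + (freq - 2 * H) * J)"
  using freq_squared by (simp add: power2_eq_square algebra_simps)

lemma amp_factor_pos: assumes "J \<in> J_range \<kappa> H" shows "0 < 1 + (freq - 2 * H) * J"
proof -
  have *: "1 + (freq - 2 * H) * J = (1 - 2 * H * J) + freq * J" by (simp add: algebra_simps)
  show ?thesis
  proof (cases "J \<ge> 0")
    case True
    then show ?thesis using J_range_less[OF assms] freq_pos unfolding * by (simp add: add_pos_nonneg)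
  next
    case J: False
    show ?thesis
    proof (cases "freq \<le> 2 * H")
      case True
      then show ?thesis using J by (simp add: add_pos_nonneg mult_nonpos_nonpos)
    next
      case False
      have "(1 + (freq - 2 * H) * J) * (freq + 2 * H) = freq + (2 * H + \<kappa> * J)"
      proof -
        have "(1 + (freq - 2 * H) * J) * (freq + 2 * H) = freq + 2 * H + (freq - 2 * H) * (freq + 2 * H) * J"
          by (simp add: algebra_simps)
        then show ?thesis by (simp only: kappa_factor)
      qed
      then have "0 < (1 + (freq - 2 * H) * J) * (freq + 2 * H)"
        using J_range_ge[OF assms] freq_pos by linarith
      then show ?thesis using freq_pos H_pos by (simp add: zero_less_mult_iff)
    qed
  qed
qed

lemma amp_squared: "J \<in> J_range \<kappa> H \<Longrightarrow> (amp J)\<^sup>2 = 1 - 4 * H * J - \<kappa> * J\<^sup>2"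
  using amp_factor_pos[of J] J_range_le[of J] unfolding amp_def by (simp add: amp_factor)

lemma amp_nonneg: "J \<in> J_range \<kappa> H \<Longrightarrow> 0 \<le> amp J"
  using amp_factor_pos[of J] J_range_le[of J] unfolding amp_def by (simp add: amp_factor)

lemma amp_pos: "J \<in> J_range \<kappa> H \<Longrightarrow> J \<noteq> J_max \<kappa> H \<Longrightarrow> 0 < amp J"
proof -
  assume J: "J \<in> J_range \<kappa> H" "J \<noteq> J_max \<kappa> H"
  then have "(freq + 2 * H) * J \<noteq> 1" using freq_pos H_pos by (simp add: J_max_eq field_simps)
  then show ?thesis using J_range_le[OF J(1)] amp_factor_pos[OF J(1)] unfolding amp_def by (simp add: amp_factor)
qed

lemma amp_J_max: "amp (J_max \<kappa> H) = 0"
  using freq_pos H_pos unfolding amp_def amp_factor by (simp add: J_max_eq)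

lemma J_max_pos: "0 < J_max \<kappa> H" using freq_pos H_pos by (simp add: J_max_eq)

lemma amp_squared': "J \<in> J_range \<kappa> H \<Longrightarrow> (amp J)\<^sup>2 = (1 - 2 * H * J)\<^sup>2 - freq\<^sup>2 * J\<^sup>2"
  unfolding amp_squared freq_squared by (simp add: power2_eq_square algebra_simps)

lemma DERIV_Q: "(Q J has_real_derivative Q' J t) (at t)"
  unfolding Q_def[abs_def] Q'_def using freq_pos
  by (auto intro!: derivative_eq_intros simp: power2_eq_square)

lemma DERIV_Q': "(Q' J has_real_derivative 1 - 2 * H * J - freq\<^sup>2 * Q J t) (at t)"
  unfolding Q'_def[abs_def] Q_def using freq_pos
  by (auto intro!: derivative_eq_intros simp: power2_eq_square)

text \<open>
  Conservation of energy: both sides are \<open>(sn r)\<^sup>2 (cos \<sigma>)\<^sup>2\<close>.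
\<close>

lemma Q'_squared: assumes "J \<in> J_range \<kappa> H"
  shows "(Q' J t)\<^sup>2 = Q J t * (2 - \<kappa> * Q J t) - (J + 2 * H * Q J t)\<^sup>2"
proof -
  define x where "x = amp J * cos (freq * t)"
  have x: "freq\<^sup>2 * Q J t = 1 - 2 * H * J + x" using freq_pos by (simp add: Q_def x_def)
  have "freq\<^sup>2 * (Q' J t)\<^sup>2 = (amp J)\<^sup>2 * (1 - (cos (freq * t))\<^sup>2)"
    using freq_pos by (simp add: Q'_def power_divide power_mult_distrib sin_squared_eq)
  also have "\<dots> = (1 - 2 * H * J)\<^sup>2 - freq\<^sup>2 * J\<^sup>2 - x\<^sup>2"
    using amp_squared'[OF assms] by (simp add: x_def power_mult_distrib algebra_simps)
  also have "\<dots> = (1 - 2 * H * J)\<^sup>2 - freq\<^sup>2 * J\<^sup>2 - (freq\<^sup>2 * Q J t - (1 - 2 * H * J))\<^sup>2" 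
    unfolding x by simp
  also have "(1 - 2 * H * J)\<^sup>2 - freq\<^sup>2 * J\<^sup>2 - (freq\<^sup>2 * Q J t - (1 - 2 * H * J))\<^sup>2
     = freq\<^sup>2 * (2 * (1 - 2 * H * J) * Q J t - J\<^sup>2 - freq\<^sup>2 * (Q J t)\<^sup>2)"
    by (simp add: power2_eq_square algebra_simps)
  also have "2 * (1 - 2 * H * J) * Q J t - J\<^sup>2 - freq\<^sup>2 * (Q J t)\<^sup>2
    = Q J t * (2 - \<kappa> * Q J t) - (J + 2 * H * Q J t)\<^sup>2"
    unfolding freq_squared by (simp add: power2_eq_square algebra_simps)
  finally show ?thesis using freq_pos by simp
qed

lemma Q_lower: assumes "J \<in> J_range \<kappa> H" shows "1 - 2 * H * J - amp J \<le> freq\<^sup>2 * Q J t"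
proof -
  have "amp J * (-1) \<le> amp J * cos (freq * t)"
    by (rule mult_left_mono[OF cos_ge_minus_one amp_nonneg[OF assms]])
  moreover have "freq\<^sup>2 * Q J t = 1 - 2 * H * J + amp J * cos (freq * t)"
    using freq_pos by (simp add: Q_def)
  ultimately show ?thesis by linarith
qed

lemma amp_le: assumes "J \<in> J_range \<kappa> H" shows "amp J \<le> 1 - 2 * H * J"
proof (rule power2_le_imp_le)
  have "0 \<le> freq\<^sup>2 * J\<^sup>2" by simp
  then show "(amp J)\<^sup>2 \<le> (1 - 2 * H * J)\<^sup>2" using amp_squared'[OF assms] by linarith
qed (use J_range_less[OF assms] in linarith)

lemma amp_less: assumes "J \<in> J_range \<kappa> H" "J \<noteq> 0" shows "amp J < 1 - 2 * H * J"
proof (rule power2_less_imp_less)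
  have "0 < freq\<^sup>2 * J\<^sup>2" using freq_pos assms(2) by simp
  then show "(amp J)\<^sup>2 < (1 - 2 * H * J)\<^sup>2" using amp_squared'[OF assms(1)] by linarith
qed (use J_range_less[OF assms(1)] in linarith)

lemma Q_nonneg: assumes "J \<in> J_range \<kappa> H" shows "0 \<le> Q J t"
proof -
  have "0 \<le> freq\<^sup>2 * Q J t" using Q_lower[OF assms, of t] amp_le[OF assms] by linarith
  then show ?thesis using freq_pos by (simp add: zero_le_mult_iff)
qed

lemma Q_pos: assumes "J \<in> J_range \<kappa> H" "t \<in> lifetime J" shows "0 < Q J t"
proof (cases "J = 0")
  case True
  have "\<bar>t\<bar> < pi / freq" using assms(2) True by (auto simp: lifetime_def)
  then have "\<bar>freq * t\<bar> < pi" using freq_pos by (simp add: abs_mult pos_less_divide_eq mult.commute)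
  then have "cos pi < cos \<bar>freq * t\<bar>" by (intro cos_monotone_0_pi) auto
  then have "cos pi < cos (freq * t)" by simp
  then show ?thesis using True freq_pos by (simp add: Q_def amp_def)
next
  case False
  then have "0 < freq\<^sup>2 * Q J t" using Q_lower[OF assms(1), of t] amp_less[OF assms(1)] by linarith
  then show ?thesis using freq_pos by (simp add: zero_less_mult_iff)
qed

text \<open>
  If \<open>\<kappa> Q\<close> reached \<open>2\<close>, conservation of energy would force \<open>J = - 4 H / \<kappa>\<close>, which is outside the range.
  So the explicit solution stays away from the antipodal axis.
\<close>

lemma Q_less: assumes "J \<in> J_range \<kappa> H" shows "\<kappa> * Q J t < 2"
proof (cases "\<kappa> > 0 \<and> Q J t > 0")
  case True
  have "0 \<le> Q J t * (2 - \<kappa> * Q J t)"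
    using Q'_squared[OF assms, of t] zero_le_power2[of "Q' J t"] zero_le_power2[of "J + 2 * H * Q J t"] by linarith
  then have "\<kappa> * Q J t \<le> 2" using True by (simp add: zero_le_mult_iff)
  moreover have "\<kappa> * Q J t \<noteq> 2"
  proof
    assume *: "\<kappa> * Q J t = 2"
    then have "(J + 2 * H * Q J t)\<^sup>2 \<le> 0" using Q'_squared[OF assms, of t] zero_le_power2[of "Q' J t"] by simp
    then have "J + 2 * H * Q J t = 0" by simp
    then have "\<kappa> * (J + 2 * H * Q J t) = 0" by simp
    then have "\<kappa> * J + 2 * H * (\<kappa> * Q J t) = 0" by (simp add: algebra_simps)
    then show False using J_range_gt[OF assms] * by simp
  qed
  ultimately show ?thesis by simp
next
  case False
  then have "\<kappa> * Q J t \<le> 0" using Q_nonneg[OF assms, of t] by (auto simp: mult_le_0_iff)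
  then show ?thesis by simp
qed

lemma zero_in_lifetime: "0 \<in> lifetime J" using freq_pos by (auto simp: lifetime_def)

lemma lifetime_open_interval: "open_interval (lifetime J)"
  unfolding open_interval_def using zero_in_lifetime[of J] by (auto simp: lifetime_def is_interval_oo)

lemma lifetime_star: "t \<in> lifetime J \<Longrightarrow> 0 \<le> u \<Longrightarrow> u \<le> 1 \<Longrightarrow> u * t \<in> lifetime J"
proof -
  assume a: "t \<in> lifetime J" "0 \<le> u" "u \<le> 1"
  have "\<bar>u * t\<bar> \<le> \<bar>t\<bar>" using a by (simp add: abs_mult mult_left_le_one_le)
  then show ?thesis using a(1) by (auto simp: lifetime_def split: if_splits)
qed

end

section \<open>Explicit solutions and rigidity\<close>

text \<open>
  The generating equations are autonomous, do not contain the height, and are \<open>2 \<pi>\<close>-periodic in the angle.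
\<close>

lemma is_solution_shift:
  assumes "is_solution \<kappa> \<tau> a H D \<gamma> \<sigma>"
  shows "is_solution \<kappa> \<tau> a H {t. t + c \<in> D} (\<lambda>t. \<gamma> (t + c) + (0, b)) (\<lambda>t. \<sigma> (t + c) + 2 * pi * of_int k)"
proof (rule is_solutionI)
  note S = is_solutionD[OF assms]
  have "{t. t + c \<in> D} = (+) (- c) ` D" by (force simp: image_iff)
  moreover have "open ((+) (- c) ` D)" "is_interval ((+) (- c) ` D)" "(+) (- c) ` D \<noteq> {}"
    using S(1,2,4) by (simp_all only: open_translation is_interval_translation image_is_empty not_False_eq_True)
  ultimately show "open_interval {t. t + c \<in> D}" by (simp only: open_interval_def simp_thms)
  fix t assume "t \<in> {t. t + c \<in> D}"
  then have t: "t + c \<in> D" by simp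
  have sc: "sin (\<sigma> (t + c) + 2 * pi * of_int k) = sin (\<sigma> (t + c))"
    "cos (\<sigma> (t + c) + 2 * pi * of_int k) = cos (\<sigma> (t + c))"
    using sin_cos_eq_iff[of "\<sigma> (t + c) + 2 * pi * of_int k" "\<sigma> (t + c)"] by auto
  show "fst (\<gamma> (t + c) + (0, b)) \<in> I \<kappa>" using S(5)[OF t] by simp
  show "((\<lambda>s. fst (\<gamma> (s + c) + (0, b))) has_real_derivative cos (\<sigma> (t + c) + 2 * pi * of_int k)) (at t)"
    unfolding sc using S(6)[OF t, unfolded DERIV_shift] by simp
  show "((\<lambda>s. snd (\<gamma> (s + c) + (0, b))) has_real_derivative
      W \<kappa> \<tau> a (fst (\<gamma> (t + c) + (0, b))) * sin (\<sigma> (t + c) + 2 * pi * of_int k)) (at t)"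
    unfolding sc using DERIV_add[OF S(7)[OF t, unfolded DERIV_shift] DERIV_const[of b]] by simp
  show "((\<lambda>s. \<sigma> (s + c) + 2 * pi * of_int k) has_real_derivative
      2 * H - ct \<kappa> (fst (\<gamma> (t + c) + (0, b))) * sin (\<sigma> (t + c) + 2 * pi * of_int k)) (at t)"
    unfolding sc using DERIV_add[OF S(8)[OF t, unfolded DERIV_shift] DERIV_const[of "2 * pi * of_int k"]] by simp
qed

lemma profileD:
  assumes "profile \<kappa> \<tau> a H J D \<gamma> \<sigma>"
  shows "is_solution \<kappa> \<tau> a H D \<gamma> \<sigma>"
    and "t \<in> D \<Longrightarrow> energy \<kappa> H (fst (\<gamma> t)) (\<sigma> t) = J"
    and "is_solution \<kappa> \<tau> a H D' \<gamma>' \<sigma>' \<Longrightarrow> D \<subseteq> D' \<Longrightarrow>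
      (\<And>t. t \<in> D \<Longrightarrow> \<gamma>' t = \<gamma> t \<and> \<sigma>' t = \<sigma> t) \<Longrightarrow> D' = D"
  using assms unfolding profile_def is_maximal_solution_def by blast+

lemma profile_shift:
  assumes "profile \<kappa> \<tau> a H J D \<gamma> \<sigma>"
  shows "profile \<kappa> \<tau> a H J {t. t + c \<in> D} (\<lambda>t. \<gamma> (t + c) + (0, b)) (\<lambda>t. \<sigma> (t + c) + 2 * pi * of_int k)"
  unfolding profile_def is_maximal_solution_def
proof (intro conjI allI impI ballI)
  note sol = profileD(1)[OF assms] and en = profileD(2)[OF assms] and max = profileD(3)[OF assms]
  show "is_solution \<kappa> \<tau> a H {t. t + c \<in> D} (\<lambda>t. \<gamma> (t + c) + (0, b)) (\<lambda>t. \<sigma> (t + c) + 2 * pi * of_int k)"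
    by (rule is_solution_shift[OF sol])
  show "energy \<kappa> H (fst (\<gamma> (t + c) + (0, b))) (\<sigma> (t + c) + 2 * pi * of_int k) = J"
    if "t \<in> {t. t + c \<in> D}" for t
  proof -
    have "sin (\<sigma> (t + c) + 2 * pi * of_int k) = sin (\<sigma> (t + c))"
      using sin_cos_eq_iff[of "\<sigma> (t + c) + 2 * pi * of_int k" "\<sigma> (t + c)"] by auto
    then show ?thesis using en[of "t + c"] that by (simp add: energy_vers)
  qed
  fix D' \<gamma>' \<sigma>'
  assume *: "is_solution \<kappa> \<tau> a H D' \<gamma>' \<sigma>' \<and> {t. t + c \<in> D} \<subseteq> D' \<and>
     (\<forall>t\<in>{t. t + c \<in> D}. \<gamma>' t = \<gamma> (t + c) + (0, b) \<and> \<sigma>' t = \<sigma> (t + c) + 2 * pi * of_int k)"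
  have "{t. t + - c \<in> D'} = D"
  proof (rule max[OF is_solution_shift[of _ _ _ _ _ _ _ "- c" "- b" "- k"]])
    show "is_solution \<kappa> \<tau> a H D' \<gamma>' \<sigma>'" using * by blast
    show "D \<subseteq> {t. t + - c \<in> D'}"
    proof
      fix t assume "t \<in> D"
      then have "t - c \<in> {t. t + c \<in> D}" by simp
      then show "t \<in> {t. t + - c \<in> D'}" using * by auto
    qed
    fix t assume "t \<in> D"
    then have "t - c \<in> {t. t + c \<in> D}" by simp
    then have "\<gamma>' (t - c) = \<gamma> (t - c + c) + (0, b) \<and> \<sigma>' (t - c) = \<sigma> (t - c + c) + 2 * pi * of_int k"
      using * by blast
    then show "\<gamma>' (t + - c) + (0, - b) = \<gamma> t \<and> \<sigma>' (t + - c) + 2 * pi * of_int (- k) = \<sigma> t"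
      by (simp add: prod_eq_iff)
  qed
  then show "D' = {t. t + c \<in> D}" by (force simp: set_eq_iff)
qed

lemma sn_flip: assumes "\<kappa> > 0" shows "sn \<kappa> (pi / sqrt \<kappa> - r) = sn \<kappa> r"
  using assms by (simp add: sn_def right_diff_distrib sin_diff)

lemma cs_flip: assumes "\<kappa> > 0" shows "cs \<kappa> (pi / sqrt \<kappa> - r) = - cs \<kappa> r"
  using assms by (simp add: cs_def right_diff_distrib cos_diff)

lemma vers_flip: assumes "\<kappa> > 0" shows "vers \<kappa> (pi / sqrt \<kappa> - r) = 2 / \<kappa> - vers \<kappa> r"
  using cs_flip[OF assms, of r] assms unfolding cs_vers by (simp add: field_simps)

lemma I_flip: assumes "\<kappa> > 0" "r \<in> I \<kappa>" shows "pi / sqrt \<kappa> - r \<in> I \<kappa>"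
  using assms by (auto simp: I_def)

text \<open>
  The map exchanges the two axes. It turns the twist \<open>2 \<tau> v - a\<close> into its negative when the pitch \<open>a\<close> is
  replaced by \<open>4 \<tau> / \<kappa> - a\<close>, so \<open>W\<close> is preserved.
\<close>

lemma is_solution_flip:
  assumes \<kappa>: "\<kappa> > 0" and "is_solution \<kappa> \<tau> a H D \<gamma> \<sigma>"
  shows "is_solution \<kappa> \<tau> (4 * \<tau> / \<kappa> - a) H D
    (\<lambda>t. (pi / sqrt \<kappa> - fst (\<gamma> t), - snd (\<gamma> t))) (\<lambda>t. \<sigma> t + pi)"
proof (rule is_solutionI)
  note S = is_solutionD[OF assms(2)]
  show "open_interval D" using S by (simp add: open_interval_def)
  fix t assume t: "t \<in> D"
  have W: "W \<kappa> \<tau> (4 * \<tau> / \<kappa> - a) (pi / sqrt \<kappa> - fst (\<gamma> t)) = W \<kappa> \<tau> a (fst (\<gamma> t))"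
  proof -
    have "2 * \<tau> * (2 / \<kappa> - vers \<kappa> (fst (\<gamma> t))) - (4 * \<tau> / \<kappa> - a) = - (2 * \<tau> * vers \<kappa> (fst (\<gamma> t)) - a)"
      using \<kappa> by (simp add: field_simps)
    then have "(2 * \<tau> * (2 / \<kappa> - vers \<kappa> (fst (\<gamma> t))) - (4 * \<tau> / \<kappa> - a))\<^sup>2 = (2 * \<tau> * vers \<kappa> (fst (\<gamma> t)) - a)\<^sup>2"
      by (simp only: power2_minus)
    then show ?thesis
      using W_eq[OF S(5)[OF t]] W_eq[OF I_flip[OF \<kappa> S(5)[OF t]]] by (simp add: sn_flip[OF \<kappa>] vers_flip[OF \<kappa>])
  qed
  have ct: "ct \<kappa> (pi / sqrt \<kappa> - fst (\<gamma> t)) = - ct \<kappa> (fst (\<gamma> t))"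
    by (simp add: ct_def sn_flip[OF \<kappa>] cs_flip[OF \<kappa>])
  show "fst (pi / sqrt \<kappa> - fst (\<gamma> t), - snd (\<gamma> t)) \<in> I \<kappa>" using I_flip[OF \<kappa> S(5)[OF t]] by simp
  show "((\<lambda>s. fst (pi / sqrt \<kappa> - fst (\<gamma> s), - snd (\<gamma> s))) has_real_derivative cos (\<sigma> t + pi)) (at t)"
    using DERIV_diff[OF DERIV_const S(6)[OF t], of "pi / sqrt \<kappa>"] by simp
  show "((\<lambda>s. snd (pi / sqrt \<kappa> - fst (\<gamma> s), - snd (\<gamma> s))) has_real_derivative
     W \<kappa> \<tau> (4 * \<tau> / \<kappa> - a) (fst (pi / sqrt \<kappa> - fst (\<gamma> t), - snd (\<gamma> t))) * sin (\<sigma> t + pi)) (at t)"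
    using DERIV_minus[OF S(7)[OF t]] by (simp add: W)
  show "((\<lambda>t. \<sigma> t + pi) has_real_derivative
      2 * H - ct \<kappa> (fst (pi / sqrt \<kappa> - fst (\<gamma> t), - snd (\<gamma> t))) * sin (\<sigma> t + pi)) (at t)"
    using DERIV_add[OF S(8)[OF t] DERIV_const, of pi] by (simp add: ct)
qed

lemma profile_flip:
  assumes \<kappa>: "\<kappa> > 0" and "profile \<kappa> \<tau> a H J D \<gamma> \<sigma>"
  shows "profile \<kappa> \<tau> (4 * \<tau> / \<kappa> - a) H (- J - 4 * H / \<kappa>) D
    (\<lambda>t. (pi / sqrt \<kappa> - fst (\<gamma> t), - snd (\<gamma> t))) (\<lambda>t. \<sigma> t + pi)"
  unfolding profile_def is_maximal_solution_def
proof (intro conjI allI impI ballI)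
  note sol = profileD(1)[OF assms(2)] and en = profileD(2)[OF assms(2)] and max = profileD(3)[OF assms(2)]
  show "is_solution \<kappa> \<tau> (4 * \<tau> / \<kappa> - a) H D
    (\<lambda>t. (pi / sqrt \<kappa> - fst (\<gamma> t), - snd (\<gamma> t))) (\<lambda>t. \<sigma> t + pi)" by (rule is_solution_flip[OF \<kappa> sol])
  show "energy \<kappa> H (fst (pi / sqrt \<kappa> - fst (\<gamma> t), - snd (\<gamma> t))) (\<sigma> t + pi) = - J - 4 * H / \<kappa>" if "t \<in> D" for t
    using en[OF that] by (simp add: energy_vers sn_flip[OF \<kappa>] vers_flip[OF \<kappa>] algebra_simps)
  fix D' \<gamma>' \<sigma>'
  assume *: "is_solution \<kappa> \<tau> (4 * \<tau> / \<kappa> - a) H D' \<gamma>' \<sigma>' \<and> D \<subseteq> D' \<and>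
     (\<forall>t\<in>D. \<gamma>' t = (pi / sqrt \<kappa> - fst (\<gamma> t), - snd (\<gamma> t)) \<and> \<sigma>' t = \<sigma> t + pi)"
  let ?\<gamma> = "\<lambda>t. (pi / sqrt \<kappa> - fst (\<gamma>' t), - snd (\<gamma>' t))"
  have "is_solution \<kappa> \<tau> (4 * \<tau> / \<kappa> - (4 * \<tau> / \<kappa> - a)) H D' ?\<gamma> (\<lambda>t. \<sigma>' t + pi)"
    using * by (intro is_solution_flip[OF \<kappa>]) blast
  then have 1: "is_solution \<kappa> \<tau> a H D' ?\<gamma> (\<lambda>t. \<sigma>' t + pi)" by simp
  have 2: "is_solution \<kappa> \<tau> a H D' ?\<gamma> (\<lambda>t. \<sigma>' t - pi)"
    using is_solution_shift[OF 1, of 0 0 "-1"] by (simp flip: zero_prod_def)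
  show "D' = D"
    by (rule max[OF 2]) (use * in auto)
qed

text \<open>
  \<open>S\<close>, \<open>C\<close>, \<open>q\<close>, \<open>q1\<close>, \<open>q2\<close> and \<open>e\<close> stand for \<open>sn\<close>, \<open>cs\<close>, the versine, its first two derivatives and
  \<open>sn r sin \<sigma>\<close>. The first two parts say that \<open>(q1 / S, e / S)\<close> moves on the unit circle with angular
  velocity \<open>(2 H q - J C) / S\<^sup>2\<close>, the third one that this is the velocity in the generating equations.
\<close>

lemma explicit_algebra:
  fixes S q q1 q2 J C H \<kappa> e :: real
  assumes "0 < S" "S\<^sup>2 = q * (2 - \<kappa> * q)" "C = 1 - \<kappa> * q" "e = J + 2 * H * q"
    "q1\<^sup>2 = S\<^sup>2 - e\<^sup>2" "q2 = C - 2 * H * e"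
  shows "(q2 * S - q1 * (C * (q1 / S))) / (S * S) = - (e / S) * ((2 * H * q - J * C) / S\<^sup>2)"
    "(2 * H * q1 * S - e * (C * (q1 / S))) / (S * S) = q1 / S * ((2 * H * q - J * C) / S\<^sup>2)"
    "(2 * H * q - J * C) / S\<^sup>2 = 2 * H - C / S * (e / S)"
proof -
  have k: "2 * H * S\<^sup>2 - e * C = 2 * H * q - J * C"
    unfolding assms(2-4) by (simp add: power2_eq_square algebra_simps)
  have "q2 * S\<^sup>2 - C * q1\<^sup>2 = - e * (2 * H * S\<^sup>2 - e * C)"
    unfolding assms(5,6) by (simp add: power2_eq_square algebra_simps)
  note k1 = this[unfolded k]
  have "(q2 * S - q1 * (C * (q1 / S))) / (S * S) = (q2 * S\<^sup>2 - C * q1\<^sup>2) / (S * S\<^sup>2)"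
    using assms(1) by (simp add: divide_simps power2_eq_square)
  also have "\<dots> = - (e / S) * ((2 * H * q - J * C) / S\<^sup>2)" unfolding k1 by simp
  finally show "(q2 * S - q1 * (C * (q1 / S))) / (S * S) = - (e / S) * ((2 * H * q - J * C) / S\<^sup>2)" .
  have "(2 * H * q1 * S - e * (C * (q1 / S))) / (S * S) = q1 * (2 * H * S\<^sup>2 - e * C) / (S * S\<^sup>2)"
    using assms(1) by (simp add: divide_simps power2_eq_square) (simp add: algebra_simps)
  then show "(2 * H * q1 * S - e * (C * (q1 / S))) / (S * S) = q1 / S * ((2 * H * q - J * C) / S\<^sup>2)"
    unfolding k by simp
  show "(2 * H * q - J * C) / S\<^sup>2 = 2 * H - C / S * (e / S)"
    unfolding k[symmetric] using assms(1) by (simp add: divide_simps power2_eq_square)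
qed

context cmc
begin

text \<open>
  The right hand side \<open>2 H - ct sin \<sigma>\<close> of the angle equation, with \<open>sin \<sigma>\<close> eliminated by the energy.
\<close>

definition angle_rate :: "real \<Rightarrow> real \<Rightarrow> real" where
  "angle_rate J t = (2 * H * Q J t - J * (1 - \<kappa> * Q J t)) / (Q J t * (2 - \<kappa> * Q J t))"

text \<open>
  The right hand side \<open>W sin \<sigma>\<close> of the height equation, with \<open>sin \<sigma>\<close> eliminated by the energy.
\<close>

definition height_rate :: "real \<Rightarrow> real \<Rightarrow> real \<Rightarrow> real \<Rightarrow> real" where
  "height_rate \<tau> a J t = sqrt (Q J t * (2 - \<kappa> * Q J t) + (2 * \<tau> * Q J t - a)\<^sup>2) * (J + 2 * H * Q J t)
     / (Q J t * (2 - \<kappa> * Q J t))"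

text \<open>
  At time \<open>0\<close> the radius is maximal, so the curve is vertical there.
\<close>

definition angle :: "real \<Rightarrow> real \<Rightarrow> real" where
  "angle J t = pi / 2 + prim (angle_rate J) t"

definition curve :: "real \<Rightarrow> real \<Rightarrow> real \<Rightarrow> real \<Rightarrow> real \<times> real" where
  "curve \<tau> a J t = (rad \<kappa> (Q J t), prim (height_rate \<tau> a J) t)"

abbreviation family :: "(real \<times> real) set" where
  "family \<equiv> {(J, t). J \<in> J_range \<kappa> H \<and> t \<in> lifetime J}"

lemma continuous_on_Q: "continuous_on S (\<lambda>(J, t). Q J t)"
  unfolding Q_def amp_def case_prod_beta using freq_pos by (intro continuous_intros) auto

lemma Q_denominator: "J \<in> J_range \<kappa> H \<Longrightarrow> t \<in> lifetime J \<Longrightarrow> 0 < Q J t * (2 - \<kappa> * Q J t)"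
  using Q_pos Q_less by simp

lemma continuous_on_angle_rate: "continuous_on family (\<lambda>(J, t). angle_rate J t)"
proof -
  note c = continuous_on_Q[of family, unfolded case_prod_beta]
  show ?thesis unfolding angle_rate_def case_prod_beta
    by (intro continuous_intros c) (use Q_denominator in fastforce)
qed

lemma continuous_on_height_rate: "continuous_on family (\<lambda>(J, t). height_rate \<tau> a J t)"
proof -
  note c = continuous_on_Q[of family, unfolded case_prod_beta]
  show ?thesis unfolding height_rate_def case_prod_beta
    by (intro continuous_intros c) (use Q_denominator in fastforce)
qed

lemma family_section:
  assumes "continuous_on family (\<lambda>(J, t). f J t)" "J \<in> J_range \<kappa> H"
  shows "continuous_on (lifetime J) (f J)"
proof -
  have "continuous_on (lifetime J) (\<lambda>t. (\<lambda>(J, t). f J t) (J, t))"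
    by (rule continuous_on_compose2[OF assms(1)]) (use assms(2) in \<open>auto intro!: continuous_intros\<close>)
  then show ?thesis by simp
qed

lemma continuous_on_explicit:
  "continuous_on family (\<lambda>(J, t). (curve \<tau> a J t, angle J t))"
proof -
  have 1: "continuous_on family (\<lambda>p. prim (height_rate \<tau> a (fst p)) (snd p))"
    using continuous_on_prim[OF continuous_on_height_rate lifetime_star] by (simp add: case_prod_beta)
  have 2: "continuous_on family (\<lambda>p. prim (angle_rate (fst p)) (snd p))"
    using continuous_on_prim[OF continuous_on_angle_rate lifetime_star] by (simp add: case_prod_beta)
  have 3: "continuous_on family (\<lambda>p. rad \<kappa> (Q (fst p) (snd p)))"
    by (rule continuous_on_compose2[OF continuous_on_rad continuous_on_Q[unfolded case_prod_beta]])
       (use Q_nonneg Q_less in \<open>force simp: less_imp_le\<close>)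
  show ?thesis unfolding curve_def angle_def case_prod_beta
    by (intro continuous_on_Pair continuous_on_add continuous_on_const 1[unfolded case_prod_beta] 2[unfolded case_prod_beta] 3[unfolded case_prod_beta])
qed

lemma explicit_radius:
  assumes "J \<in> J_range \<kappa> H" "t \<in> lifetime J"
  shows "rad \<kappa> (Q J t) \<in> I \<kappa>" "vers \<kappa> (rad \<kappa> (Q J t)) = Q J t" "0 < sn \<kappa> (rad \<kappa> (Q J t))"
    "(sn \<kappa> (rad \<kappa> (Q J t)))\<^sup>2 = Q J t * (2 - \<kappa> * Q J t)" "cs \<kappa> (rad \<kappa> (Q J t)) = 1 - \<kappa> * Q J t"
proof -
  show 1: "rad \<kappa> (Q J t) \<in> I \<kappa>" using rad_in_I Q_pos Q_less assms by blast
  show 2: "vers \<kappa> (rad \<kappa> (Q J t)) = Q J t" using vers_rad[of "Q J t" \<kappa>] Q_pos[OF assms] Q_less[OF assms(1), of t] by simp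
  show "0 < sn \<kappa> (rad \<kappa> (Q J t))" by (rule sn_pos[OF 1])
  show "(sn \<kappa> (rad \<kappa> (Q J t)))\<^sup>2 = Q J t * (2 - \<kappa> * Q J t)" by (simp add: sn_squared 2)
  show "cs \<kappa> (rad \<kappa> (Q J t)) = 1 - \<kappa> * Q J t" by (simp add: cs_vers 2)
qed

lemma DERIV_radius:
  assumes "J \<in> J_range \<kappa> H" "t \<in> lifetime J"
  shows "((\<lambda>t. rad \<kappa> (Q J t)) has_real_derivative Q' J t / sn \<kappa> (rad \<kappa> (Q J t))) (at t)"
  using DERIV_chain2[OF DERIV_rad[OF Q_pos[OF assms] Q_less[OF assms(1)]] DERIV_Q] by simp

lemma DERIV_angle:
  assumes "J \<in> J_range \<kappa> H" "t \<in> lifetime J"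
  shows "(angle J has_real_derivative angle_rate J t) (at t)"
  unfolding angle_def[abs_def]
  using DERIV_add[OF DERIV_const DERIV_prim[OF _ _ zero_in_lifetime assms(2) family_section[OF continuous_on_angle_rate assms(1)]], of "pi / 2"]
    lifetime_open_interval[of J] by (simp add: open_interval_def)

lemma DERIV_height:
  assumes "J \<in> J_range \<kappa> H" "t \<in> lifetime J"
  shows "(prim (height_rate \<tau> a J) has_real_derivative height_rate \<tau> a J t) (at t)"
  using DERIV_prim[OF _ _ zero_in_lifetime assms(2) family_section[OF continuous_on_height_rate assms(1)]]
    lifetime_open_interval[of J] by (simp add: open_interval_def)

text \<open>
  The angle is defined by a quadrature; that it is the angle of the curve follows from comparing it with
  the unit vector \<open>(Q' / sn, (J + 2 H Q) / sn)\<close>, which has the same angular velocity and the same value at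
  time \<open>0\<close>.
\<close>

lemma angle_identities:
  assumes J: "J \<in> J_range \<kappa> H"
  shows "t \<in> lifetime J \<Longrightarrow> cos (angle J t) = Q' J t / sn \<kappa> (rad \<kappa> (Q J t))"
    and "t \<in> lifetime J \<Longrightarrow> sin (angle J t) = (J + 2 * H * Q J t) / sn \<kappa> (rad \<kappa> (Q J t))"
    and "t \<in> lifetime J \<Longrightarrow> angle_rate J t = 2 * H - ct \<kappa> (rad \<kappa> (Q J t)) * sin (angle J t)"
proof -
  let ?S = "\<lambda>t. sn \<kappa> (rad \<kappa> (Q J t))"
  define c where "c t = Q' J t / ?S t" for t
  define s where "s t = (J + 2 * H * Q J t) / ?S t" for t
  note R = explicit_radius[OF J]
  have e2: "(Q' J t)\<^sup>2 = (?S t)\<^sup>2 - (J + 2 * H * Q J t)\<^sup>2" if "t \<in> lifetime J" for t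
    using Q'_squared[OF J, of t] R(4)[OF that] by simp
  have q2: "1 - 2 * H * J - freq\<^sup>2 * Q J t = (1 - \<kappa> * Q J t) - 2 * H * (J + 2 * H * Q J t)" for t
    unfolding freq_squared by (simp add: power2_eq_square algebra_simps)
  note alg = explicit_algebra[OF R(3) R(4) refl refl e2 refl]
  have dS: "((\<lambda>t. ?S t) has_real_derivative (1 - \<kappa> * Q J t) * (Q' J t / ?S t)) (at t)" if "t \<in> lifetime J" for t
    using DERIV_sn[OF DERIV_radius[OF J that], of \<kappa>] R(5)[OF that] by simp
  have dc: "(c has_real_derivative - s t * angle_rate J t) (at t)" if t: "t \<in> lifetime J" for t
  proof -
    have "?S t \<noteq> 0" using R(3)[OF t] by simp
    from DERIV_divide[OF DERIV_Q'[of J] dS[OF t] this]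
    show ?thesis unfolding c_def[abs_def] s_def angle_rate_def R(4)[OF t, symmetric] q2 alg(1)[OF t t t] .
  qed
  have ds: "(s has_real_derivative c t * angle_rate J t) (at t)" if t: "t \<in> lifetime J" for t
  proof -
    have nz: "?S t \<noteq> 0" using R(3)[OF t] by simp
    have "((\<lambda>t. J + 2 * H * Q J t) has_real_derivative 2 * H * Q' J t) (at t)"
      using DERIV_add[OF DERIV_const DERIV_cmult[OF DERIV_Q], of J "2 * H"] by simp
    from DERIV_divide[OF this dS[OF t] nz]
    show ?thesis unfolding c_def s_def[abs_def] angle_rate_def R(4)[OF t, symmetric] alg(2)[OF t t t] .
  qed
  have c0: "c 0 = cos (angle J 0)" by (simp add: c_def Q'_def angle_def)
  \<comment> \<open>Energy conservation gives \<open>s 0 = 1\<close> or \<open>s 0 = -1\<close>; the lower end of the energy range decides the sign.\<close>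
  have s0: "s 0 = sin (angle J 0)"
  proof -
    have "freq\<^sup>2 * (J + 2 * H * Q J 0) = (2 * H + \<kappa> * J) + 2 * H * amp J"
    proof -
      have "freq\<^sup>2 * (J + 2 * H * Q J 0) = freq\<^sup>2 * J + 2 * H * (freq\<^sup>2 * Q J 0)" by (simp add: algebra_simps)
      also have "freq\<^sup>2 * Q J 0 = 1 - 2 * H * J + amp J" using freq_pos by (simp add: Q_def)
      finally show ?thesis unfolding freq_squared by (simp add: power2_eq_square algebra_simps)
    qed
    also have "\<dots> \<ge> 0" using J_range_ge[OF J] amp_nonneg[OF J] H_pos by simp
    finally have nn: "0 \<le> J + 2 * H * Q J 0" using freq_pos by (simp add: zero_le_mult_iff)
    have "(?S 0)\<^sup>2 = (J + 2 * H * Q J 0)\<^sup>2" using e2[OF zero_in_lifetime] by (simp add: Q'_def)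
    then have "?S 0 = J + 2 * H * Q J 0" using nn R(3)[OF zero_in_lifetime] by (simp add: power2_eq_iff)
    then show ?thesis using R(3)[OF zero_in_lifetime] by (simp add: s_def angle_def)
  qed
  have conv: "convex (lifetime J)" using lifetime_open_interval[of J] by (simp add: open_interval_def is_interval_convex)
  note L = circle_lift_unique[OF conv zero_in_lifetime _ c0 s0 dc ds DERIV_angle[OF J], simplified]
  show "t \<in> lifetime J \<Longrightarrow> cos (angle J t) = Q' J t / ?S t" using L(1)[of t] by (simp add: c_def)
  show s: "t \<in> lifetime J \<Longrightarrow> sin (angle J t) = (J + 2 * H * Q J t) / ?S t" using L(2)[of t] by (simp add: s_def)
  show "t \<in> lifetime J \<Longrightarrow> angle_rate J t = 2 * H - ct \<kappa> (rad \<kappa> (Q J t)) * sin (angle J t)"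
  proof -
    assume t: "t \<in> lifetime J"
    show ?thesis
      unfolding s[OF t] ct_def R(5)[OF t] alg(3)[OF t t t, symmetric] angle_rate_def R(4)[OF t] ..
  qed
qed

lemma explicit_solution:
  assumes J: "J \<in> J_range \<kappa> H"
  shows "is_solution \<kappa> \<tau> a H (lifetime J) (curve \<tau> a J) (angle J)"
    and "t \<in> lifetime J \<Longrightarrow> energy \<kappa> H (fst (curve \<tau> a J t)) (angle J t) = J"
proof -
  note R = explicit_radius[OF J] and A = angle_identities[OF J]
  show "is_solution \<kappa> \<tau> a H (lifetime J) (curve \<tau> a J) (angle J)"
  proof (rule is_solutionI[OF lifetime_open_interval])
    fix t assume t: "t \<in> lifetime J"
    show "fst (curve \<tau> a J t) \<in> I \<kappa>" using R(1)[OF t] by (simp add: curve_def)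
    show "((\<lambda>s. fst (curve \<tau> a J s)) has_real_derivative cos (angle J t)) (at t)"
      using DERIV_radius[OF J t] by (simp add: curve_def A(1)[OF t])
    have "W \<kappa> \<tau> a (rad \<kappa> (Q J t)) * sin (angle J t) = height_rate \<tau> a J t"
      unfolding W_eq[OF R(1)[OF t]] A(2)[OF t] R(2)[OF t] height_rate_def R(4)[OF t, symmetric]
      by (simp add: power2_eq_square)
    then show "((\<lambda>s. snd (curve \<tau> a J s)) has_real_derivative
        W \<kappa> \<tau> a (fst (curve \<tau> a J t)) * sin (angle J t)) (at t)"
      using DERIV_height[OF J t, of \<tau> a] by (simp add: curve_def)
    show "(angle J has_real_derivative 2 * H - ct \<kappa> (fst (curve \<tau> a J t)) * sin (angle J t)) (at t)"
      using DERIV_angle[OF J t] A(3)[OF t] by (simp add: curve_def)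
  qed
  show "energy \<kappa> H (fst (curve \<tau> a J t)) (angle J t) = J" if "t \<in> lifetime J"
    unfolding energy_vers using A(2)[OF that] R(2,3)[OF that] by (simp add: curve_def)
qed

lemma energy_identity:
  assumes "J \<in> J_range \<kappa> H"
  shows "freq\<^sup>2 * (q * (2 - \<kappa> * q) - (J + 2 * H * q)\<^sup>2) = (amp J)\<^sup>2 - (freq\<^sup>2 * q - (1 - 2 * H * J))\<^sup>2"
proof -
  have "q * (2 - \<kappa> * q) - (J + 2 * H * q)\<^sup>2 = 2 * (1 - 2 * H * J) * q - J\<^sup>2 - freq\<^sup>2 * q\<^sup>2"
    unfolding freq_squared by (simp add: power2_eq_square algebra_simps)
  show ?thesis unfolding amp_squared'[OF assms] \<open>q * (2 - \<kappa> * q) - _ = _\<close>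
    by (simp add: power2_eq_square algebra_simps)
qed

text \<open>
  The versine of any solution with energy \<open>J\<close> satisfies the oscillator equation, and the energy fixes its
  amplitude; only the phase remains, and this is the shift \<open>c\<close> of time. The versine and its derivative
  determine the angle modulo \<open>2 \<pi>\<close>, and the height has a known derivative.
\<close>

lemma rigidity:
  assumes J: "J \<in> J_range \<kappa> H" and sol: "is_solution \<kappa> \<tau> a H D \<gamma> \<sigma>"
    and en: "\<And>t. t \<in> D \<Longrightarrow> energy \<kappa> H (fst (\<gamma> t)) (\<sigma> t) = J"
  obtains c b and k :: int where "\<And>t. t \<in> D \<Longrightarrow> t + c \<in> lifetime J"
    "\<And>t. t \<in> D \<Longrightarrow> \<gamma> t = curve \<tau> a J (t + c) + (0, b)"
    "\<And>t. t \<in> D \<Longrightarrow> \<sigma> t = angle J (t + c) + 2 * pi * of_int k"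
proof -
  note S = is_solutionD[OF sol]
  obtain t0 where t0: "t0 \<in> D" using S(4) by blast
  define r where "r t = fst (\<gamma> t)" for t
  define v where "v t = vers \<kappa> (r t)" for t
  \<comment> \<open>Displacement from the equilibrium and velocity, the latter in units of the frequency.\<close>
  define y where "y t = v t - (1 - 2 * H * J) / freq\<^sup>2" for t
  define z where "z t = sn \<kappa> (r t) * cos (\<sigma> t) / freq" for t
  have r: "(r has_real_derivative cos (\<sigma> t)) (at t)" if "t \<in> D" for t
    using S(6)[OF that] by (simp add: r_def[abs_def])
  have snp: "0 < sn \<kappa> (r t)" if "t \<in> D" for t using sn_pos[OF S(5)[OF that]] by (simp add: r_def)
  have e: "sn \<kappa> (r t) * sin (\<sigma> t) = J + 2 * H * v t" if "t \<in> D" for t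
    using en[OF that] by (simp add: energy_vers r_def v_def)
  have dy: "(y has_real_derivative freq * z t) (at t)" if "t \<in> D" for t
    using DERIV_diff[OF DERIV_vers[OF r[OF that]] DERIV_const] freq_pos
    by (simp add: y_def[abs_def] v_def[abs_def] z_def)
  have dz: "(z has_real_derivative - freq * y t) (at t)" if t: "t \<in> D" for t
  proof -
    have s: "(\<sigma> has_real_derivative 2 * H - ct \<kappa> (r t) * sin (\<sigma> t)) (at t)" using S(8)[OF t] by (simp add: r_def)
    have "((\<lambda>t. sn \<kappa> (r t) * cos (\<sigma> t) / freq) has_real_derivative
      (cs \<kappa> (r t) * cos (\<sigma> t) * cos (\<sigma> t) + - sin (\<sigma> t) * (2 * H - ct \<kappa> (r t) * sin (\<sigma> t)) * sn \<kappa> (r t)) / freq) (at t)"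
      by (rule DERIV_cdivide[OF DERIV_mult[OF DERIV_sn[OF r[OF t]] DERIV_chain2[OF DERIV_cos s]]])
    moreover have "(cs \<kappa> (r t) * cos (\<sigma> t) * cos (\<sigma> t) + - sin (\<sigma> t) * (2 * H - ct \<kappa> (r t) * sin (\<sigma> t)) * sn \<kappa> (r t))
       = - freq\<^sup>2 * y t"
    proof -
      have c: "ct \<kappa> (r t) * sn \<kappa> (r t) = cs \<kappa> (r t)" using snp[OF t] by (simp add: ct_def)
      have "(cs \<kappa> (r t) * cos (\<sigma> t) * cos (\<sigma> t) + - sin (\<sigma> t) * (2 * H - ct \<kappa> (r t) * sin (\<sigma> t)) * sn \<kappa> (r t))
        = cs \<kappa> (r t) * (cos (\<sigma> t))\<^sup>2 + (ct \<kappa> (r t) * sn \<kappa> (r t)) * (sin (\<sigma> t))\<^sup>2 - 2 * H * (sn \<kappa> (r t) * sin (\<sigma> t))"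
        by (simp add: power2_eq_square algebra_simps)
      also have "\<dots> = cs \<kappa> (r t) * ((cos (\<sigma> t))\<^sup>2 + (sin (\<sigma> t))\<^sup>2) - 2 * H * (J + 2 * H * v t)"
        unfolding c e[OF t] distrib_left ..
      also have "\<dots> = 1 - 2 * H * J - freq\<^sup>2 * v t"
        unfolding freq_squared cs_vers sin_cos_squared_add2 v_def by (simp add: power2_eq_square algebra_simps)
      also have "\<dots> = - freq\<^sup>2 * y t"
      proof -
        have "freq\<^sup>2 * ((1 - 2 * H * J) / freq\<^sup>2) = 1 - 2 * H * J" using freq_pos by simp
        then show ?thesis unfolding y_def by (simp only: right_diff_distrib minus_mult_left [symmetric])
      qed
      finally show ?thesis .
    qed
    ultimately show ?thesis unfolding z_def[abs_def] using freq_pos by (simp add: power2_eq_square)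
  qed
  define R where "R = amp J / freq\<^sup>2"
  have "(y t0)\<^sup>2 + (z t0)\<^sup>2 = R\<^sup>2"
  proof -
    have "freq\<^sup>2 * (z t0)\<^sup>2 = (sn \<kappa> (r t0))\<^sup>2 - (sn \<kappa> (r t0) * sin (\<sigma> t0))\<^sup>2"
    proof -
      have "freq\<^sup>2 * (z t0)\<^sup>2 = (sn \<kappa> (r t0))\<^sup>2 * (cos (\<sigma> t0))\<^sup>2"
        using freq_pos by (simp add: z_def power_divide power_mult_distrib)
      then show ?thesis by (simp only: cos_squared_eq power_mult_distrib right_diff_distrib mult_1_right)
    qed
    then have "freq\<^sup>2 * (freq\<^sup>2 * (z t0)\<^sup>2) = freq\<^sup>2 * (v t0 * (2 - \<kappa> * v t0) - (J + 2 * H * v t0)\<^sup>2)"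
      unfolding e[OF t0] sn_squared v_def by simp
    also have "\<dots> = (amp J)\<^sup>2 - (freq\<^sup>2 * y t0)\<^sup>2"
    proof -
      have "freq\<^sup>2 * y t0 = freq\<^sup>2 * v t0 - (1 - 2 * H * J)"
        unfolding y_def right_diff_distrib[of _ "v t0"] using freq_pos by simp
      then show ?thesis unfolding energy_identity[OF J] by simp
    qed
    finally have "freq\<^sup>2 * freq\<^sup>2 * ((y t0)\<^sup>2 + (z t0)\<^sup>2) = (amp J)\<^sup>2"
      by (simp add: power_mult_distrib power2_eq_square algebra_simps)
    then show ?thesis using freq_pos by (simp add: R_def power_divide field_simps power2_eq_square)
  qed
  moreover have "0 \<le> R" using amp_nonneg[OF J] by (simp add: R_def)
  ultimately obtain \<theta> where \<theta>: "- pi < \<theta>" "\<theta> \<le> pi" "y t0 = R * cos \<theta>" "z t0 = - R * sin \<theta>"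
    by (rule polar_angle)
  define c where "c = \<theta> / freq - t0"
  have c: "freq * (t0 + c) = \<theta>" using freq_pos by (simp add: c_def)
  note osc = harmonic_oscillator_unique[OF S(3) t0 _ dy dz, of _ R c, unfolded c, OF _ _ _ \<theta>(3,4), simplified]
  have vQ: "v t = Q J (t + c)" if "t \<in> D" for t
    using osc(1)[OF that] by (simp add: y_def R_def Q_def add_divide_distrib)
  have zQ: "sn \<kappa> (r t) * cos (\<sigma> t) = Q' J (t + c)" if "t \<in> D" for t
    using osc(2)[OF that] freq_pos by (simp add: z_def R_def Q'_def field_simps power2_eq_square)
  have vp: "0 < v t" if "t \<in> D" for t using vers_pos[OF S(5)[OF that]] by (simp add: v_def r_def)
  have lifetime: "t + c \<in> lifetime J" if t: "t \<in> D" for t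
  proof (cases "J = 0")
    case True
    have Q0: "Q J (pi / freq) = 0" "Q J (- pi / freq) = 0" using True freq_pos by (simp_all add: Q_def amp_def)
    \<comment> \<open>The versine is positive on \<open>D\<close>, so \<open>D\<close> contains neither of the adjacent zeros of \<open>Q\<close>.\<close>
    have nd: "pi / freq - c \<notin> D" "- pi / freq - c \<notin> D" using vQ vp Q0 by (metis diff_add_cancel less_irrefl)+
    have "freq * (t0 + c) \<noteq> pi" using nd t0 freq_pos by (metis add_diff_cancel_right' nonzero_mult_div_cancel_left less_irrefl)
    then have b: "- pi / freq < t0 + c" "t0 + c < pi / freq"
      using \<theta>(1,2) c freq_pos by (simp_all add: field_simps)
    have "t + c < pi / freq"
    proof (rule ccontr)
      assume "\<not> t + c < pi / freq"
      then have "t0 \<le> pi / freq - c" "pi / freq - c \<le> t" using b by linarith+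
      then show False using nd(1) mem_is_interval_1_I[OF S(2) t0 t] by blast
    qed
    moreover have "- pi / freq < t + c"
    proof (rule ccontr)
      assume "\<not> - pi / freq < t + c"
      then have "t \<le> - pi / freq - c" "- pi / freq - c \<le> t0" using b by linarith+
      then show False using nd(2) mem_is_interval_1_I[OF S(2) t t0] by blast
    qed
    ultimately show ?thesis using True by (simp add: lifetime_def)
  qed (simp add: lifetime_def)
  have rR: "r t = rad \<kappa> (Q J (t + c))" if "t \<in> D" for t
    using rad_vers[OF S(5)[OF that]] vQ[OF that] by (simp add: r_def v_def)
  have cs: "cos (\<sigma> t) = cos (angle J (t + c))" "sin (\<sigma> t) = sin (angle J (t + c))" if t: "t \<in> D" for t
  proof -
    note A = angle_identities(1,2)[OF J lifetime[OF t], folded rR[OF t] vQ[OF t] zQ[OF t] e[OF t]]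
    show "cos (\<sigma> t) = cos (angle J (t + c))" "sin (\<sigma> t) = sin (angle J (t + c))"
      using A snp[OF t] by (simp_all add: e[OF t, symmetric])
  qed
  have "((\<lambda>t. \<sigma> t - angle J (t + c)) has_real_derivative 0) (at t within D)" if t: "t \<in> D" for t
  proof (rule has_field_derivative_at_within)
    have "fst (\<gamma> t) = rad \<kappa> (Q J (t + c))" using rR[OF t] by (simp add: r_def)
    then have 1: "(\<sigma> has_real_derivative angle_rate J (t + c)) (at t)"
      using S(8)[OF t] angle_identities(3)[OF J lifetime[OF t]] cs(2)[OF t] by simp
    show "((\<lambda>t. \<sigma> t - angle J (t + c)) has_real_derivative 0) (at t)"
      using DERIV_diff[OF 1 DERIV_angle[OF J lifetime[OF t], unfolded DERIV_shift]] by simp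
  qed
  then obtain d where d: "\<forall>t\<in>D. \<sigma> t - angle J (t + c) = d"
    using has_field_derivative_zero_constant[OF S(3), of "\<lambda>t. \<sigma> t - angle J (t + c)"] by blast
  obtain k :: int where k: "\<sigma> t0 = angle J (t0 + c) + 2 * pi * of_int k"
    using cs[OF t0] sin_cos_eq_iff[of "\<sigma> t0" "angle J (t0 + c)"] by auto
  have "((\<lambda>t. snd (\<gamma> t) - snd (curve \<tau> a J (t + c))) has_real_derivative 0) (at t within D)" if t: "t \<in> D" for t
  proof (rule has_field_derivative_at_within)
    note E = is_solutionD(7)[OF explicit_solution(1)[OF J, of \<tau> a] lifetime[OF t], unfolded DERIV_shift]
    show "((\<lambda>t. snd (\<gamma> t) - snd (curve \<tau> a J (t + c))) has_real_derivative 0) (at t)"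
      using DERIV_diff[OF S(7)[OF t] E] cs(2)[OF t] rR[OF t] by (simp add: curve_def r_def)
  qed
  then obtain b where b: "\<forall>t\<in>D. snd (\<gamma> t) - snd (curve \<tau> a J (t + c)) = b"
    using has_field_derivative_zero_constant[OF S(3), of "\<lambda>t. snd (\<gamma> t) - snd (curve \<tau> a J (t + c))"] by blast
  show ?thesis
  proof (rule that[of c b k])
    fix t assume t: "t \<in> D"
    show "t + c \<in> lifetime J" by (rule lifetime[OF t])
    show "\<gamma> t = curve \<tau> a J (t + c) + (0, b)"
      using b rR[OF t] t by (auto simp: prod_eq_iff curve_def r_def)
    show "\<sigma> t = angle J (t + c) + 2 * pi * of_int k"
      using d k t t0 by (smt (verit))
  qed
qed

text \<open>
  An extension of the explicit solution has the same energy, so by rigidity it is itself a piece of a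
  shifted explicit solution. The case \<open>J = 0\<close> is the only one where this is not immediate: there a bounded
  interval would be mapped by a translation into itself.
\<close>

lemma explicit_profile:
  assumes J: "J \<in> J_range \<kappa> H"
  shows "profile \<kappa> \<tau> a H J (lifetime J) (curve \<tau> a J) (angle J)"
  unfolding profile_def is_maximal_solution_def
proof (intro conjI allI impI ballI)
  show "is_solution \<kappa> \<tau> a H (lifetime J) (curve \<tau> a J) (angle J)" by (rule explicit_solution(1)[OF J])
  show "energy \<kappa> H (fst (curve \<tau> a J t)) (angle J t) = J" if "t \<in> lifetime J" for t
    by (rule explicit_solution(2)[OF J that])
  fix D' \<gamma>' \<sigma>'
  assume *: "is_solution \<kappa> \<tau> a H D' \<gamma>' \<sigma>' \<and> lifetime J \<subseteq> D' \<and> (\<forall>t\<in>lifetime J. \<gamma>' t = curve \<tau> a J t \<and> \<sigma>' t = angle J t)"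
  then have sol: "is_solution \<kappa> \<tau> a H D' \<gamma>' \<sigma>'" by blast
  obtain J' where J': "\<And>t. t \<in> D' \<Longrightarrow> energy \<kappa> H (fst (\<gamma>' t)) (\<sigma>' t) = J'"
    using energy_constant[OF sol] by blast
  have "J' = J" using J'[of 0] explicit_solution(2)[OF J zero_in_lifetime, of \<tau> a] * zero_in_lifetime[of J] by auto
  with J' have en: "\<And>t. t \<in> D' \<Longrightarrow> energy \<kappa> H (fst (\<gamma>' t)) (\<sigma>' t) = J" by simp
  obtain c b and k :: int where c: "\<And>t. t \<in> D' \<Longrightarrow> t + c \<in> lifetime J"
    by (rule rigidity[OF J sol en]) blast+
  show "D' = lifetime J"
  proof (cases "J = 0")
    case True
    \<comment> \<open>Otherwise a point of the interval close to one of its ends is moved out of it.\<close>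
    have "c = 0"
    proof (rule ccontr)
      assume "c \<noteq> 0"
      define t where "t = (if c > 0 then pi / freq - min c (pi / freq) else max c (- pi / freq))"
      have p: "0 < pi / freq" using freq_pos by simp
      have 1: "- min c (pi / freq) + pi / freq \<in> lifetime J" if "c > 0" using that True p by (auto simp: lifetime_def min_def)
      have 2: "- max c (- pi / freq) - pi / freq \<in> lifetime J" if "c < 0" using that True p by (auto simp: lifetime_def max_def)
      show False
      proof (cases "c > 0")
        case True
        then have "- min c (pi / freq) + pi / freq + c \<in> lifetime J" using 1 c * by blast
        then show False using \<open>J = 0\<close> by (auto simp: lifetime_def min_def split: if_splits)
      next
        case False
        then have "- max c (- pi / freq) - pi / freq + c \<in> lifetime J" using 2 c * \<open>c \<noteq> 0\<close> by (meson linorder_neqE_linordered_idom subsetD)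
        then show False using \<open>J = 0\<close> by (auto simp: lifetime_def max_def split: if_splits)
      qed
    qed
    then show ?thesis using c * by auto
  next
    case False
    then show ?thesis using * by (auto simp: lifetime_def)
  qed
qed

lemma solution_extends:
  assumes J: "J \<in> J_range \<kappa> H" and sol: "is_solution \<kappa> \<tau> a H D \<gamma> \<sigma>"
    and en: "\<And>t. t \<in> D \<Longrightarrow> energy \<kappa> H (fst (\<gamma> t)) (\<sigma> t) = J"
  obtains c b and k :: int where "D \<subseteq> {t. t + c \<in> lifetime J}"
    "\<And>t. t \<in> D \<Longrightarrow> \<gamma> t = curve \<tau> a J (t + c) + (0, b)"
    "\<And>t. t \<in> D \<Longrightarrow> \<sigma> t = angle J (t + c) + 2 * pi * of_int k"
    "profile \<kappa> \<tau> a H J {t. t + c \<in> lifetime J} (\<lambda>t. curve \<tau> a J (t + c) + (0, b)) (\<lambda>t. angle J (t + c) + 2 * pi * of_int k)"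
  using rigidity[OF J sol en] profile_shift[OF explicit_profile[OF J]] by (metis mem_Collect_eq subsetI)

text \<open>
  By maximality the piece given by \<open>solution_extends\<close> is everything.
\<close>

lemma profile_normal_form:
  assumes J: "J \<in> J_range \<kappa> H" and P: "profile \<kappa> \<tau> a H J D \<gamma> \<sigma>"
  obtains c b and k :: int where "D = {t. t + c \<in> lifetime J}"
    "\<And>t. t \<in> D \<Longrightarrow> \<gamma> t = curve \<tau> a J (t + c) + (0, b)"
    "\<And>t. t \<in> D \<Longrightarrow> \<sigma> t = angle J (t + c) + 2 * pi * of_int k"
proof -
  have sol: "is_solution \<kappa> \<tau> a H D \<gamma> \<sigma>" and en: "\<And>t. t \<in> D \<Longrightarrow> energy \<kappa> H (fst (\<gamma> t)) (\<sigma> t) = J"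
    using profileD(1,2)[OF P] by blast+
  obtain c b and k :: int where c: "D \<subseteq> {t. t + c \<in> lifetime J}"
    "\<And>t. t \<in> D \<Longrightarrow> \<gamma> t = curve \<tau> a J (t + c) + (0, b)"
    "\<And>t. t \<in> D \<Longrightarrow> \<sigma> t = angle J (t + c) + 2 * pi * of_int k"
    "profile \<kappa> \<tau> a H J {t. t + c \<in> lifetime J} (\<lambda>t. curve \<tau> a J (t + c) + (0, b)) (\<lambda>t. angle J (t + c) + 2 * pi * of_int k)"
    by (rule solution_extends[OF J sol en]) blast+
  have "{t. t + c \<in> lifetime J} = D"
    using profileD(1)[OF c(4)] c(1-3) by (intro profileD(3)[OF P]) auto
  with c show ?thesis by (intro that[of c b k]) auto
qed

lemma profile_unique:
  assumes J: "J \<in> J_range \<kappa> H" and "profile \<kappa> \<tau> a H J D \<gamma> \<sigma>" "profile \<kappa> \<tau> a H J D' \<gamma>' \<sigma>'"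
  shows "same_profile D \<gamma> \<sigma> D' \<gamma>' \<sigma>'"
proof -
  obtain c b and k :: int where 1: "D = {t. t + c \<in> lifetime J}"
    "\<And>t. t \<in> D \<Longrightarrow> \<gamma> t = curve \<tau> a J (t + c) + (0, b)"
    "\<And>t. t \<in> D \<Longrightarrow> \<sigma> t = angle J (t + c) + 2 * pi * of_int k"
    by (rule profile_normal_form[OF assms(1,2)]) blast
  obtain c' b' and k' :: int where 2: "D' = {t. t + c' \<in> lifetime J}"
    "\<And>t. t \<in> D' \<Longrightarrow> \<gamma>' t = curve \<tau> a J (t + c') + (0, b')"
    "\<And>t. t \<in> D' \<Longrightarrow> \<sigma>' t = angle J (t + c') + 2 * pi * of_int k'"
    by (rule profile_normal_form[OF assms(1,3)]) blast
  have D': "D' = (\<lambda>t. t + (c - c')) ` D"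
  proof (intro set_eqI iffI)
    fix t assume "t \<in> D'"
    then show "t \<in> (\<lambda>t. t + (c - c')) ` D"
      unfolding 1(1) 2(1) by (intro image_eqI[of _ _ "t - (c - c')"]) (auto simp: algebra_simps)
  qed (auto simp: 1(1) 2(1))
  show ?thesis unfolding same_profile_def
  proof (rule exI[of _ "c - c'"], rule exI[of _ "b' - b"], rule exI[of _ "k' - k"], intro conjI ballI D')
    fix t assume t: "t \<in> D"
    then have t': "t + (c - c') \<in> D'" using D' by blast
    have s: "t + (c - c') + c' = t + c" by simp
    show "\<gamma>' (t + (c - c')) = \<gamma> t + (0, b' - b)"
      using 2(2)[OF t', unfolded s] 1(2)[OF t] by (simp add: prod_eq_iff)
    show "\<sigma>' (t + (c - c')) = \<sigma> t + 2 * pi * real_of_int (k' - k)"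
      using 2(3)[OF t', unfolded s] 1(3)[OF t] by (simp add: algebra_simps)
  qed
qed

end

section \<open>Generating equations and constant mean curvature\<close>

lemma continuous_on_sn [continuous_intros]: "continuous_on S f \<Longrightarrow> continuous_on S (\<lambda>x. sn \<kappa> (f x))"
  by (rule continuous_on_compose2[of UNIV "sn \<kappa>"])
     (auto intro!: DERIV_continuous_on DERIV_sn[OF DERIV_ident])

lemma continuous_on_cs [continuous_intros]: "continuous_on S f \<Longrightarrow> continuous_on S (\<lambda>x. cs \<kappa> (f x))"
  by (rule continuous_on_compose2[of UNIV "cs \<kappa>"])
     (auto intro!: DERIV_continuous_on DERIV_cs[OF DERIV_ident])

lemma continuous_on_vers [continuous_intros]: "continuous_on S f \<Longrightarrow> continuous_on S (\<lambda>x. vers \<kappa> (f x))"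
  unfolding vers_def by (intro continuous_intros) auto

text \<open>
  The derivative of \<open>W\<close> with respect to the radius.
\<close>

definition W' :: "real \<Rightarrow> real \<Rightarrow> real \<Rightarrow> real \<Rightarrow> real" where
  "W' \<kappa> \<tau> a r = (2 * \<tau> * vers \<kappa> r - a) * (2 * \<tau> - (2 * \<tau> * vers \<kappa> r - a) * cs \<kappa> r / (sn \<kappa> r)\<^sup>2)
        / (sn \<kappa> r * W \<kappa> \<tau> a r)"

lemma continuous_on_W:
  assumes "continuous_on S r" "\<And>x. x \<in> S \<Longrightarrow> r x \<in> I \<kappa>"
  shows "continuous_on S (\<lambda>x. W \<kappa> \<tau> a (r x))"
  by (rule continuous_on_compose2[of "I \<kappa>" "W \<kappa> \<tau> a"])
     (use assms in \<open>auto intro!: DERIV_continuous_on has_field_derivative_at_within[OF DERIV_W]\<close>)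

lemma continuous_on_W':
  assumes "continuous_on S r" "\<And>x. x \<in> S \<Longrightarrow> r x \<in> I \<kappa>"
  shows "continuous_on S (\<lambda>x. W' \<kappa> \<tau> a (r x))"
proof -
  have "sn \<kappa> (r x) \<noteq> 0" "W \<kappa> \<tau> a (r x) \<noteq> 0" if "x \<in> S" for x
    using sn_pos[OF assms(2)[OF that]] W_pos[OF assms(2)[OF that], of \<tau> a] by auto
  then show ?thesis unfolding W'_def
    by (intro continuous_intros continuous_on_W assms) auto
qed

lemma solution_derivatives:
  assumes sol: "is_solution \<kappa> \<tau> a H D \<gamma> \<sigma>"
  shows "t \<in> D \<Longrightarrow> (\<gamma> has_vector_derivative (cos (\<sigma> t), W \<kappa> \<tau> a (fst (\<gamma> t)) * sin (\<sigma> t))) (at t)"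
    and "continuous_on D \<gamma>" and "continuous_on D \<sigma>"
    and "continuous_on D (\<lambda>t. (cos (\<sigma> t), W \<kappa> \<tau> a (fst (\<gamma> t)) * sin (\<sigma> t)))"
proof -
  note S = is_solutionD[OF sol]
  show 1: "(\<gamma> has_vector_derivative (cos (\<sigma> t), W \<kappa> \<tau> a (fst (\<gamma> t)) * sin (\<sigma> t))) (at t)" if "t \<in> D" for t
    using has_vector_derivative_Pair[OF S(6)[OF that, unfolded has_real_derivative_iff_has_vector_derivative]
      S(7)[OF that, unfolded has_real_derivative_iff_has_vector_derivative]] by simp
  show g: "continuous_on D \<gamma>"
    using 1 by (metis continuous_at_imp_continuous_on has_vector_derivative_continuous)
  show s: "continuous_on D \<sigma>"
    using S(8) by (metis continuous_at_imp_continuous_on DERIV_isCont)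
  show "continuous_on D (\<lambda>t. (cos (\<sigma> t), W \<kappa> \<tau> a (fst (\<gamma> t)) * sin (\<sigma> t)))"
    by (intro continuous_intros continuous_on_W g s) (use S(5) in auto)
qed

lemma solution_unit_speed:
  assumes sol: "is_solution \<kappa> \<tau> a H D \<gamma> \<sigma>"
  shows "unit_speed_curve \<kappa> \<tau> a D \<gamma>"
proof -
  note S = is_solutionD[OF sol] and d = solution_derivatives[OF sol]
  let ?g = "\<lambda>t. (cos (\<sigma> t), W \<kappa> \<tau> a (fst (\<gamma> t)) * sin (\<sigma> t))"
  let ?s = "\<lambda>t. 2 * H - ct \<kappa> (fst (\<gamma> t)) * sin (\<sigma> t)"
  let ?g' = "\<lambda>t. (- sin (\<sigma> t) * ?s t, W' \<kappa> \<tau> a (fst (\<gamma> t)) * cos (\<sigma> t) * sin (\<sigma> t)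
     + cos (\<sigma> t) * ?s t * W \<kappa> \<tau> a (fst (\<gamma> t)))"
  have vd: "vector_derivative \<gamma> (at t) = ?g t" if "t \<in> D" for t
    by (rule vector_derivative_at[OF d(1)[OF that]])
  have g': "(?g has_vector_derivative ?g' t) (at t)" if t: "t \<in> D" for t
  proof -
    have 1: "((\<lambda>t. cos (\<sigma> t)) has_real_derivative - sin (\<sigma> t) * ?s t) (at t)"
      by (rule DERIV_chain2[OF DERIV_cos S(8)[OF t]])
    have 2: "((\<lambda>t. W \<kappa> \<tau> a (fst (\<gamma> t)) * sin (\<sigma> t)) has_real_derivative
        W' \<kappa> \<tau> a (fst (\<gamma> t)) * cos (\<sigma> t) * sin (\<sigma> t) + cos (\<sigma> t) * ?s t * W \<kappa> \<tau> a (fst (\<gamma> t))) (at t)"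
      unfolding W'_def
      by (rule DERIV_mult[OF DERIV_chain2[OF DERIV_W[OF S(5)[OF t]] S(6)[OF t]] DERIV_chain2[OF DERIV_sin S(8)[OF t]]])
    show ?thesis
      using has_vector_derivative_Pair[OF 1[unfolded has_real_derivative_iff_has_vector_derivative]
        2[unfolded has_real_derivative_iff_has_vector_derivative]] .
  qed
  have cg': "continuous_on D ?g'"
  proof -
    have "sn \<kappa> (fst (\<gamma> t)) \<noteq> 0" if "t \<in> D" for t using sn_pos[OF S(5)[OF that]] by simp
    then show ?thesis unfolding ct_def
      by (intro continuous_intros continuous_on_W continuous_on_W' d(2,3)) (use S(5) in auto)
  qed
  have vdd: "((\<lambda>t. vector_derivative \<gamma> (at t)) has_vector_derivative ?g' t) (at t)" if "t \<in> D" for t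
    by (rule has_vector_derivative_transform_within_open[OF g'[OF that] S(1) that]) (simp add: vd)
  have W0: "W \<kappa> \<tau> a (fst (\<gamma> t)) \<noteq> 0" if "t \<in> D" for t using W_pos[OF S(5)[OF that], of \<tau> a] by simp
  show ?thesis unfolding unit_speed_curve_def
  proof (intro conjI ballI)
    show "open_interval D" using S by (simp add: open_interval_def)
    show "\<gamma> ` D \<subseteq> I \<kappa> \<times> UNIV" using S(5) by (simp add: image_subset_iff mem_Times_iff)
    show "\<gamma> C1_differentiable_on D"
      unfolding C1_differentiable_on_def by (rule exI[of _ ?g]) (intro conjI ballI d(1,4))
    show "(\<lambda>t. vector_derivative \<gamma> (at t)) C1_differentiable_on D"
      unfolding C1_differentiable_on_def by (rule exI[of _ ?g']) (intro conjI ballI vdd cg')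
    show "(fst (vector_derivative \<gamma> (at t)))\<^sup>2 + (snd (vector_derivative \<gamma> (at t)))\<^sup>2 / (W \<kappa> \<tau> a (fst (\<gamma> t)))\<^sup>2 = 1"
      if "t \<in> D" for t
      using W0[OF that] by (simp add: vd[OF that] power_mult_distrib)
  qed
qed

lemma solution_has_cmc:
  assumes sol: "is_solution \<kappa> \<tau> a H D \<gamma> \<sigma>"
  shows "has_cmc \<kappa> \<tau> a H D \<gamma>"
  unfolding has_cmc_def
proof
  note S = is_solutionD[OF sol]
  fix p assume "p \<in> D \<times> (UNIV :: real set)"
  then obtain t \<phi> where p: "p = (t, \<phi>)" and t: "t \<in> D" by auto
  obtain N where N: "is_unit_normal \<kappa> \<tau> (gen_coord a \<gamma>) (t, \<phi>) N"
    using mean_curvature_gen_coord(1)[OF S(1) t S(6) S(7) S(5)[OF t] S(8)[OF t], of \<phi>] by blast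
  have "mean_curvature \<kappa> \<tau> (gen_coord a \<gamma>) (t, \<phi>) N
      = (2 * H - ct \<kappa> (fst (\<gamma> t)) * sin (\<sigma> t) + ct \<kappa> (fst (\<gamma> t)) * sin (\<sigma> t)) / 2"
    by (rule mean_curvature_gen_coord(2)[OF S(1) t S(6) S(7) S(5)[OF t] S(8)[OF t] N])
  then show "\<exists>N. is_unit_normal \<kappa> \<tau> (gen_coord a \<gamma>) p N \<and> mean_curvature \<kappa> \<tau> (gen_coord a \<gamma>) p N = H"
    using N p by auto
qed

text \<open>
  The components of the unit tangent in the orbit space are continuously differentiable functions on the
  unit circle, so an angle is obtained by integrating their angular velocity.
\<close>

lemma cmc_curve_is_solution:
  assumes us: "unit_speed_curve \<kappa> \<tau> a D \<gamma>" and cmc: "has_cmc \<kappa> \<tau> a H D \<gamma>"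
  obtains \<sigma> where "is_solution \<kappa> \<tau> a H D \<gamma> \<sigma>"
proof -
  have oi: "open_interval D" and D: "open D" "is_interval D" "D \<noteq> {}" and I: "\<And>t. t \<in> D \<Longrightarrow> fst (\<gamma> t) \<in> I \<kappa>"
    using us by (auto simp: unit_speed_curve_def open_interval_def)
  obtain g where g: "\<And>t. t \<in> D \<Longrightarrow> (\<gamma> has_vector_derivative g t) (at t)" "continuous_on D g"
    using us by (auto simp: unit_speed_curve_def C1_differentiable_on_def)
  have vd: "vector_derivative \<gamma> (at t) = g t" if "t \<in> D" for t
    by (rule vector_derivative_at[OF g(1)[OF that]])
  obtain g' where g'0: "\<And>t. t \<in> D \<Longrightarrow> ((\<lambda>t. vector_derivative \<gamma> (at t)) has_vector_derivative g' t) (at t)"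
      and cg': "continuous_on D g'"
    using us unfolding unit_speed_curve_def C1_differentiable_on_def[of "\<lambda>t. vector_derivative \<gamma> (at t)"] by blast
  have g': "(g has_vector_derivative g' t) (at t)" if "t \<in> D" for t
    by (rule has_vector_derivative_transform_within_open[OF g'0[OF that] D(1) that]) (simp add: vd)
  define w where "w t = W \<kappa> \<tau> a (fst (\<gamma> t))" for t
  define w' where "w' t = W' \<kappa> \<tau> a (fst (\<gamma> t)) * fst (g t)" for t
  define c where "c t = fst (g t)" for t
  define s where "s t = snd (g t) / w t" for t
  define c' where "c' t = fst (g' t)" for t
  define s' where "s' t = (snd (g' t) * w t - snd (g t) * w' t) / (w t * w t)" for t
  have wp: "0 < w t" if "t \<in> D" for t using W_pos[OF I[OF that]] by (simp add: w_def)
  have r: "((\<lambda>t. fst (\<gamma> t)) has_real_derivative fst (g t)) (at t)" if "t \<in> D" for t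
    unfolding has_real_derivative_iff_has_vector_derivative
    by (rule bounded_linear.has_vector_derivative[OF bounded_linear_fst g(1)[OF that]])
  have h: "((\<lambda>t. snd (\<gamma> t)) has_real_derivative snd (g t)) (at t)" if "t \<in> D" for t
    unfolding has_real_derivative_iff_has_vector_derivative
    by (rule bounded_linear.has_vector_derivative[OF bounded_linear_snd g(1)[OF that]])
  have dc: "(c has_real_derivative c' t) (at t)" if "t \<in> D" for t
    unfolding has_real_derivative_iff_has_vector_derivative c_def[abs_def] c'_def
    by (rule bounded_linear.has_vector_derivative[OF bounded_linear_fst g'[OF that]])
  have dh: "((\<lambda>t. snd (g t)) has_real_derivative snd (g' t)) (at t)" if "t \<in> D" for t
    unfolding has_real_derivative_iff_has_vector_derivative
    by (rule bounded_linear.has_vector_derivative[OF bounded_linear_snd g'[OF that]])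
  have dw: "(w has_real_derivative w' t) (at t)" if t: "t \<in> D" for t
    unfolding w_def[abs_def] w'_def W'_def by (rule DERIV_chain2[OF DERIV_W[OF I[OF t]] r[OF t]])
  have ds: "(s has_real_derivative s' t) (at t)" if t: "t \<in> D" for t
    unfolding s_def[abs_def] s'_def using wp[OF t] by (intro DERIV_divide dh dw t) auto
  have cg: "continuous_on D \<gamma>" using g(1) by (metis continuous_at_imp_continuous_on has_vector_derivative_continuous)
  have cw: "continuous_on D w" unfolding w_def by (intro continuous_on_W continuous_intros cg I)
  have cs': "continuous_on D s'" and cc': "continuous_on D c'" and cc: "continuous_on D c" and cs: "continuous_on D s"
    unfolding s'_def c'_def c_def s_def w'_def
    using wp by (intro continuous_intros cw continuous_on_W' cg g(2) cg' I; force)+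
  \<comment> \<open>The angular velocity of the unit tangent.\<close>
  define \<theta> where "\<theta> t = c t * s' t - s t * c' t" for t
  have c\<theta>: "continuous_on D \<theta>" unfolding \<theta>_def by (intro continuous_intros cc cs cc' cs')
  have one: "(c t)\<^sup>2 + (s t)\<^sup>2 = 1" if "t \<in> D" for t
    using us vd[OF that] that by (auto simp: unit_speed_curve_def c_def s_def w_def power_divide)
  have orth: "c t * c' t + s t * s' t = 0" if t: "t \<in> D" for t
  proof -
    have "((\<lambda>t. c t * c t + s t * s t) has_real_derivative c' t * c t + c' t * c t + (s' t * s t + s' t * s t)) (at t)"
      by (rule DERIV_add[OF DERIV_mult[OF dc dc] DERIV_mult[OF ds ds]]; fact t)
    moreover have "((\<lambda>t. c t * c t + s t * s t) has_real_derivative 0) (at t)"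
      by (rule has_field_derivative_transform_within_open[OF DERIV_const[of 1] D(1) t])
         (use one in \<open>simp add: power2_eq_square\<close>)
    ultimately have "c' t * c t + c' t * c t + (s' t * s t + s' t * s t) = 0" by (rule DERIV_unique)
    then show ?thesis by (simp add: algebra_simps)
  qed
  have c'\<theta>: "c' t = - s t * \<theta> t" and s'\<theta>: "s' t = c t * \<theta> t" if t: "t \<in> D" for t
  proof -
    have "- s t * \<theta> t = ((c t)\<^sup>2 + (s t)\<^sup>2) * c' t - c t * (c t * c' t + s t * s' t)"
      by (simp add: \<theta>_def power2_eq_square algebra_simps)
    then show "c' t = - s t * \<theta> t" by (simp add: one[OF t] orth[OF t])
    have "c t * \<theta> t = ((c t)\<^sup>2 + (s t)\<^sup>2) * s' t - s t * (c t * c' t + s t * s' t)"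
      by (simp add: \<theta>_def power2_eq_square algebra_simps)
    then show "s' t = c t * \<theta> t" by (simp add: one[OF t] orth[OF t])
  qed
  obtain t0 where t0: "t0 \<in> D" using D(3) by blast
  obtain \<sigma>0 where \<sigma>0: "c t0 = cos \<sigma>0" "s t0 = sin \<sigma>0"
    using sincos_total_2pi[OF one[OF t0]] by metis
  define \<sigma> where "\<sigma> t = \<sigma>0 + prim (\<lambda>u. \<theta> (u + t0)) (t + - t0)" for t
  define E where "E = (+) (- t0) ` D"
  have E: "open E" "is_interval E" "0 \<in> E" using D t0
    unfolding E_def by (simp_all only: open_translation is_interval_translation) force
  have d\<sigma>: "(\<sigma> has_real_derivative \<theta> t) (at t)" if t: "t \<in> D" for t
  proof -
    have "t + - t0 \<in> E" using t by (auto simp: E_def image_iff)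
    moreover have "continuous_on E (\<lambda>u. \<theta> (u + t0))"
      by (rule continuous_on_compose2[OF c\<theta>]) (auto simp: E_def intro!: continuous_intros)
    ultimately have "(prim (\<lambda>u. \<theta> (u + t0)) has_real_derivative \<theta> (t + - t0 + t0)) (at (t + - t0))"
      using DERIV_prim[OF E] by blast
    from DERIV_add[OF DERIV_const this[unfolded DERIV_shift], of \<sigma>0]
    show ?thesis by (simp add: \<sigma>_def[abs_def])
  qed
  have \<sigma>t0: "\<sigma> t0 = \<sigma>0" by (simp add: \<sigma>_def)
  have lift: "c t = cos (\<sigma> t)" "s t = sin (\<sigma> t)" if t: "t \<in> D" for t
    using circle_lift_unique[OF is_interval_convex[OF D(2)] t0 t, of c \<sigma> s \<theta>] dc ds d\<sigma> c'\<theta> s'\<theta> \<sigma>0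
    by (simp_all add: \<sigma>t0)
  have R: "((\<lambda>s. fst (\<gamma> s)) has_real_derivative cos (\<sigma> t)) (at t)" if "t \<in> D" for t
    using r[OF that] lift(1)[OF that] by (simp add: c_def)
  have h': "((\<lambda>s. snd (\<gamma> s)) has_real_derivative W \<kappa> \<tau> a (fst (\<gamma> t)) * sin (\<sigma> t)) (at t)" if "t \<in> D" for t
    using h[OF that] lift(2)[OF that] wp[OF that] by (simp add: s_def w_def field_simps)
  have \<theta>H: "\<theta> t = 2 * H - ct \<kappa> (fst (\<gamma> t)) * sin (\<sigma> t)" if t: "t \<in> D" for t
  proof -
    have "(t, 0) \<in> D \<times> (UNIV :: real set)" using t by simp
    then obtain N where N: "is_unit_normal \<kappa> \<tau> (gen_coord a \<gamma>) (t, 0) N"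
        "mean_curvature \<kappa> \<tau> (gen_coord a \<gamma>) (t, 0) N = H"
      using cmc unfolding has_cmc_def by blast
    have "H = (\<theta> t + ct \<kappa> (fst (\<gamma> t)) * sin (\<sigma> t)) / 2"
      using mean_curvature_gen_coord(2)[OF D(1) t R h' I[OF t] d\<sigma>[OF t] N(1)] N(2) by simp
    then show ?thesis by simp
  qed
  have "is_solution \<kappa> \<tau> a H D \<gamma> \<sigma>"
    by (rule is_solutionI[OF oi I R h']) (use d\<sigma> \<theta>H in auto)
  then show ?thesis by (rule that)
qed

context cmc
begin

text \<open>
  For \<open>J > 0\<close> the hypothesis bounds \<open>\<omega>\<^sup>2 q\<^sup>2 + J\<^sup>2\<close> by \<open>2 (1 - 2 H J) q\<close>, and the arithmetic-geometric mean
  inequality bounds it from below by \<open>2 \<omega> J q\<close>.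
\<close>

lemma energy_le_J_max:
  assumes "0 < q" "(J + 2 * H * q)\<^sup>2 \<le> q * (2 - \<kappa> * q)"
  shows "J \<le> J_max \<kappa> H"
proof (cases "J \<le> 0")
  case True
  then show ?thesis using J_max_pos by linarith
next
  case False
  have "(J + 2 * H * q)\<^sup>2 - q * (2 - \<kappa> * q) = freq\<^sup>2 * q\<^sup>2 + J\<^sup>2 - 2 * (1 - 2 * H * J) * q"
    unfolding freq_squared by (simp add: power2_eq_square algebra_simps)
  moreover have "0 \<le> (freq * q - J)\<^sup>2" by simp
  then have "2 * (freq * J) * q \<le> freq\<^sup>2 * q\<^sup>2 + J\<^sup>2" by (simp add: power2_eq_square algebra_simps)
  ultimately have "2 * (freq * J) * q \<le> 2 * (1 - 2 * H * J) * q" using assms(2) by linarith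
  then have "freq * J \<le> 1 - 2 * H * J" using assms(1) by simp
  then have "J * (freq + 2 * H) \<le> 1" by (simp add: algebra_simps)
  then show ?thesis using freq_pos H_pos by (simp add: J_max_eq pos_le_divide_eq)
qed

lemma energy_range:
  assumes "r \<in> I \<kappa>"
  shows "energy \<kappa> H r \<sigma> \<le> J_max \<kappa> H"
proof (rule energy_le_J_max)
  show "0 < vers \<kappa> r" by (rule vers_pos[OF assms])
  have "(sn \<kappa> r)\<^sup>2 * (sin \<sigma>)\<^sup>2 \<le> (sn \<kappa> r)\<^sup>2 * 1"
    by (rule mult_left_mono) (auto simp: abs_square_le_1)
  then show "(energy \<kappa> H r \<sigma> + 2 * H * vers \<kappa> r)\<^sup>2 \<le> vers \<kappa> r * (2 - \<kappa> * vers \<kappa> r)"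
    unfolding energy_vers by (simp add: power_mult_distrib flip: sn_squared)
qed

text \<open>
  If the energy is below the listed range, the flipped curve has its energy in the range: the bound by
  \<open>J\<^sub>m\<^sub>a\<^sub>x\<close> applies to both axes.
\<close>

lemma cmc_curve_extends:
  assumes "unit_speed_curve \<kappa> \<tau> a D \<gamma>" "has_cmc \<kappa> \<tau> a H D \<gamma>"
  shows "\<exists>J D' \<gamma>' \<sigma>'. D \<subseteq> D' \<and> (\<forall>t\<in>D. \<gamma>' t = \<gamma> t) \<and> profile \<kappa> \<tau> a H J D' \<gamma>' \<sigma>' \<and>
           (J \<in> J_range \<kappa> H \<or>
            \<kappa> > 0 \<and> J < - 2 * H / \<kappa> \<and> - J - 4 * H / \<kappa> \<in> J_range \<kappa> H \<and>
            profile \<kappa> \<tau> (4 * \<tau> / \<kappa> - a) H (- J - 4 * H / \<kappa>) D'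
              (\<lambda>t. (pi / sqrt \<kappa> - fst (\<gamma>' t), - snd (\<gamma>' t))) (\<lambda>t. \<sigma>' t + pi))"
proof -
  obtain \<sigma> where sol: "is_solution \<kappa> \<tau> a H D \<gamma> \<sigma>"
    using cmc_curve_is_solution[OF assms] .
  obtain J where J: "\<And>t. t \<in> D \<Longrightarrow> energy \<kappa> H (fst (\<gamma> t)) (\<sigma> t) = J"
    by (rule energy_constant[OF sol]) blast
  note S = is_solutionD[OF sol]
  obtain t0 where t0: "t0 \<in> D" using S(4) by blast
  have Jm: "J \<le> J_max \<kappa> H" using energy_range[OF S(5)[OF t0]] J[OF t0] by metis
  show ?thesis
  proof (cases "\<kappa> > 0 \<and> J < - 2 * H / \<kappa>")
    case False
    then have JR: "J \<in> J_range \<kappa> H" using Jm by (auto simp: J_range_def)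
    obtain c b and k :: int where e: "D \<subseteq> {t. t + c \<in> lifetime J}"
      "\<And>t. t \<in> D \<Longrightarrow> \<gamma> t = curve \<tau> a J (t + c) + (0, b)"
      "\<And>t. t \<in> D \<Longrightarrow> \<sigma> t = angle J (t + c) + 2 * pi * of_int k"
      "profile \<kappa> \<tau> a H J {t. t + c \<in> lifetime J} (\<lambda>t. curve \<tau> a J (t + c) + (0, b)) (\<lambda>t. angle J (t + c) + 2 * pi * of_int k)"
      by (rule solution_extends[OF JR sol J]) blast+
    show ?thesis
    proof (rule exI[of _ J], rule exI[of _ "{t. t + c \<in> lifetime J}"], rule exI[of _ "\<lambda>t. curve \<tau> a J (t + c) + (0, b)"],
        rule exI[of _ "\<lambda>t. angle J (t + c) + 2 * pi * of_int k"], intro conjI ballI disjI1)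
      show "D \<subseteq> {t. t + c \<in> lifetime J}" by (rule e(1))
      show "curve \<tau> a J (t + c) + (0, b) = \<gamma> t" if "t \<in> D" for t by (rule e(2)[OF that, symmetric])
    qed (rule e(4), rule JR)
  next
    case True
    then have \<kappa>: "\<kappa> > 0" and Jl: "J < - 2 * H / \<kappa>" by auto
    define J' where "J' = - J - 4 * H / \<kappa>"
    let ?a = "4 * \<tau> / \<kappa> - a" and ?f = "\<lambda>\<gamma> t. (pi / sqrt \<kappa> - fst (\<gamma> t), - snd (\<gamma> t)) :: real \<times> real"
    have sol': "is_solution \<kappa> \<tau> ?a H D (?f \<gamma>) (\<lambda>t. \<sigma> t + pi)" by (rule is_solution_flip[OF \<kappa> sol])
    have J': "energy \<kappa> H (fst (?f \<gamma> t)) (\<sigma> t + pi) = J'" if "t \<in> D" for t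
      using J[OF that] by (simp add: energy_vers sn_flip[OF \<kappa>] vers_flip[OF \<kappa>] J'_def algebra_simps)
    have "J' \<le> J_max \<kappa> H" using energy_range[OF is_solutionD(5)[OF sol' t0]] J'[OF t0] by metis
    moreover have "- 2 * H / \<kappa> \<le> J'" using Jl by (simp add: J'_def)
    ultimately have JR: "J' \<in> J_range \<kappa> H" using \<kappa> by (simp add: J_range_def)
    obtain c b and k :: int where e: "D \<subseteq> {t. t + c \<in> lifetime J'}"
      "\<And>t. t \<in> D \<Longrightarrow> ?f \<gamma> t = curve \<tau> ?a J' (t + c) + (0, b)"
      "\<And>t. t \<in> D \<Longrightarrow> \<sigma> t + pi = angle J' (t + c) + 2 * pi * of_int k"
      "profile \<kappa> \<tau> ?a H J' {t. t + c \<in> lifetime J'} (\<lambda>t. curve \<tau> ?a J' (t + c) + (0, b)) (\<lambda>t. angle J' (t + c) + 2 * pi * of_int k)"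
      by (rule solution_extends[OF JR sol' J']) blast+
    define D' where "D' = {t. t + c \<in> lifetime J'}"
    define \<gamma>1 where "\<gamma>1 t = curve \<tau> ?a J' (t + c) + (0, b)" for t
    define \<sigma>1 where "\<sigma>1 t = angle J' (t + c) + 2 * pi * of_int k - pi" for t
    have p1: "profile \<kappa> \<tau> ?a H J' D' \<gamma>1 (\<lambda>t. \<sigma>1 t + pi)"
      using e(4) by (simp add: D'_def \<gamma>1_def[abs_def] \<sigma>1_def)
    have p2: "profile \<kappa> \<tau> a H J D' (?f \<gamma>1) \<sigma>1"
      using profile_shift[OF profile_flip[OF \<kappa> p1], of 0 0 "-1"] by (simp add: J'_def flip: zero_prod_def)
    have ff: "?f (?f \<gamma>1) = \<gamma>1" by (rule ext) (simp only: fst_conv snd_conv minus_minus diff_diff_eq2 add_diff_cancel_left' prod.collapse)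
    show ?thesis
    proof (rule exI[of _ J], rule exI[of _ D'], rule exI[of _ "?f \<gamma>1"], rule exI[of _ \<sigma>1], intro conjI ballI disjI2 \<kappa> Jl p2)
      show "D \<subseteq> D'" using e(1) by (simp add: D'_def)
      show "?f \<gamma>1 t = \<gamma> t" if "t \<in> D" for t
        using e(2)[OF that] by (simp add: \<gamma>1_def[symmetric] prod_eq_iff)
      show "- J - 4 * H / \<kappa> \<in> J_range \<kappa> H" using JR by (simp add: J'_def)
      show "profile \<kappa> \<tau> ?a H (- J - 4 * H / \<kappa>) D' (?f (?f \<gamma>1)) (\<lambda>t. \<sigma>1 t + pi)"
        using p1 unfolding ff J'_def .
    qed
  qed
qed

end

section \<open>Coverings and the topological type of an invariant surface\<close>

lemma covering_space_Times:
  assumes "covering_space C p S" "covering_space D q T"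
  shows "covering_space (C \<times> D) (\<lambda>(x, y). (p x, q y)) (S \<times> T)"
proof (rule covering_spaceI)
  have cp: "continuous_on C p" and cq: "continuous_on D q" and ip: "p ` C = S" and iq: "q ` D = T"
    using assms by (auto simp: covering_space_def)
  show "continuous_on (C \<times> D) (\<lambda>(x, y). (p x, q y))"
    unfolding case_prod_beta
    by (intro continuous_on_Pair continuous_on_compose2[OF cp] continuous_on_compose2[OF cq] continuous_intros) auto
  show "(\<lambda>(x, y). (p x, q y)) ` (C \<times> D) = S \<times> T" using ip iq by force
  fix z assume "z \<in> S \<times> T"
  then obtain x y where z: "z = (x, y)" "x \<in> S" "y \<in> T" by auto
  obtain A V where A: "x \<in> A" "openin (top_of_set S) A" "\<Union>V = C \<inter> p -` A"
      "\<And>u. u \<in> V \<Longrightarrow> openin (top_of_set C) u" "pairwise disjnt V" "\<And>u. u \<in> V \<Longrightarrow> \<exists>q. homeomorphism u A p q"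
    using assms(1) z(2) unfolding covering_space_def by meson
  obtain B U where B: "y \<in> B" "openin (top_of_set T) B" "\<Union>U = D \<inter> q -` B"
      "\<And>u. u \<in> U \<Longrightarrow> openin (top_of_set D) u" "pairwise disjnt U" "\<And>u. u \<in> U \<Longrightarrow> \<exists>p. homeomorphism u B q p"
    using assms(2) z(3) unfolding covering_space_def by meson
  let ?W = "(\<lambda>(v, u). v \<times> u) ` (V \<times> U)"
  show "\<exists>A. z \<in> A \<and> openin (top_of_set (S \<times> T)) A \<and>
      (\<exists>v. \<Union>v = C \<times> D \<inter> (\<lambda>(x, y). (p x, q y)) -` A \<and> (\<forall>u\<in>v. openin (top_of_set (C \<times> D)) u) \<and>
        pairwise disjnt v \<and> (\<forall>u\<in>v. \<exists>q'. homeomorphism u A (\<lambda>(x, y). (p x, q y)) q'))"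
  proof (rule exI[of _ "A \<times> B"], intro conjI exI[of _ ?W] ballI)
    show "z \<in> A \<times> B" using z A B by simp
    show "openin (top_of_set (S \<times> T)) (A \<times> B)" by (rule openin_Times[OF A(2) B(2)])
    have "\<Union>?W = \<Union>V \<times> \<Union>U" by auto
    then show "\<Union>?W = C \<times> D \<inter> (\<lambda>(x, y). (p x, q y)) -` (A \<times> B)" unfolding A(3) B(3) by auto
    show "pairwise disjnt ?W"
    proof (rule pairwiseI)
      fix a b assume "a \<in> ?W" "b \<in> ?W" "a \<noteq> b"
      then obtain v u v' u' where *: "a = v \<times> u" "b = v' \<times> u'" "v \<in> V" "v' \<in> V" "u \<in> U" "u' \<in> U" by auto
      with \<open>a \<noteq> b\<close> have "v \<noteq> v' \<or> u \<noteq> u'" by auto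
      then have "disjnt v v' \<or> disjnt u u'"
        using pairwiseD[OF A(5) *(3,4)] pairwiseD[OF B(5) *(5,6)] by blast
      then show "disjnt a b" unfolding *(1,2) disjnt_def Times_Int_Times by auto
    qed
    fix w assume "w \<in> ?W"
    then obtain v u where w: "w = v \<times> u" "v \<in> V" "u \<in> U" by auto
    show "openin (top_of_set (C \<times> D)) w" unfolding w by (rule openin_Times[OF A(4)[OF w(2)] B(4)[OF w(3)]])
    obtain p' q' where h: "homeomorphism v A p p'" "homeomorphism u B q q'" using A(6) B(6) w by meson
    have "homeomorphism (v \<times> u) (A \<times> B) (\<lambda>(x, y). (p x, q y)) (\<lambda>(x, y). (p' x, q' y))"
    proof (rule homeomorphismI)
      show "continuous_on (v \<times> u) (\<lambda>(x, y). (p x, q y))" "continuous_on (A \<times> B) (\<lambda>(x, y). (p' x, q' y))"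
        unfolding case_prod_beta
        by (intro continuous_on_Pair continuous_on_compose2[OF homeomorphism_cont1[OF h(1)]]
          continuous_on_compose2[OF homeomorphism_cont1[OF h(2)]] continuous_on_compose2[OF homeomorphism_cont2[OF h(1)]]
          continuous_on_compose2[OF homeomorphism_cont2[OF h(2)]] continuous_intros; force)+
    qed (use h in \<open>auto simp: homeomorphism_def\<close>)
    then show "\<exists>q'. homeomorphism w (A \<times> B) (\<lambda>(x, y). (p x, q y)) q'" using w(1) by blast
  qed
qed

lemma covering_space_compose_homeomorphism:
  assumes "covering_space C p S" "homeomorphism S T f g"
  shows "covering_space C (\<lambda>x. f (p x)) T"
proof (rule covering_spaceI)
  have cp: "continuous_on C p" and ip: "p ` C = S" using assms by (auto simp: covering_space_def)
  have f: "continuous_on S f" "f ` S = T" "\<And>x. x \<in> S \<Longrightarrow> g (f x) = x" "\<And>y. y \<in> T \<Longrightarrow> f (g y) = y" "g ` T = S"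
    using assms(2) by (auto simp: homeomorphism_def)
  show "continuous_on C (\<lambda>x. f (p x))" using continuous_on_compose2[OF f(1) cp] ip by simp
  show "(\<lambda>x. f (p x)) ` C = T" using ip f(2) by (metis image_image)
  fix y assume y: "y \<in> T"
  then have "g y \<in> S" using f(5) by auto
  then obtain A V where A: "g y \<in> A" "openin (top_of_set S) A" "\<Union>V = C \<inter> p -` A"
      "\<And>u. u \<in> V \<Longrightarrow> openin (top_of_set C) u" "pairwise disjnt V" "\<And>u. u \<in> V \<Longrightarrow> \<exists>q. homeomorphism u A p q"
    using assms(1) unfolding covering_space_def by meson
  have AS: "A \<subseteq> S" using A(2) openin_imp_subset by blast
  show "\<exists>B. y \<in> B \<and> openin (top_of_set T) B \<and> (\<exists>v. \<Union>v = C \<inter> (\<lambda>x. f (p x)) -` B \<and>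
      (\<forall>u\<in>v. openin (top_of_set C) u) \<and> pairwise disjnt v \<and> (\<forall>u\<in>v. \<exists>q. homeomorphism u B (\<lambda>x. f (p x)) q))"
  proof (rule exI[of _ "f ` A"], intro conjI exI[of _ V] ballI A(5))
    show "y \<in> f ` A" using A(1) f(4)[OF y] by (metis image_eqI)
    show "openin (top_of_set T) (f ` A)" by (rule homeomorphism_imp_open_map[OF assms(2) A(2)])
    have "p x \<in> A" if "x \<in> C" "f (p x) \<in> f ` A" for x
    proof -
      from that(2) obtain s where "s \<in> A" "f (p x) = f s" by (rule imageE) blast
      then have "p x = s" using f(3) AS ip that(1) by (metis imageI subsetD)
      then show ?thesis using \<open>s \<in> A\<close> by simp
    qed
    then show "\<Union>V = C \<inter> (\<lambda>x. f (p x)) -` f ` A" unfolding A(3) by auto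
    fix u assume u: "u \<in> V"
    show "openin (top_of_set C) u" by (rule A(4)[OF u])
    obtain q where q: "homeomorphism u A p q" using A(6)[OF u] by blast
    have "homeomorphism A (f ` A) f g"
      by (rule homeomorphism_of_subsets[OF assms(2) AS]) (use AS f(2) in auto)
    from homeomorphism_compose[OF q this]
    show "\<exists>q. homeomorphism u (f ` A) (\<lambda>x. f (p x)) q" by (auto simp: o_def)
  qed
qed

text \<open>
  The nearest multiple of \<open>2 \<pi>\<close> is at distance at most \<open>\<pi>\<close>, and on \<open>[\<pi> / 2, \<pi>]\<close> the cosine is not positive.
\<close>

lemma cos_pos_near_period:
  assumes "cos x > 0"
  obtains n :: int where "\<bar>x - 2 * pi * of_int n\<bar> < pi / 2"
proof -
  let ?n = "round (x / (2 * pi))"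
  let ?y = "x - 2 * pi * of_int ?n"
  have "\<bar>of_int ?n - x / (2 * pi)\<bar> \<le> 1 / 2" by (rule of_int_round_abs_le)
  then have "2 * pi * \<bar>of_int ?n - x / (2 * pi)\<bar> \<le> pi" by simp
  moreover have "2 * pi * \<bar>of_int ?n - x / (2 * pi)\<bar> = \<bar>?y\<bar>"
    by (simp add: field_simps abs_if split: if_splits) 
  ultimately have y: "\<bar>?y\<bar> \<le> pi" by simp
  have "cos ?y = cos x" using sin_cos_eq_iff[of x ?y] by auto
  then have "cos \<bar>?y\<bar> > 0" using assms by simp
  have "\<bar>?y\<bar> < pi / 2"
  proof (rule ccontr)
    assume "\<not> \<bar>?y\<bar> < pi / 2"
    then have "cos \<bar>?y\<bar> \<le> cos (pi / 2)" using y by (intro cos_monotone_0_pi_le) auto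
    then show False using \<open>cos \<bar>?y\<bar> > 0\<close> by simp
  qed
  then show ?thesis by (rule that)
qed

lemma cos_pos_if_abs_less: "\<bar>x\<bar> < pi / 2 \<Longrightarrow> 0 < cos x"
  using cos_gt_zero_pi[of x] by (simp only: abs_less_iff minus_less_iff)

text \<open>
  Half circles are evenly covered: over the half circle centred at \<open>cis \<alpha>\<close> the sheets are the intervals of
  length \<open>\<pi>\<close> in \<open>k t\<close> around the points \<open>\<alpha> + 2 \<pi> n\<close>, and the arcsine inverts the covering on each of them.
\<close>

lemma covering_space_cis:
  assumes "k \<noteq> (0 :: real)"
  shows "covering_space UNIV (\<lambda>t. cis (k * t)) (sphere 0 1)"
proof (rule covering_spaceI)
  show "continuous_on UNIV (\<lambda>t. cis (k * t))" by (intro continuous_intros)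
  show "range (\<lambda>t. cis (k * t)) = sphere 0 1"
  proof
    show "sphere 0 1 \<subseteq> range (\<lambda>t. cis (k * t))"
    proof
      fix z :: complex assume "z \<in> sphere 0 1"
      then have "z = cis (k * (Arg z / k))" using rcis_cmod_Arg[of z] assms by (simp add: rcis_def)
      then show "z \<in> range (\<lambda>t. cis (k * t))" by blast
    qed
  qed auto
  fix z :: complex assume "z \<in> sphere 0 1"
  then obtain \<alpha> where z: "z = cis \<alpha>" using rcis_cmod_Arg[of z] by (metis mem_sphere_0 rcis_def mult_1 of_real_1)
  define A where "A = {w \<in> sphere 0 1. Re (w * cis (- \<alpha>)) > 0}"
  define U where "U n = {t. \<bar>k * t - \<alpha> - 2 * pi * of_int n\<bar> < pi / 2}" for n :: int
  have per: "cos (x - 2 * pi * of_int n) = cos x" "sin (x - 2 * pi * of_int n) = sin x" for x and n :: int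
    using sin_cos_eq_iff[of x "x - 2 * pi * of_int n"] by auto
  have Re: "cis (k * t) * cis (- \<alpha>) = cis (k * t - \<alpha>)" for t by (simp add: cis_mult)
  have memA: "cis (k * t) \<in> A \<longleftrightarrow> cos (k * t - \<alpha>) > 0" for t by (simp add: A_def cos_diff)
  show "\<exists>A. z \<in> A \<and> openin (top_of_set (sphere 0 1)) A \<and> (\<exists>v. \<Union>v = UNIV \<inter> (\<lambda>t. cis (k * t)) -` A \<and>
      (\<forall>u\<in>v. openin (top_of_set UNIV) u) \<and> pairwise disjnt v \<and> (\<forall>u\<in>v. \<exists>q. homeomorphism u A (\<lambda>t. cis (k * t)) q))"
  proof (rule exI[of _ A], intro conjI exI[of _ "range U"] ballI)
    show "z \<in> A" by (simp add: A_def z cis_mult)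
    have "open {w. Re (w * cis (- \<alpha>)) > 0}" by (intro open_Collect_less continuous_intros)
    moreover have "A = sphere 0 1 \<inter> {w. Re (w * cis (- \<alpha>)) > 0}" by (auto simp: A_def)
    ultimately show "openin (top_of_set (sphere 0 1)) A" by (simp add: openin_open_Int)
    show "\<Union>(range U) = UNIV \<inter> (\<lambda>t. cis (k * t)) -` A"
    proof (intro set_eqI iffI)
      fix t assume "t \<in> \<Union>(range U)"
      then obtain n :: int where "\<bar>k * t - \<alpha> - 2 * pi * of_int n\<bar> < pi / 2" by (auto simp: U_def)
      then have "cos (k * t - \<alpha> - 2 * pi * of_int n) > 0" by (rule cos_pos_if_abs_less)
      then show "t \<in> UNIV \<inter> (\<lambda>t. cis (k * t)) -` A" unfolding per(1) by (simp add: memA)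
    next
      fix t assume "t \<in> UNIV \<inter> (\<lambda>t. cis (k * t)) -` A"
      then have "cos (k * t - \<alpha>) > 0" by (simp add: memA)
      then obtain n :: int where "\<bar>k * t - \<alpha> - 2 * pi * of_int n\<bar> < pi / 2" by (rule cos_pos_near_period)
      then show "t \<in> \<Union>(range U)" by (auto simp: U_def)
    qed
    show "pairwise disjnt (range U)"
    proof (rule pairwiseI)
      fix x y assume "x \<in> range U" "y \<in> range U" "x \<noteq> y"
      then obtain n m where nm: "x = U n" "y = U m" "n \<noteq> m" by auto
      show "disjnt x y"
      proof (rule ccontr)
        assume "\<not> disjnt x y"
        then obtain t where "t \<in> U n" "t \<in> U m" using nm by (auto simp: disjnt_def)
        then have "\<bar>k * t - \<alpha> - 2 * pi * of_int n\<bar> < pi / 2" "\<bar>k * t - \<alpha> - 2 * pi * of_int m\<bar> < pi / 2"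
          by (simp_all only: U_def mem_Collect_eq)
        then have "\<bar>(k * t - \<alpha> - 2 * pi * of_int m) - (k * t - \<alpha> - 2 * pi * of_int n)\<bar> < pi"
          using abs_triangle_ineq4[of "k * t - \<alpha> - 2 * pi * of_int m" "k * t - \<alpha> - 2 * pi * of_int n"] by linarith
        then have "\<bar>2 * pi * of_int n - 2 * pi * of_int m\<bar> < pi" by simp
        also have "2 * pi * of_int n - 2 * pi * of_int m = 2 * pi * of_int (n - m)" by (simp add: algebra_simps)
        finally have "\<bar>real_of_int (n - m)\<bar> * (2 * pi) < 1 * pi" by (simp add: abs_mult)
        moreover have "1 \<le> \<bar>real_of_int (n - m)\<bar>" using nm(3) by linarith
        then have "1 * (2 * pi) \<le> \<bar>real_of_int (n - m)\<bar> * (2 * pi)" by (intro mult_right_mono) auto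
        ultimately show False using pi_gt_zero by linarith
      qed
    qed
    fix u assume "u \<in> range U"
    then obtain n where u: "u = U n" by auto
    show "openin (top_of_set UNIV) u" unfolding u U_def by (simp, intro open_Collect_less continuous_intros)
    let ?q = "\<lambda>w. (\<alpha> + 2 * pi * of_int n + arcsin (Im (w * cis (- \<alpha>)))) / k"
    have qA: "cos (k * ?q w - \<alpha> - 2 * pi * of_int n) = Re (w * cis (- \<alpha>))"
        "sin (k * ?q w - \<alpha> - 2 * pi * of_int n) = Im (w * cis (- \<alpha>))"
        "\<bar>k * ?q w - \<alpha> - 2 * pi * of_int n\<bar> < pi / 2" if "w \<in> A" for w
    proof -
      define v where "v = w * cis (- \<alpha>)"
      have "norm v = 1" "Re v > 0" using that by (auto simp: A_def v_def norm_mult)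
      then have v: "(Re v)\<^sup>2 + (Im v)\<^sup>2 = 1" using cmod_power2[of v] by simp
      have kq: "k * ?q w - \<alpha> - 2 * pi * of_int n = arcsin (Im v)" using assms by (simp add: v_def)
      have "(Im v)\<^sup>2 < 1" using v \<open>Re v > 0\<close> by (metis less_add_same_cancel2 zero_less_power)
      then have b: "- 1 < Im v" "Im v < 1" by (simp_all add: abs_square_less_1 abs_less_iff)
      have "sin (k * ?q w - \<alpha> - 2 * pi * of_int n) = sin (arcsin (Im v))" by (rule arg_cong[OF kq])
      also have "\<dots> = Im v" using b by simp
      finally show "sin (k * ?q w - \<alpha> - 2 * pi * of_int n) = Im (w * cis (- \<alpha>))"
        by (simp only: v_def)
      have "cos (k * ?q w - \<alpha> - 2 * pi * of_int n) = cos (arcsin (Im v))" by (rule arg_cong[OF kq])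
      also have "\<dots> = sqrt (1 - (Im v)\<^sup>2)" using b by (intro cos_arcsin) auto
      also have "1 - (Im v)\<^sup>2 = (Re v)\<^sup>2" using v by simp
      also have "sqrt ((Re v)\<^sup>2) = Re v" using \<open>Re v > 0\<close> by simp
      finally show "cos (k * ?q w - \<alpha> - 2 * pi * of_int n) = Re (w * cis (- \<alpha>))"
        by (simp only: v_def)
      have "\<bar>arcsin (Im v)\<bar> < pi / 2" using arcsin_lt_bounded[OF b] by linarith
      then show "\<bar>k * ?q w - \<alpha> - 2 * pi * of_int n\<bar> < pi / 2" by (simp only: kq)
    qed
    have "homeomorphism u A (\<lambda>t. cis (k * t)) ?q"
    proof (rule homeomorphismI)
      show "continuous_on u (\<lambda>t. cis (k * t))" by (intro continuous_intros)
      show "continuous_on A ?q"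
      proof (intro continuous_intros ballI)
        fix w assume w: "w \<in> A"
        then have "norm (w * cis (- \<alpha>)) = 1" by (auto simp: A_def norm_mult)
        then show "- 1 \<le> Im (w * cis (- \<alpha>)) \<and> Im (w * cis (- \<alpha>)) \<le> 1"
          using abs_Im_le_cmod[of "w * cis (- \<alpha>)"] by linarith
      qed (use assms in auto)
      show "(\<lambda>t. cis (k * t)) ` u \<subseteq> A"
      proof (rule image_subsetI)
        fix t assume "t \<in> u"
        then have "\<bar>k * t - \<alpha> - 2 * pi * of_int n\<bar> < pi / 2" by (simp add: u U_def)
        then have "cos (k * t - \<alpha> - 2 * pi * of_int n) > 0" by (rule cos_pos_if_abs_less)
        then show "cis (k * t) \<in> A" unfolding per(1) memA .
      qed
      show "?q ` A \<subseteq> u" unfolding u U_def using qA(3) by (intro image_subsetI CollectI)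
      show "?q (cis (k * t)) = t" if "t \<in> u" for t
      proof -
        have b: "\<bar>k * t - \<alpha> - 2 * pi * of_int n\<bar> < pi / 2" using that by (simp only: u U_def mem_Collect_eq)
        have "Im (cis (k * t) * cis (- \<alpha>)) = sin (k * t - \<alpha> - 2 * pi * of_int n)" unfolding Re per by simp
        then have "arcsin (Im (cis (k * t) * cis (- \<alpha>))) = k * t - \<alpha> - 2 * pi * of_int n"
          using b by (simp only:) (intro arcsin_sin; linarith)
        then show ?thesis using assms by (simp only:) simp
      qed
      show "cis (k * ?q w) = w" if w: "w \<in> A" for w
      proof -
        have "cis (k * ?q w - \<alpha>) = w * cis (- \<alpha>)"
          using qA(1,2)[OF w] unfolding per by (simp add: complex_eq_iff)
        then have "cis (k * ?q w - \<alpha>) * cis \<alpha> = w * (cis (- \<alpha>) * cis \<alpha>)" by simp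
        then show ?thesis by (simp add: cis_mult)
      qed
    qed
    then show "\<exists>q. homeomorphism u A (\<lambda>t. cis (k * t)) q" by blast
  qed
qed

text \<open>
  The partial derivatives are \<open>(r', 0, h')\<close> and \<open>(0, 1, a)\<close>, which are independent unless \<open>r'\<close> and \<open>h'\<close>
  both vanish.
\<close>

lemma C1_immersion_gen_coord:
  assumes g: "\<And>t. t \<in> D \<Longrightarrow> (\<gamma> has_vector_derivative g t) (at t)" and "continuous_on D g"
    and nz: "\<And>t. t \<in> D \<Longrightarrow> g t \<noteq> 0"
  shows "C1_immersion (D \<times> UNIV) (gen_coord a \<gamma>)"
proof -
  define B1 :: "(real \<times> real) \<Rightarrow>\<^sub>L (real^3)" where "B1 = Blinfun (\<lambda>x. fst x *\<^sub>R axis 1 1)"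
  define B2 :: "(real \<times> real) \<Rightarrow>\<^sub>L (real^3)" where "B2 = Blinfun (\<lambda>x. fst x *\<^sub>R axis 3 1)"
  define B3 :: "(real \<times> real) \<Rightarrow>\<^sub>L (real^3)" where "B3 = Blinfun (\<lambda>x. snd x *\<^sub>R axis 2 1 + (a * snd x) *\<^sub>R axis 3 1)"
  have B1: "blinfun_apply B1 x = fst x *\<^sub>R axis 1 1" for x
    unfolding B1_def by (subst bounded_linear_Blinfun_apply) (auto intro!: bounded_linear_intros)
  have B2: "blinfun_apply B2 x = fst x *\<^sub>R axis 3 1" for x
    unfolding B2_def by (subst bounded_linear_Blinfun_apply) (auto intro!: bounded_linear_intros)
  have B3: "blinfun_apply B3 x = snd x *\<^sub>R axis 2 1 + (a * snd x) *\<^sub>R axis 3 1" for x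
    unfolding B3_def by (subst bounded_linear_Blinfun_apply) (auto intro!: bounded_linear_intros)
  define Y' where "Y' p = fst (g (fst p)) *\<^sub>R B1 + snd (g (fst p)) *\<^sub>R B2 + B3" for p :: "real \<times> real"
  have Y': "blinfun_apply (Y' p) x = vector [fst (g (fst p)) * fst x, snd x, snd (g (fst p)) * fst x + a * snd x]" for p x
    unfolding vector_3_axis
    by (simp add: Y'_def B1 B2 B3 blinfun.add_left blinfun.scaleR_left scaleR_left_distrib)
  show ?thesis unfolding C1_immersion_def
  proof (intro exI[of _ Y'] conjI ballI)
    show "continuous_on (D \<times> UNIV) Y'"
      unfolding Y'_def by (intro continuous_intros continuous_on_compose2[OF assms(2)]) auto
    fix p :: "real \<times> real" assume "p \<in> D \<times> UNIV"
    then obtain t \<phi> where p: "p = (t, \<phi>)" and t: "t \<in> D" by auto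
    have d: "((\<lambda>p. \<gamma> (fst p)) has_derivative (\<lambda>x. fst x *\<^sub>R g t)) (at p)"
    proof -
      have "(\<gamma> has_derivative (\<lambda>h. h *\<^sub>R g t)) (at (fst p))" using g[OF t] p by (simp add: has_vector_derivative_def)
      from has_derivative_compose[OF has_derivative_fst[OF has_derivative_ident] this]
      show ?thesis by simp
    qed
    have "(gen_coord a \<gamma> has_derivative (\<lambda>x. vector [fst (g t) * fst x, snd x, snd (g t) * fst x + a * snd x])) (at p)"
      unfolding gen_coord_eq[abs_def] vector_3_axis
      by (auto intro!: derivative_eq_intros d simp: fun_eq_iff mult.commute)
    then show "(gen_coord a \<gamma> has_derivative blinfun_apply (Y' p)) (at p)"
      by (simp add: Y'[abs_def] p)
    show "inj (blinfun_apply (Y' p))"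
    proof (rule injI)
      fix x y assume "blinfun_apply (Y' p) x = blinfun_apply (Y' p) y"
      then have "fst (g t) * fst x = fst (g t) * fst y" "snd x = snd y" "snd (g t) * fst x = snd (g t) * fst y"
        by (auto simp: Y' vec_eq_iff forall_3 p)
      moreover have "fst (g t) \<noteq> 0 \<or> snd (g t) \<noteq> 0" using nz[OF t] by (auto simp: prod_eq_iff)
      ultimately show "x = y" by (auto simp: prod_eq_iff)
    qed
  qed
qed

definition period :: "real set \<Rightarrow> (real \<Rightarrow> 'a) \<Rightarrow> real \<Rightarrow> bool" where
  "period D \<gamma> T \<longleftrightarrow> (\<forall>s. s + T \<in> D \<longleftrightarrow> s \<in> D) \<and> (\<forall>s\<in>D. \<gamma> (s + T) = \<gamma> s)"

lemma same_parameter_iff: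
  "same_parameter a D \<gamma> (t, \<phi>) (t', \<phi>') \<longleftrightarrow> period D \<gamma> (t' - t) \<and> cis \<phi> = cis \<phi>' \<and> a * \<phi> = a * \<phi>'"
proof -
  have "(\<forall>x. pt (screw a \<phi> x) = pt (screw a \<phi>' x)) \<longleftrightarrow> cis \<phi> = cis \<phi>' \<and> a * \<phi> = a * \<phi>'"
  proof
    assume "\<forall>x. pt (screw a \<phi> x) = pt (screw a \<phi>' x)"
    then have "pt (screw a \<phi> 0) = pt (screw a \<phi>' 0)" by blast
    then show "cis \<phi> = cis \<phi>' \<and> a * \<phi> = a * \<phi>'" by (simp add: pt_def screw_def)
  next
    assume "cis \<phi> = cis \<phi>' \<and> a * \<phi> = a * \<phi>'"
    then show "\<forall>x. pt (screw a \<phi> x) = pt (screw a \<phi>' x)"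
      by (simp add: pt_def screw_def flip: cis_mult)
  qed
  moreover have "(\<exists>T. t' = t + T \<and> P T) \<longleftrightarrow> P (t' - t)" for P
    by (metis add_diff_cancel_left' add.commute diff_add_cancel)
  ultimately show ?thesis by (simp add: same_parameter_def period_def)
qed

lemma gen_point_eq: "gen_point a \<gamma> (t, \<phi>) = (fst (\<gamma> t), cis \<phi>, snd (\<gamma> t) + a * \<phi>)"
  by (simp add: gen_point_def gen_coord_eq pt_def)

text \<open>
  A covering that identifies exactly the equal parameters carries the parametrisation to the quotient.
\<close>

lemma is_immersedI:
  assumes "C1_immersion (D \<times> UNIV) (gen_coord a \<gamma>)" "covering_space (D \<times> UNIV) q S"
    and sp: "\<And>t \<phi> t' \<phi>'. t \<in> D \<Longrightarrow> t' \<in> D \<Longrightarrow> q (t, \<phi>) = q (t', \<phi>') \<longleftrightarrow>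
      period D \<gamma> (t' - t) \<and> cis \<phi> = cis \<phi>' \<and> a * \<phi> = a * \<phi>'"
  shows "is_immersed a D \<gamma> S"
proof -
  define F where "F s = gen_point a \<gamma> (SOME p. p \<in> D \<times> UNIV \<and> q p = s)" for s
  have "F (q p) = gen_point a \<gamma> p" if p: "p \<in> D \<times> UNIV" for p
  proof -
    define p' where "p' = (SOME p'. p' \<in> D \<times> UNIV \<and> q p' = q p)"
    have "p' \<in> D \<times> UNIV \<and> q p' = q p" unfolding p'_def by (rule someI[of _ p]) (use p in simp)
    moreover obtain t \<phi> t' \<phi>' where e: "p = (t, \<phi>)" "p' = (t', \<phi>')" by (metis surj_pair)
    ultimately have *: "period D \<gamma> (t - t')" "cis \<phi> = cis \<phi>'" "a * \<phi> = a * \<phi>'" "t' \<in> D"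
      using sp[of t' t \<phi>' \<phi>] p by auto
    then have "\<gamma> (t' + (t - t')) = \<gamma> t'" unfolding period_def by blast
    moreover have "F (q p) = gen_point a \<gamma> p'" by (simp only: F_def p'_def)
    ultimately show ?thesis using * by (auto simp: e gen_point_eq)
  qed
  then show ?thesis unfolding is_immersed_def generating_immersion_def
    using assms same_parameter_iff by (intro exI[of _ F] conjI exI[of _ q]) auto
qed

lemma is_embeddedI:
  assumes "C1_immersion (D \<times> UNIV) (gen_coord a \<gamma>)" "covering_space (D \<times> UNIV) q S"
    and sp: "\<And>t \<phi> t' \<phi>'. t \<in> D \<Longrightarrow> t' \<in> D \<Longrightarrow> q (t, \<phi>) = q (t', \<phi>') \<longleftrightarrow>
      period D \<gamma> (t' - t) \<and> cis \<phi> = cis \<phi>' \<and> a * \<phi> = a * \<phi>'"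
    and F: "\<And>t \<phi>. t \<in> D \<Longrightarrow> F (q (t, \<phi>)) = gen_point a \<gamma> (t, \<phi>)"
    and h: "homeomorphism S (gen_surface a D \<gamma>) F G"
  shows "is_embedded a D \<gamma> S"
  unfolding is_embedded_def generating_immersion_def
  using assms same_parameter_iff
  by (intro exI[of _ F] exI[of _ G] conjI exI[of _ q]) auto

text \<open>
  The parameter domain of a surface of revolution whose profile is an interval \<open>D\<close>.
\<close>

lemma annulus_covering: "covering_space (D \<times> UNIV) (\<lambda>(t, \<phi>). (cis \<phi>, t)) (sphere 0 1 \<times> (D :: real set))"
proof -
  have "covering_space (D \<times> UNIV) (\<lambda>(x, y). (x, cis (1 * y))) (D \<times> sphere 0 1)"
    by (rule covering_space_Times[OF homeomorphism_imp_covering_space[OF homeomorphism_ident] covering_space_cis]) simp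
  moreover have "homeomorphism (D \<times> sphere 0 1) (sphere 0 1 \<times> D) prod.swap prod.swap"
    by (rule homeomorphismI) (auto intro!: continuous_intros simp: prod.swap_def)
  ultimately have "covering_space (D \<times> UNIV) (\<lambda>p. prod.swap ((\<lambda>(x, y). (x, cis (1 * y))) p)) (sphere 0 1 \<times> D)"
    by (rule covering_space_compose_homeomorphism)
  then show ?thesis by (simp add: case_prod_unfold prod.swap_def)
qed

lemma immersed_without_periods:
  assumes im: "C1_immersion (D \<times> UNIV) (gen_coord a \<gamma>)" and np: "\<And>T. period D \<gamma> T \<Longrightarrow> T = 0"
  shows "a \<noteq> 0 \<Longrightarrow> homeomorphism (D \<times> (UNIV :: real set)) S \<Phi> \<Psi> \<Longrightarrow> is_immersed a D \<gamma> S"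
    and "a = 0 \<Longrightarrow> homeomorphism (sphere (0::complex) 1 \<times> D) S' \<Phi>' \<Psi>' \<Longrightarrow> is_immersed a D \<gamma> S'"
proof -
  have np': "period D \<gamma> (t' - t) \<longleftrightarrow> t = t'" for t t' using np[of "t' - t"] by (auto simp: period_def)
  show "is_immersed a D \<gamma> S" if "a \<noteq> 0" and h: "homeomorphism (D \<times> (UNIV :: real set)) S \<Phi> \<Psi>"
  proof (rule is_immersedI[OF im homeomorphism_imp_covering_space[OF h]])
    fix t \<phi> t' \<phi>' assume "t \<in> D" "t' \<in> D"
    then have "\<Phi> (t, \<phi>) = \<Phi> (t', \<phi>') \<longleftrightarrow> (t, \<phi>) = (t', \<phi>')"
      using homeomorphism_apply1[OF h] by (metis SigmaI UNIV_I)
    then show "\<Phi> (t, \<phi>) = \<Phi> (t', \<phi>') \<longleftrightarrow> period D \<gamma> (t' - t) \<and> cis \<phi> = cis \<phi>' \<and> a * \<phi> = a * \<phi>'"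
      using \<open>a \<noteq> 0\<close> by (auto simp: np')
  qed
  show "is_immersed a D \<gamma> S'" if "a = 0" and h: "homeomorphism (sphere (0::complex) 1 \<times> D) S' \<Phi>' \<Psi>'"
  proof (rule is_immersedI[OF im covering_space_compose_homeomorphism[OF annulus_covering h]])
    fix t \<phi> t' \<phi>' assume "t \<in> D" "t' \<in> D"
    then have "\<Phi>' (cis \<phi>, t) = \<Phi>' (cis \<phi>', t') \<longleftrightarrow> (cis \<phi>, t) = (cis \<phi>', t')"
      using homeomorphism_apply1[OF h] by (metis SigmaI mem_sphere_0 norm_cis)
    then show "\<Phi>' (case (t, \<phi>) of (t, \<phi>) \<Rightarrow> (cis \<phi>, t)) = \<Phi>' (case (t', \<phi>') of (t, \<phi>) \<Rightarrow> (cis \<phi>, t)) \<longleftrightarrow>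
        period D \<gamma> (t' - t) \<and> cis \<phi> = cis \<phi>' \<and> a * \<phi> = a * \<phi>'"
      using \<open>a = 0\<close> by (auto simp: np')
  qed
qed

text \<open>
  A point of a surface of revolution determines its rotation angle, its height determines the parameter,
  and the inverse of the height is continuous by invariance of domain.
\<close>

lemma embedded_if_height_monotone:
  assumes im: "C1_immersion (D \<times> UNIV) (gen_coord 0 \<gamma>)" and D: "open D" "is_interval D"
    and \<gamma>: "continuous_on D \<gamma>" and mono: "strict_mono_on D (\<lambda>t. snd (\<gamma> t))"
    and h: "homeomorphism (sphere (0::complex) 1 \<times> D) S \<Phi> \<Psi>"
  shows "is_embedded 0 D \<gamma> S"
proof -
  let ?h = "\<lambda>t. snd (\<gamma> t)"
  have inj: "inj_on ?h D" using mono by (rule strict_mono_on_imp_inj_on)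
  have ch: "continuous_on D ?h" by (intro continuous_intros \<gamma>)
  obtain k where k: "homeomorphism D (?h ` D) ?h k"
    using invariance_of_domain_homeomorphism[OF D(1) ch _ inj] by auto
  have np: "period D \<gamma> (t' - t) \<longleftrightarrow> t = t'" if "t \<in> D" "t' \<in> D" for t t'
  proof
    assume "period D \<gamma> (t' - t)"
    then have "\<gamma> (t + (t' - t)) = \<gamma> t" using that unfolding period_def by blast
    then show "t = t'" using inj that by (auto simp: inj_on_def)
  qed (simp add: period_def)
  define F where "F s = (fst (\<gamma> (snd (\<Psi> s))), fst (\<Psi> s), ?h (snd (\<Psi> s)))" for s
  define G where "G x = \<Phi> (fst (snd x), k (snd (snd x)))" for x :: "real \<times> complex \<times> real"
  note c = homeomorphism_cont1[OF h] homeomorphism_cont2[OF h]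
  have \<Psi>S: "\<Psi> s \<in> sphere 0 1 \<times> D" if "s \<in> S" for s using h that by (auto simp: homeomorphism_def)
  have \<Psi>: "\<Psi> (\<Phi> (w, t)) = (w, t)" "\<Phi> (w, t) \<in> S" if "w \<in> sphere 0 1" "t \<in> D" for w t
    using h that by (auto simp: homeomorphism_def)
  have \<Phi>: "\<Phi> (\<Psi> s) = s" if "s \<in> S" for s using h that by (auto simp: homeomorphism_def)
  have kh: "k (?h t) = t" if "t \<in> D" for t using k that by (auto simp: homeomorphism_def)
  have surf: "gen_surface 0 D \<gamma> = {(fst (\<gamma> t), w, ?h t) |t w. t \<in> D \<and> w \<in> sphere 0 1}" (is "_ = ?R")
  proof (intro set_eqI iffI)
    fix x assume "x \<in> gen_surface 0 D \<gamma>"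
    then obtain t \<phi> where "t \<in> D" "x = (fst (\<gamma> t), cis \<phi>, ?h t)" by (auto simp: gen_surface_def gen_point_eq)
    then show "x \<in> ?R" by force
  next
    fix x assume "x \<in> ?R"
    then obtain t w where x: "t \<in> D" "w \<in> sphere 0 1" "x = (fst (\<gamma> t), w, ?h t)" by blast
    then have "w = cis (Arg w)" using rcis_cmod_Arg[of w] by (simp add: rcis_def)
    then have "x = gen_point 0 \<gamma> (t, Arg w)" using x by (simp add: gen_point_eq)
    then show "x \<in> gen_surface 0 D \<gamma>" using x(1) unfolding gen_surface_def by blast
  qed
  have hom: "homeomorphism S (gen_surface 0 D \<gamma>) F G"
  proof (rule homeomorphismI)
    have "continuous_on S (\<lambda>s. \<gamma> (snd (\<Psi> s)))"
      by (rule continuous_on_compose2[OF \<gamma>]) (use \<Psi>S in \<open>force intro!: continuous_intros c(2)\<close>)+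
    then show "continuous_on S F" unfolding F_def by (intro continuous_intros c(2))
    have "continuous_on (gen_surface 0 D \<gamma>) (\<lambda>x. k (snd (snd x)))"
      by (rule continuous_on_compose2[OF homeomorphism_cont2[OF k]]) (auto simp: surf intro!: continuous_intros)
    then show "continuous_on (gen_surface 0 D \<gamma>) G"
      unfolding G_def by (intro continuous_on_compose2[OF c(1)] continuous_intros) (auto simp: surf kh)
    show "F ` S \<subseteq> gen_surface 0 D \<gamma>"
    proof (rule image_subsetI)
      fix s assume "s \<in> S"
      then show "F s \<in> gen_surface 0 D \<gamma>" using \<Psi>S[of s] unfolding surf F_def by (auto simp: mem_Times_iff)
    qed
    show "G ` gen_surface 0 D \<gamma> \<subseteq> S" using \<Psi>(2) by (auto simp: surf G_def kh)
    show "G (F s) = s" if "s \<in> S" for s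
    proof -
      have "snd (\<Psi> s) \<in> D" using \<Psi>S[OF that] by auto
      then show ?thesis using \<Phi>[OF that] by (simp add: G_def F_def kh)
    qed
    show "F (G x) = x" if "x \<in> gen_surface 0 D \<gamma>" for x
      using that \<Psi>(1) by (auto simp: surf F_def G_def kh)
  qed
  show ?thesis
  proof (rule is_embeddedI[OF im covering_space_compose_homeomorphism[OF annulus_covering h] _ _ hom])
    fix t \<phi> assume t: "t \<in> D"
    then show "F (\<Phi> (case (t, \<phi>) of (t, \<phi>) \<Rightarrow> (cis \<phi>, t))) = gen_point 0 \<gamma> (t, \<phi>)"
      by (simp add: F_def \<Psi> gen_point_eq)
    fix t' \<phi>' assume t': "t' \<in> D"
    have "\<Phi> (cis \<phi>, t) = \<Phi> (cis \<phi>', t') \<longleftrightarrow> (cis \<phi>, t) = (cis \<phi>', t')"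
      using \<Psi>(1)[OF _ t, of "cis \<phi>"] \<Psi>(1)[OF _ t', of "cis \<phi>'"] by (metis mem_sphere_0 norm_cis)
    then show "\<Phi> (case (t, \<phi>) of (t, \<phi>) \<Rightarrow> (cis \<phi>, t)) = \<Phi> (case (t', \<phi>') of (t, \<phi>) \<Rightarrow> (cis \<phi>, t)) \<longleftrightarrow>
        period D \<gamma> (t' - t) \<and> cis \<phi> = cis \<phi>' \<and> 0 * \<phi> = 0 * \<phi>'"
      by (auto simp: np[OF t t'])
  qed
qed

lemma cis_freq_eq_iff:
  assumes "w \<noteq> 0"
  shows "cis (w * t) = cis (w * t') \<longleftrightarrow> (\<exists>n :: int. t' - t = of_int n * (2 * pi / w))"
proof -
  have "cis (w * t') = cis (w * t) \<longleftrightarrow> (\<exists>n :: int. w * t' = w * t + 2 * pi * of_int n)"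
    using sin_cos_eq_iff[of "w * t'" "w * t"] by (auto simp: complex_eq_iff)
  also have "\<dots> \<longleftrightarrow> (\<exists>n :: int. t' - t = of_int n * (2 * pi / w))"
    using assms by (simp add: field_simps)
  finally show ?thesis by metis
qed

lemma immersed_cylinder_if_periodic:
  assumes im: "C1_immersion (UNIV \<times> UNIV) (gen_coord a \<gamma>)" and "a \<noteq> 0" "w \<noteq> 0"
    and per: "\<And>T. period UNIV \<gamma> T \<longleftrightarrow> (\<exists>n :: int. T = of_int n * (2 * pi / w))"
  shows "is_immersed a UNIV \<gamma> cylinder"
proof -
  have "covering_space (UNIV \<times> UNIV) (\<lambda>(t, \<phi>). (cis (w * t), \<phi>)) (sphere 0 1 \<times> (UNIV :: real set))"
    by (rule covering_space_Times[OF covering_space_cis[OF assms(3)] homeomorphism_imp_covering_space[OF homeomorphism_ident]])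
  then show ?thesis unfolding cylinder_def
    by (rule is_immersedI[OF im]) (use assms(2) in \<open>auto simp: per cis_freq_eq_iff[OF assms(3)]\<close>)
qed

lemma image_vimage_factor: "(\<And>p. F (q p) = f p) \<Longrightarrow> q ` (f -` U) = range q \<inter> F -` U"
  by auto

text \<open>
  The induced map on the torus is continuous because coverings are open, and injective because the loop is
  simple; compactness makes it a homeomorphism onto the surface.
\<close>

lemma embedded_torus_if_simple_loop:
  assumes im: "C1_immersion (UNIV \<times> UNIV) (gen_coord 0 \<gamma>)" and "w \<noteq> 0"
    and per: "\<And>T. period UNIV \<gamma> T \<longleftrightarrow> (\<exists>n :: int. T = of_int n * (2 * pi / w))"
    and inj: "\<And>t t'. \<gamma> t = \<gamma> t' \<Longrightarrow> period UNIV \<gamma> (t' - t)" and cont: "continuous_on UNIV \<gamma>"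
  shows "is_embedded 0 UNIV \<gamma> torus"
proof -
  let ?q = "\<lambda>(t, \<phi>). (cis (w * t), cis (1 * \<phi>))"
  have cov: "covering_space (UNIV \<times> UNIV) ?q torus"
    unfolding torus_def
    by (rule covering_space_Times[OF covering_space_cis[OF assms(2)] covering_space_cis]) simp
  have sp: "?q (t, \<phi>) = ?q (t', \<phi>') \<longleftrightarrow> period UNIV \<gamma> (t' - t) \<and> cis \<phi> = cis \<phi>' \<and> 0 * \<phi> = 0 * \<phi>'" for t \<phi> t' \<phi>'
    by (auto simp: per cis_freq_eq_iff[OF assms(2)])
  obtain F where F: "\<And>p. p \<in> UNIV \<times> UNIV \<Longrightarrow> F (?q p) = gen_point 0 \<gamma> p"
  proof -
    define F where "F s = gen_point 0 \<gamma> (SOME p. ?q p = s)" for s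
    have "F (?q (t, \<phi>)) = gen_point 0 \<gamma> (t, \<phi>)" for t \<phi>
    proof -
      define p' where "p' = (SOME p'. ?q p' = ?q (t, \<phi>))"
      obtain t' \<phi>' where e: "p' = (t', \<phi>')" by (metis surj_pair)
      have "?q p' = ?q (t, \<phi>)" unfolding p'_def by (rule someI[of _ "(t, \<phi>)"]) simp
      then have "period UNIV \<gamma> (t - t')" "cis \<phi>' = cis \<phi>" unfolding e sp by auto
      then have "\<gamma> (t' + (t - t')) = \<gamma> t'" unfolding period_def by blast
      then show ?thesis using \<open>cis \<phi>' = cis \<phi>\<close> unfolding F_def p'_def[symmetric] e by (simp add: gen_point_eq)
    qed
    then show ?thesis by (intro that[of F]) (auto simp del: cis_conv_exp)
  qed
  have FT: "F (?q (t, \<phi>)) = (fst (\<gamma> t), cis \<phi>, snd (\<gamma> t))" for t \<phi> using F[of "(t, \<phi>)"] by (simp add: gen_point_eq)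
  have q: "?q ` UNIV = torus" using cov by (simp add: covering_space_def)
  have "continuous_on torus F"
  proof (subst continuous_on_open_gen[where T = UNIV])
    show "F \<in> torus \<rightarrow> UNIV" by simp
    show "\<forall>U. openin (top_of_set UNIV) U \<longrightarrow> openin (top_of_set torus) (torus \<inter> F -` U)"
    proof (intro allI impI)
      fix U :: "(real \<times> complex \<times> real) set" assume "openin (top_of_set UNIV) U"
      then have "open U" by simp
      have c: "continuous_on UNIV (\<lambda>(t, \<phi>). (fst (\<gamma> t), cis \<phi>, snd (\<gamma> t)))"
        unfolding case_prod_beta by (intro continuous_intros continuous_on_compose2[OF cont]) auto
      have "open ((\<lambda>(t, \<phi>). (fst (\<gamma> t), cis \<phi>, snd (\<gamma> t))) -` U)"
        using open_vimage[OF \<open>open U\<close> c] .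
      then have "openin (top_of_set torus) (?q ` ((\<lambda>(t, \<phi>). (fst (\<gamma> t), cis \<phi>, snd (\<gamma> t))) -` U))"
        by (intro covering_space_open_map[OF cov]) simp
      moreover have "?q ` ((\<lambda>(t, \<phi>). (fst (\<gamma> t), cis \<phi>, snd (\<gamma> t))) -` U) = torus \<inter> F -` U"
        unfolding q[symmetric] by (rule image_vimage_factor) (use FT in \<open>simp add: case_prod_beta\<close>)
      ultimately show "openin (top_of_set torus) (torus \<inter> F -` U)" by simp
    qed
  qed
  moreover have "compact torus" unfolding torus_def by (intro compact_Times compact_sphere)
  moreover have "F ` torus = gen_surface 0 UNIV \<gamma>"
    unfolding q[symmetric] image_image gen_surface_def using F by (intro image_cong) auto
  moreover have "inj_on F torus"
  proof (rule inj_onI)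
    fix x y assume "x \<in> torus" "y \<in> torus" and e: "F x = F y"
    then obtain t \<phi> t' \<phi>' where xy: "x = ?q (t, \<phi>)" "y = ?q (t', \<phi>')" using q by (metis (no_types, lifting) imageE surj_pair)
    then have "\<gamma> t = \<gamma> t'" "cis \<phi> = cis \<phi>'" using e unfolding xy FT by (auto simp: prod_eq_iff)
    then show "x = y" unfolding xy sp using inj by simp
  qed
  ultimately obtain G where "homeomorphism torus (gen_surface 0 UNIV \<gamma>) F G"
    using homeomorphism_compact by blast
  then show ?thesis by (intro is_embeddedI[OF im cov sp F]) auto
qed

text \<open>
  Archimedes' projection: a circle of the cylinder is shrunk to the parallel of the sphere at the same
  height.
\<close>

lemma doubly_punctured_sphere_homeomorphism:
  fixes A c :: real
  assumes "0 < A"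
  obtains \<Phi> \<Psi> where "homeomorphism (sphere (0::complex) 1 \<times> {t. \<bar>t + c\<bar> < A}) doubly_punctured_sphere \<Phi> \<Psi>"
proof -
  let ?s = "\<lambda>t. (t + c) / A"
  let ?\<Phi> = "\<lambda>(w, t). vector [sqrt (1 - (?s t)\<^sup>2) * Re w, sqrt (1 - (?s t)\<^sup>2) * Im w, ?s t] :: real^3"
  let ?\<Psi> = "\<lambda>x :: real^3. (Complex (x$1) (x$2) / of_real (sqrt (1 - (x$3)\<^sup>2)), A * x$3 - c)"
  have norm3: "norm x = 1 \<longleftrightarrow> (x$1)\<^sup>2 + (x$2)\<^sup>2 + (x$3)\<^sup>2 = 1" for x :: "real^3"
    by (simp add: norm_eq_1 inner_vec_def sum_3 power2_eq_square)
  have dps: "x \<in> doubly_punctured_sphere \<longleftrightarrow> (x$1)\<^sup>2 + (x$2)\<^sup>2 + (x$3)\<^sup>2 = 1 \<and> \<bar>x$3\<bar> < 1" for x :: "real^3"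
  proof -
    have "x = axis 3 1 \<or> x = - axis 3 1 \<longleftrightarrow> \<bar>x$3\<bar> = 1" if n: "(x$1)\<^sup>2 + (x$2)\<^sup>2 + (x$3)\<^sup>2 = 1"
    proof
      assume "\<bar>x$3\<bar> = 1"
      then have "(x$3)\<^sup>2 = 1" by (simp add: abs_square_eq_1)
      then have "(x$1)\<^sup>2 + (x$2)\<^sup>2 = 0" using n by simp
      then have "x$1 = 0" "x$2 = 0" by (auto simp: sum_power2_eq_zero_iff)
      then show "x = axis 3 1 \<or> x = - axis 3 1" using \<open>\<bar>x$3\<bar> = 1\<close>
        by (auto simp: vec_eq_iff forall_3 axis_def abs_if split: if_splits)
    qed (auto simp: axis_def)
    moreover have "\<bar>x$3\<bar> \<le> 1" if "(x$1)\<^sup>2 + (x$2)\<^sup>2 + (x$3)\<^sup>2 = 1"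
    proof -
      have "(x$3)\<^sup>2 \<le> 1" using that zero_le_power2[of "x$1"] zero_le_power2[of "x$2"] by linarith
      then show ?thesis by (simp add: abs_square_le_1)
    qed
    ultimately show ?thesis unfolding doubly_punctured_sphere_def by (auto simp: norm3)
  qed
  have s: "(?s t)\<^sup>2 < 1" if "\<bar>t + c\<bar> < A" for t
    using that assms by (simp add: abs_square_less_1)
  have "homeomorphism (sphere 0 1 \<times> {t. \<bar>t + c\<bar> < A}) doubly_punctured_sphere ?\<Phi> ?\<Psi>"
  proof (rule homeomorphismI)
    show "continuous_on (sphere 0 1 \<times> {t. \<bar>t + c\<bar> < A}) ?\<Phi>"
      unfolding vector_3_axis case_prod_beta using assms by (intro continuous_intros) auto
    show "continuous_on doubly_punctured_sphere ?\<Psi>"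
      unfolding complex_eq complex.sel
      by (intro continuous_intros) (auto simp: dps abs_square_eq_1)
    show "?\<Phi> ` (sphere 0 1 \<times> {t. \<bar>t + c\<bar> < A}) \<subseteq> doubly_punctured_sphere"
    proof (rule image_subsetI)
      fix p :: "complex \<times> real" assume "p \<in> sphere 0 1 \<times> {t. \<bar>t + c\<bar> < A}"
      then obtain w t where p: "p = (w, t)" "norm w = 1" "\<bar>t + c\<bar> < A" by auto
      have "(Re w)\<^sup>2 + (Im w)\<^sup>2 = 1" using p(2) cmod_power2[of w] by simp
      then have "(1 - (?s t)\<^sup>2) * (Re w)\<^sup>2 + (1 - (?s t)\<^sup>2) * (Im w)\<^sup>2 = 1 - (?s t)\<^sup>2"
        by (metis distrib_left mult_1_right)
      then show "?\<Phi> p \<in> doubly_punctured_sphere"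
        using s[OF p(3)] assms p(3) by (simp add: p(1) dps power_mult_distrib)
    qed
    show "?\<Psi> ` doubly_punctured_sphere \<subseteq> sphere 0 1 \<times> {t. \<bar>t + c\<bar> < A}"
    proof (rule image_subsetI)
      fix x :: "real^3" assume "x \<in> doubly_punctured_sphere"
      then have x: "(x$1)\<^sup>2 + (x$2)\<^sup>2 + (x$3)\<^sup>2 = 1" "\<bar>x$3\<bar> < 1" by (auto simp: dps)
      have "cmod (Complex (x$1) (x$2)) = sqrt (1 - (x$3)\<^sup>2)"
        using x(1) by (simp add: cmod_def)
      moreover have "(x$3)\<^sup>2 < 1" using x(2) by (simp add: abs_square_less_1)
      ultimately show "?\<Psi> x \<in> sphere 0 1 \<times> {t. \<bar>t + c\<bar> < A}"
        using x(2) assms by (simp add: norm_divide abs_mult)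
    qed
    show "?\<Psi> (?\<Phi> p) = p" if "p \<in> sphere 0 1 \<times> {t. \<bar>t + c\<bar> < A}" for p
    proof -
      obtain w t where p0: "p = (w, t)" by (cases p)
      then have p: "p = (w, t)" "\<bar>t + c\<bar> < A" using that by simp_all
      then show ?thesis using s[OF p(2)] assms by (simp add: complex_eq_iff)
    qed
    show "?\<Phi> (?\<Psi> x) = x" if "x \<in> doubly_punctured_sphere" for x
    proof -
      have "(x$3)\<^sup>2 < 1" using that by (simp add: dps abs_square_less_1)
      then show ?thesis using assms by (simp add: vec_eq_iff forall_3)
    qed
  qed
  then show ?thesis using that by blast
qed

section \<open>Distances in the induced metric\<close>

text \<open>
  The projection to the radius is a Riemannian submersion.
\<close>

lemma first_component_le_metric: "\<bar>v$1\<bar> \<le> sqrt (metric \<kappa> \<tau> x v v)"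
proof (rule real_le_rsqrt)
  show "\<bar>v$1\<bar>\<^sup>2 \<le> metric \<kappa> \<tau> x v v"
    by (simp add: metric_eq power2_eq_square[of "v$1", symmetric] flip: power2_eq_square[of "v$2"] power2_eq_square[of "_ - _"])
qed

locale C1_curve =
  fixes D :: "real set" and \<gamma> g :: "real \<Rightarrow> real \<times> real"
  assumes D: "open D" "is_interval D"
    and deriv: "\<And>t. t \<in> D \<Longrightarrow> (\<gamma> has_vector_derivative g t) (at t)"
    and cont: "continuous_on D g"
begin

lemma radius_deriv: "t \<in> D \<Longrightarrow> ((\<lambda>t. fst (\<gamma> t)) has_real_derivative fst (g t)) (at t)"
  unfolding has_real_derivative_iff_has_vector_derivative
  by (rule bounded_linear.has_vector_derivative[OF bounded_linear_fst deriv])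

lemma height_deriv: "t \<in> D \<Longrightarrow> ((\<lambda>t. snd (\<gamma> t)) has_real_derivative snd (g t)) (at t)"
  unfolding has_real_derivative_iff_has_vector_derivative
  by (rule bounded_linear.has_vector_derivative[OF bounded_linear_snd deriv])

lemma continuous_on_curve: "continuous_on D \<gamma>"
  using deriv by (metis continuous_at_imp_continuous_on has_vector_derivative_continuous)

text \<open>
  The length of a path bounds the variation of the radius along it.
\<close>

lemma path_length_ge:
  assumes "path_length \<kappa> \<tau> a D \<gamma> p p' l"
  shows "\<bar>fst (\<gamma> (fst p)) - fst (\<gamma> (fst p'))\<bar> \<le> l"
proof -
  obtain c where c: "c piecewise_C1_differentiable_on {0..1}" "c 0 = p" "c 1 = p'" "c ` {0..1} \<subseteq> D \<times> UNIV"
    and l: "((\<lambda>s. let v = vector_derivative (\<lambda>s. gen_coord a \<gamma> (c s)) (at s)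
              in sqrt (metric \<kappa> \<tau> (gen_coord a \<gamma> (c s)) v v)) has_integral l) {0..1}"
    using assms unfolding path_length_def by blast
  define v where "v s = vector_derivative (\<lambda>s. gen_coord a \<gamma> (c s)) (at s)" for s
  define f where "f s = fst (\<gamma> (fst (c s)))" for s
  have cc: "continuous_on {0..1} c" using c(1) by (simp add: piecewise_C1_differentiable_on_def)
  obtain S where S: "finite S" "c C1_differentiable_on ({0..1} - S)"
    using c(1) by (auto simp: piecewise_C1_differentiable_on_def)
  obtain c' where c': "\<And>s. s \<in> {0..1} - S \<Longrightarrow> (c has_vector_derivative c' s) (at s)"
    using S(2) unfolding C1_differentiable_on_def by blast
  have cD: "fst (c s) \<in> D" if "s \<in> {0..1}" for s using c(4) that by (force simp: image_subset_iff)
  have cf: "continuous_on {0..1} f" unfolding f_def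
    by (intro continuous_on_fst continuous_on_compose2[OF continuous_on_curve] cc) (use cD in auto)
  have df: "(f has_vector_derivative v s $ 1) (at s)" if s: "s \<in> {0<..<1} - S" for s
  proof -
    have s': "s \<in> {0..1} - S" "fst (c s) \<in> D" using s cD[of s] by auto
    have c1: "((\<lambda>s. fst (c s)) has_real_derivative fst (c' s)) (at s)"
      unfolding has_real_derivative_iff_has_vector_derivative
      by (rule bounded_linear.has_vector_derivative[OF bounded_linear_fst c'[OF s'(1)]])
    have c2: "((\<lambda>s. snd (c s)) has_real_derivative snd (c' s)) (at s)"
      unfolding has_real_derivative_iff_has_vector_derivative
      by (rule bounded_linear.has_vector_derivative[OF bounded_linear_snd c'[OF s'(1)]])
    have r: "(f has_real_derivative fst (g (fst (c s))) * fst (c' s)) (at s)"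
      unfolding f_def[abs_def] by (rule DERIV_chain2[OF radius_deriv[OF s'(2)] c1])
    have h: "((\<lambda>s. snd (\<gamma> (fst (c s))) + a * snd (c s)) has_real_derivative
        snd (g (fst (c s))) * fst (c' s) + a * snd (c' s)) (at s)"
      by (rule DERIV_add[OF DERIV_chain2[OF height_deriv[OF s'(2)] c1] DERIV_cmult[OF c2]])
    have "v s = vector [fst (g (fst (c s))) * fst (c' s), snd (c' s), snd (g (fst (c s))) * fst (c' s) + a * snd (c' s)]"
      unfolding v_def gen_coord_eq
      by (rule vector_derivative_at, rule has_vector_derivative_vector_3[OF r[unfolded f_def[abs_def]] c2 h])
    then show ?thesis using r by (simp add: has_real_derivative_iff_has_vector_derivative)
  qed
  have int: "((\<lambda>s. v s $ 1) has_integral f 1 - f 0) {0..1}"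
    by (rule fundamental_theorem_of_calculus_interior_strong[OF S(1) _ df cf]) auto
  have l': "((\<lambda>s. sqrt (metric \<kappa> \<tau> (gen_coord a \<gamma> (c s)) (v s) (v s))) has_integral l) {0..1}"
    using l by (simp add: v_def Let_def)
  have "f 1 - f 0 \<le> l"
    by (rule has_integral_le[OF int l']) (use first_component_le_metric abs_le_D1 in blast)
  moreover have "- (f 1 - f 0) \<le> l"
    by (rule has_integral_le[OF has_integral_neg[OF int] l']) (use first_component_le_metric abs_le_D2 in blast)
  ultimately show ?thesis using c(2,3) by (simp add: f_def abs_le_iff)
qed

text \<open>
  The speed of the image of the straight segment from \<open>p\<close> to \<open>p'\<close> in the parameter domain.
\<close>

definition line_speed :: "real \<Rightarrow> real \<Rightarrow> real \<Rightarrow> real \<times> real \<Rightarrow> real \<times> real \<Rightarrow> real \<Rightarrow> real" where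
  "line_speed \<kappa> \<tau> a p p' s =
     (let q = p + s *\<^sub>R (p' - p);
          v = vector [fst (g (fst q)) * (fst p' - fst p), snd p' - snd p,
                snd (g (fst q)) * (fst p' - fst p) + a * (snd p' - snd p)]
      in sqrt (metric \<kappa> \<tau> (gen_coord a \<gamma> q) v v))"

lemma line_in_D:
  assumes "fst p \<in> D" "fst p' \<in> D" "s \<in> {0..1}"
  shows "fst p + s * (fst p' - fst p) \<in> D"
proof -
  have "(1 - s) *\<^sub>R fst p + s *\<^sub>R fst p' \<in> D"
    using is_interval_convex[OF D(2)] assms by (intro convexD_alt) auto
  then show ?thesis by (simp add: algebra_simps)
qed

lemma continuous_on_line_speed:
  assumes "fst p \<in> D" "fst p' \<in> D"
  shows "continuous_on {0..1} (line_speed \<kappa> \<tau> a p p')"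
proof -
  note L = line_in_D[OF assms]
  have g: "continuous_on {0..1} (\<lambda>s. g (fst p + s * (fst p' - fst p)))"
    by (rule continuous_on_compose2[OF cont]) (use L in \<open>auto intro!: continuous_intros\<close>)
  have \<gamma>: "continuous_on {0..1} (\<lambda>s. \<gamma> (fst p + s * (fst p' - fst p)))"
    by (rule continuous_on_compose2[OF continuous_on_curve]) (use L in \<open>auto intro!: continuous_intros\<close>)
  show ?thesis
    unfolding line_speed_def Let_def metric_eq gen_coord_eq by (simp, intro continuous_intros g \<gamma>)
qed

lemma path_length_line:
  assumes "fst p \<in> D" "fst p' \<in> D"
  shows "path_length \<kappa> \<tau> a D \<gamma> p p' (integral {0..1} (line_speed \<kappa> \<tau> a p p'))"
  unfolding path_length_def
proof (rule exI[of _ "\<lambda>s. p + s *\<^sub>R (p' - p)"], intro conjI)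
  let ?c = "\<lambda>s. p + s *\<^sub>R (p' - p)"
  note L = line_in_D[OF assms]
  have dc: "(?c has_vector_derivative p' - p) (at s)" for s
    by (auto intro!: derivative_eq_intros)
  have "?c C1_differentiable_on {0..1}"
    unfolding C1_differentiable_on_def using dc by (intro exI[of _ "\<lambda>s. p' - p"]) auto
  then show "?c piecewise_C1_differentiable_on {0..1}" by (rule C1_differentiable_imp_piecewise)
  show "?c ` {0..1} \<subseteq> D \<times> UNIV" using L by (intro image_subsetI) (simp add: mem_Times_iff)
  have "(let v = vector_derivative (\<lambda>s. gen_coord a \<gamma> (?c s)) (at s)
              in sqrt (metric \<kappa> \<tau> (gen_coord a \<gamma> (?c s)) v v)) = line_speed \<kappa> \<tau> a p p' s" if s: "s \<in> {0..1}" for s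
  proof -
    have c1: "((\<lambda>s. fst (?c s)) has_real_derivative fst p' - fst p) (at s)"
      by (auto intro!: derivative_eq_intros)
    have c2: "((\<lambda>s. snd (?c s)) has_real_derivative snd p' - snd p) (at s)"
      by (auto intro!: derivative_eq_intros)
    have sD: "fst (?c s) \<in> D" using L[OF s] by simp
    have r: "((\<lambda>s. fst (\<gamma> (fst (?c s)))) has_real_derivative fst (g (fst (?c s))) * (fst p' - fst p)) (at s)"
      by (rule DERIV_chain2[OF radius_deriv[OF sD] c1])
    have h: "((\<lambda>s. snd (\<gamma> (fst (?c s))) + a * snd (?c s)) has_real_derivative
        snd (g (fst (?c s))) * (fst p' - fst p) + a * (snd p' - snd p)) (at s)"
      by (rule DERIV_add[OF DERIV_chain2[OF height_deriv[OF sD] c1] DERIV_cmult[OF c2]])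
    have "vector_derivative (\<lambda>s. gen_coord a \<gamma> (?c s)) (at s) =
        vector [fst (g (fst (?c s))) * (fst p' - fst p), snd p' - snd p,
                snd (g (fst (?c s))) * (fst p' - fst p) + a * (snd p' - snd p)]"
      unfolding gen_coord_eq by (rule vector_derivative_at, rule has_vector_derivative_vector_3[OF r c2 h])
    then show ?thesis by (simp only: line_speed_def Let_def)
  qed
  then show "((\<lambda>s. let v = vector_derivative (\<lambda>s. gen_coord a \<gamma> (?c s)) (at s)
              in sqrt (metric \<kappa> \<tau> (gen_coord a \<gamma> (?c s)) v v)) has_integral
      integral {0..1} (line_speed \<kappa> \<tau> a p p')) {0..1}"
    by (subst has_integral_cong[of _ _ "line_speed \<kappa> \<tau> a p p'"])
       (use integrable_continuous_real[OF continuous_on_line_speed[OF assms]] in auto)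
qed auto

text \<open>
  The straight segment makes the set of lengths nonempty, so that its infimum is meaningful.
\<close>

lemma riem_dist_ge:
  assumes "fst p \<in> D" "fst p' \<in> D"
  shows "\<bar>fst (\<gamma> (fst p)) - fst (\<gamma> (fst p'))\<bar> \<le> riem_dist \<kappa> \<tau> a D \<gamma> p p'"
  unfolding riem_dist_def
  by (rule cInf_greatest) (use path_length_line[OF assms] path_length_ge in auto)

lemma riem_dist_le:
  assumes "t \<in> D" "t' \<in> D" and B: "\<And>t. t \<in> D \<Longrightarrow> norm (g t) \<le> B"
  shows "riem_dist \<kappa> \<tau> a D \<gamma> (t, 0) (t', 0) \<le> B * \<bar>t' - t\<bar>"
proof -
  let ?p = "(t, 0 :: real)" and ?p' = "(t', 0 :: real)"
  have pD: "fst ?p \<in> D" "fst ?p' \<in> D" using assms by auto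
  have "riem_dist \<kappa> \<tau> a D \<gamma> ?p ?p' \<le> integral {0..1} (line_speed \<kappa> \<tau> a ?p ?p')"
    unfolding riem_dist_def
  proof (rule cInf_lower)
    show "integral {0..1} (line_speed \<kappa> \<tau> a ?p ?p') \<in> {l. path_length \<kappa> \<tau> a D \<gamma> ?p ?p' l}"
      using path_length_line[OF pD] by simp
    show "bdd_below {l. path_length \<kappa> \<tau> a D \<gamma> ?p ?p' l}"
      by (rule bdd_belowI[of _ 0]) (use path_length_ge in fastforce)
  qed
  also have "\<dots> \<le> integral {0..1} (\<lambda>s :: real. B * \<bar>t' - t\<bar>)"
  proof (rule Henstock_Kurzweil_Integration.integral_le)
    show "line_speed \<kappa> \<tau> a ?p ?p' integrable_on {0..1}"
      by (rule integrable_continuous_real[OF continuous_on_line_speed[OF pD]])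
    fix s :: real assume s: "s \<in> {0..1}"
    define u where "u = t + s * (t' - t)"
    have u: "u \<in> D" using line_in_D[OF pD s] by (simp add: u_def)
    have "line_speed \<kappa> \<tau> a ?p ?p' s = sqrt ((fst (g u))\<^sup>2 * (t' - t)\<^sup>2 + (snd (g u))\<^sup>2 * (t' - t)\<^sup>2)"
      by (simp add: line_speed_def Let_def metric_eq gen_coord_eq u_def power2_eq_square algebra_simps)
    also have "\<dots> = sqrt (((fst (g u))\<^sup>2 + (snd (g u))\<^sup>2) * (t' - t)\<^sup>2)" by (simp add: distrib_right)
    also have "\<dots> = norm (g u) * \<bar>t' - t\<bar>" by (simp add: real_sqrt_mult norm_prod_def)
    also have "\<dots> \<le> B * \<bar>t' - t\<bar>" using B[OF u] by (intro mult_right_mono) auto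
    finally show "line_speed \<kappa> \<tau> a ?p ?p' s \<le> B * \<bar>t' - t\<bar>" .
  qed auto
  finally show ?thesis by simp
qed

text \<open>
  A curve of finite length that runs into the axis gives a Cauchy sequence. It has no limit, since the
  radius is a Lipschitz function for the distance and is positive on the surface.
\<close>

lemma not_complete_surface:
  assumes B: "\<And>t. t \<in> D \<Longrightarrow> norm (g t) \<le> B" and pos: "\<And>t. t \<in> D \<Longrightarrow> 0 < fst (\<gamma> t)"
    and T: "\<And>n. T n \<in> D" "T \<longlonglongrightarrow> L" "(\<lambda>n. fst (\<gamma> (T n))) \<longlonglongrightarrow> 0"
  shows "\<not> complete_surface \<kappa> \<tau> a D \<gamma>"
proof
  assume C: "complete_surface \<kappa> \<tau> a D \<gamma>"
  define x where "x n = (T n, 0 :: real)" for n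
  have "0 \<le> B" using B[OF T(1)[of 0]] norm_ge_zero order_trans by blast
  have r: "range x \<subseteq> D \<times> UNIV" using T(1) by (auto simp: x_def)
  have cauchy: "\<forall>e>0. \<exists>n0. \<forall>m\<ge>n0. \<forall>n\<ge>n0. riem_dist \<kappa> \<tau> a D \<gamma> (x m) (x n) < e"
  proof (intro allI impI)
    fix e :: real assume "e > 0"
    then have "e / (B + 1) > 0" using \<open>0 \<le> B\<close> by simp
    then obtain n0 where n0: "\<And>m n. m \<ge> n0 \<Longrightarrow> n \<ge> n0 \<Longrightarrow> \<bar>T m - T n\<bar> < e / (B + 1)"
      using LIMSEQ_imp_Cauchy[OF T(2)] unfolding Cauchy_def dist_real_def by blast
    have "riem_dist \<kappa> \<tau> a D \<gamma> (x m) (x n) < e" if "m \<ge> n0" "n \<ge> n0" for m n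
    proof -
      have "riem_dist \<kappa> \<tau> a D \<gamma> (x m) (x n) \<le> B * \<bar>T n - T m\<bar>"
        unfolding x_def by (rule riem_dist_le[OF T(1) T(1) B])
      also have "\<dots> \<le> (B + 1) * \<bar>T n - T m\<bar>" by (intro mult_right_mono) auto
      also have "\<dots> < e" using n0[OF that(2,1)] \<open>0 \<le> B\<close> by (simp add: field_simps)
      finally show ?thesis .
    qed
    then show "\<exists>n0. \<forall>m\<ge>n0. \<forall>n\<ge>n0. riem_dist \<kappa> \<tau> a D \<gamma> (x m) (x n) < e" by blast
  qed
  obtain p where p: "p \<in> D \<times> UNIV" "(\<lambda>n. riem_dist \<kappa> \<tau> a D \<gamma> (x n) p) \<longlonglongrightarrow> 0"
    using C r cauchy unfolding complete_surface_def by blast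
  then have pD: "fst p \<in> D" by auto
  have "(\<lambda>n. fst (\<gamma> (T n)) - fst (\<gamma> (fst p))) \<longlonglongrightarrow> 0"
  proof (rule Lim_null_comparison[OF _ p(2)])
    have "norm (fst (\<gamma> (T n)) - fst (\<gamma> (fst p))) \<le> riem_dist \<kappa> \<tau> a D \<gamma> (x n) p" for n
      using riem_dist_ge[of "x n" p] T(1)[of n] pD by (simp add: x_def)
    then show "\<forall>\<^sub>F n in sequentially. norm (fst (\<gamma> (T n)) - fst (\<gamma> (fst p))) \<le> riem_dist \<kappa> \<tau> a D \<gamma> (x n) p"
      by simp
  qed
  moreover have "(\<lambda>n. fst (\<gamma> (T n)) - fst (\<gamma> (fst p))) \<longlonglongrightarrow> 0 - fst (\<gamma> (fst p))"
    by (intro tendsto_intros T(3))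
  ultimately have "0 - fst (\<gamma> (fst p)) = 0" using LIMSEQ_unique by blast
  then show False using pos[OF pD] by simp
qed

end

section \<open>Cylinders, unduloids and spheres\<close>

lemma strict_mono_on_if_deriv_pos:
  fixes f :: "real \<Rightarrow> real"
  assumes D: "is_interval D" and f: "\<And>t. t \<in> D \<Longrightarrow> (f has_real_derivative f' t) (at t)"
    and pos: "\<And>t. t \<in> D \<Longrightarrow> 0 < f' t"
  shows "strict_mono_on D f"
proof (rule strict_mono_onI)
  fix x y assume xy: "x \<in> D" "y \<in> D" "x < y"
  show "f x < f y"
  proof (rule DERIV_pos_imp_increasing[OF xy(3)])
    fix z assume "x \<le> z" "z \<le> y"
    then have "z \<in> D" using mem_is_interval_1_I[OF D xy(1,2)] by blast
    then show "\<exists>d. (f has_real_derivative d) (at z) \<and> 0 < d" using f pos by blast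
  qed
qed

context cmc
begin

abbreviation cycle :: real where "cycle \<equiv> 2 * pi / freq"

lemma cycle_pos: "0 < cycle" using freq_pos by simp

lemma Q_periodic: "Q J (t + cycle) = Q J t"
proof -
  have "freq * (t + cycle) = freq * t + 2 * pi" using freq_pos by (simp add: distrib_left)
  then show ?thesis by (simp add: Q_def)
qed

lemma Q'_periodic: "Q' J (t + cycle) = Q' J t"
proof -
  have "freq * (t + cycle) = freq * t + 2 * pi" using freq_pos by (simp add: distrib_left)
  then show ?thesis by (simp add: Q'_def)
qed

lemma Q_even: "Q J (- t) = Q J t" by (simp add: Q_def)

lemma rates_periodic:
  "angle_rate J (t + cycle) = angle_rate J t" "height_rate \<tau> a J (t + cycle) = height_rate \<tau> a J t"
  by (simp_all add: angle_rate_def height_rate_def Q_periodic)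

lemma rates_even: "angle_rate J (- t) = angle_rate J t" "height_rate \<tau> a J (- t) = height_rate \<tau> a J t"
  by (simp_all add: angle_rate_def height_rate_def Q_even)

lemma Q_le_Q0: "J \<in> J_range \<kappa> H \<Longrightarrow> Q J t \<le> Q J 0"
proof -
  assume J: "J \<in> J_range \<kappa> H"
  have "amp J * cos (freq * t) \<le> amp J * 1" by (rule mult_left_mono[OF cos_le_one amp_nonneg[OF J]])
  then show ?thesis by (simp add: Q_def divide_right_mono)
qed

lemma lifetime_UNIV: "J \<noteq> 0 \<Longrightarrow> lifetime J = UNIV" by (simp add: lifetime_def)

text \<open>
  The conclusion of \<open>profile_normal_form\<close> in components, as a predicate, so that statements about one profile
  can share the same constants.
\<close>

definition is_normal_form ::
  "real \<Rightarrow> real \<Rightarrow> real \<Rightarrow> real set \<Rightarrow> (real \<Rightarrow> real \<times> real) \<Rightarrow> (real \<Rightarrow> real) \<Rightarrow> real \<Rightarrow> real \<Rightarrow> int \<Rightarrow> bool" where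
  "is_normal_form \<tau> a J D \<gamma> \<sigma> c b k \<longleftrightarrow> D = {t. t + c \<in> lifetime J} \<and>
     (\<forall>t\<in>D. fst (\<gamma> t) = rad \<kappa> (Q J (t + c)) \<and> snd (\<gamma> t) = prim (height_rate \<tau> a J) (t + c) + b \<and>
            \<sigma> t = angle J (t + c) + 2 * pi * of_int k)"

lemma normal_form_exists:
  assumes "J \<in> J_range \<kappa> H" "profile \<kappa> \<tau> a H J D \<gamma> \<sigma>"
  obtains c b k where "is_normal_form \<tau> a J D \<gamma> \<sigma> c b k"
proof -
  obtain c b and k :: int where n: "D = {t. t + c \<in> lifetime J}"
    "\<And>t. t \<in> D \<Longrightarrow> \<gamma> t = curve \<tau> a J (t + c) + (0, b)"
    "\<And>t. t \<in> D \<Longrightarrow> \<sigma> t = angle J (t + c) + 2 * pi * of_int k"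
    by (rule profile_normal_form[OF assms]) blast
  have "is_normal_form \<tau> a J D \<gamma> \<sigma> c b k"
    unfolding is_normal_form_def using n by (simp add: curve_def)
  then show ?thesis by (rule that)
qed

lemma profile_immersion:
  assumes "profile \<kappa> \<tau> a H J D \<gamma> \<sigma>"
  shows "C1_immersion (D \<times> UNIV) (gen_coord a \<gamma>)"
    and "C1_curve D \<gamma> (\<lambda>t. (cos (\<sigma> t), W \<kappa> \<tau> a (fst (\<gamma> t)) * sin (\<sigma> t)))"
proof -
  note sol = profileD(1)[OF assms]
  note d = solution_derivatives[OF sol] and S = is_solutionD[OF sol]
  show "C1_immersion (D \<times> UNIV) (gen_coord a \<gamma>)"
  proof (rule C1_immersion_gen_coord[OF d(1,4)])
    fix t assume "t \<in> D"
    then have "W \<kappa> \<tau> a (fst (\<gamma> t)) > 0" using W_pos S(5) by blast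
    moreover have "cos (\<sigma> t) \<noteq> 0 \<or> sin (\<sigma> t) \<noteq> 0" using sin_zero_abs_cos_one by fastforce
    ultimately show "(cos (\<sigma> t), W \<kappa> \<tau> a (fst (\<gamma> t)) * sin (\<sigma> t)) \<noteq> 0" by (auto simp: prod_eq_iff)
  qed
  show "C1_curve D \<gamma> (\<lambda>t. (cos (\<sigma> t), W \<kappa> \<tau> a (fst (\<gamma> t)) * sin (\<sigma> t)))"
    by (rule C1_curve.intro[OF S(1,2) d(1,4)])
qed

lemma cylindrically_bounded:
  assumes J: "J \<in> J_range \<kappa> H" and P: "profile \<kappa> \<tau> a H J D \<gamma> \<sigma>"
  shows "\<exists>R \<in> I \<kappa>. \<forall>p \<in> gen_surface a D \<gamma>. fst p \<le> R"
proof
  obtain c b k where N: "is_normal_form \<tau> a J D \<gamma> \<sigma> c b k" by (rule normal_form_exists[OF J P])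
  show "rad \<kappa> (Q J 0) \<in> I \<kappa>" by (rule explicit_radius(1)[OF J zero_in_lifetime])
  show "\<forall>p \<in> gen_surface a D \<gamma>. fst p \<le> rad \<kappa> (Q J 0)"
  proof
    fix p assume "p \<in> gen_surface a D \<gamma>"
    then obtain t \<phi> where t: "t \<in> D" "p = gen_point a \<gamma> (t, \<phi>)" by (auto simp: gen_surface_def)
    then have "fst p = rad \<kappa> (Q J (t + c))" using N by (simp add: gen_point_eq is_normal_form_def)
    also have "\<dots> \<le> rad \<kappa> (Q J 0)"
      by (rule rad_mono[OF Q_nonneg[OF J] Q_le_Q0[OF J] less_imp_le[OF Q_less[OF J]]])
    finally show "fst p \<le> rad \<kappa> (Q J 0)" .
  qed
qed

lemma sin_angle_pos:
  assumes J: "J \<in> J_range \<kappa> H" "0 \<le> J" and t: "t \<in> lifetime J"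
  shows "0 < sin (angle J t)"
proof -
  have "0 < J + 2 * H * Q J t" using Q_pos[OF J(1) t] H_pos J(2) by (simp add: add_nonneg_pos)
  then show ?thesis unfolding angle_identities(2)[OF J(1) t] using explicit_radius(3)[OF J(1) t] by simp
qed

lemma profile_sin:
  assumes N: "is_normal_form \<tau> a J D \<gamma> \<sigma> c b k" and "t \<in> D"
  shows "sin (\<sigma> t) = sin (angle J (t + c))" "cos (\<sigma> t) = cos (angle J (t + c))"
proof -
  have "\<sigma> t = angle J (t + c) + 2 * pi * of_int k" using N assms(2) by (simp add: is_normal_form_def)
  then show "sin (\<sigma> t) = sin (angle J (t + c))" "cos (\<sigma> t) = cos (angle J (t + c))"
    using sin_cos_eq_iff[of "\<sigma> t" "angle J (t + c)"] by auto
qed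

lemma profile_height_increasing:
  assumes J: "J \<in> J_range \<kappa> H" "0 \<le> J" and P: "profile \<kappa> \<tau> a H J D \<gamma> \<sigma>"
  shows "strict_mono_on D (\<lambda>t. snd (\<gamma> t))"
proof -
  obtain c b k where N: "is_normal_form \<tau> a J D \<gamma> \<sigma> c b k" by (rule normal_form_exists[OF J(1) P])
  note S = is_solutionD[OF profileD(1)[OF P]]
  show ?thesis
  proof (rule strict_mono_on_if_deriv_pos[OF S(2) S(7)])
    fix t assume t: "t \<in> D"
    then have "t + c \<in> lifetime J" using N by (simp add: is_normal_form_def)
    then show "0 < W \<kappa> \<tau> a (fst (\<gamma> t)) * sin (\<sigma> t)"
      unfolding profile_sin(1)[OF N t] using sin_angle_pos[OF J] W_pos[OF S(5)[OF t]] by simp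
  qed
qed

lemma no_period_if_height_increasing:
  fixes \<gamma> :: "real \<Rightarrow> real \<times> real"
  assumes "strict_mono_on D (\<lambda>t. snd (\<gamma> t))" "D \<noteq> {}" "period D \<gamma> T"
  shows "T = 0"
proof -
  obtain s where s: "s \<in> D" using assms(2) by blast
  then have s': "s + T \<in> D" "\<gamma> (s + T) = \<gamma> s" using assms(3) by (auto simp: period_def)
  have "inj_on (\<lambda>t. snd (\<gamma> t)) D" by (rule strict_mono_on_imp_inj_on[OF assms(1)])
  then have "s + T = s" by (rule inj_onD[OF _ _ s'(1) s]) (simp add: s'(2))
  then show ?thesis by simp
qed

text \<open>
  For \<open>J = J\<^sub>m\<^sub>a\<^sub>x\<close> the amplitude is zero and the radius is constant. Then the angle is constantly \<open>\<pi> / 2\<close>, and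
  the angle equation reduces to \<open>ct r = 2 H\<close>.
\<close>

lemma cylinder_case:
  assumes J: "J = J_max \<kappa> H" and P: "profile \<kappa> \<tau> a H J D \<gamma> \<sigma>" and JR: "J \<in> J_range \<kappa> H"
  shows "\<gamma> ` D = {arct \<kappa> (2 * H)} \<times> UNIV"
    and "gen_surface a D \<gamma> = {arct \<kappa> (2 * H)} \<times> sphere 0 1 \<times> UNIV"
proof -
  obtain c b k where N: "is_normal_form \<tau> a J D \<gamma> \<sigma> c b k" by (rule normal_form_exists[OF JR P])
  have J0: "0 < J" using J J_max_pos by simp
  have lifetime: "lifetime J = UNIV" using J0 by (simp add: lifetime_def)
  have amp: "amp J = 0" using amp_J_max J by simp
  have Q: "Q J t = Q J 0" for t by (simp add: Q_def amp)
  define r0 where "r0 = rad \<kappa> (Q J 0)"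
  define m where "m = height_rate \<tau> a J 0"
  have r0I: "r0 \<in> I \<kappa>" unfolding r0_def by (rule explicit_radius(1)[OF JR zero_in_lifetime])
  have c0: "cos (angle J t) = 0" for t
    using angle_identities(1)[OF JR, of t] by (simp add: lifetime Q'_def amp)
  have s1: "sin (angle J t) = 1" for t
  proof -
    have "(sin (angle J t))\<^sup>2 = 1" using c0[of t] by (simp add: sin_squared_eq)
    then show ?thesis using sin_angle_pos[OF JR less_imp_le[OF J0], of t] by (auto simp: lifetime power2_eq_1_iff)
  qed
  have "angle_rate J 0 = 0"
  proof -
    have "((\<lambda>t. cos (angle J t)) has_real_derivative - sin (angle J 0) * angle_rate J 0) (at 0)"
      by (rule DERIV_chain2[OF DERIV_cos DERIV_angle[OF JR zero_in_lifetime]])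
    moreover have "((\<lambda>t. cos (angle J t)) has_real_derivative 0) (at 0)" by (simp add: c0)
    ultimately have "- sin (angle J 0) * angle_rate J 0 = 0" by (rule DERIV_unique)
    then show ?thesis by (simp add: s1)
  qed
  then have ct: "ct \<kappa> r0 = 2 * H"
    using angle_identities(3)[OF JR zero_in_lifetime] by (simp add: s1 r0_def)
  have arct: "arct \<kappa> (2 * H) = r0"
    unfolding arct_def ct[symmetric] by (rule the_inv_into_f_f[OF ct_inj r0I])
  have hr: "height_rate \<tau> a J = (\<lambda>t. m)"
  proof
    fix t show "height_rate \<tau> a J t = m" by (simp only: m_def height_rate_def Q[of t])
  qed
  have pm: "prim (\<lambda>t. m) t = t * m" for t by (simp add: prim_def)
  have \<gamma>: "\<gamma> t = (r0, (t + c) * m + b)" for t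
  proof -
    have n: "fst (\<gamma> t) = rad \<kappa> (Q J (t + c))" "snd (\<gamma> t) = prim (height_rate \<tau> a J) (t + c) + b"
      using N by (simp_all add: is_normal_form_def lifetime)
    then show ?thesis by (simp only: pm prod_eq_iff r0_def Q[of "t + c"] hr fst_conv snd_conv)
  qed
  have D: "D = UNIV" using N by (simp add: is_normal_form_def lifetime)
  have mpos: "m > 0"
  proof -
    have 1: "0 < Q J 0 * (2 - \<kappa> * Q J 0)" by (rule Q_denominator[OF JR zero_in_lifetime])
    have 2: "0 < J + 2 * H * Q J 0" using J0 H_pos Q_nonneg[OF JR, of 0] by (simp add: add_pos_nonneg)
    have 3: "0 < sqrt (Q J 0 * (2 - \<kappa> * Q J 0) + (2 * \<tau> * Q J 0 - a)\<^sup>2)"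
      using 1 by (simp only: real_sqrt_gt_0_iff add_pos_nonneg zero_le_power2)
    show ?thesis unfolding m_def height_rate_def
      by (rule divide_pos_pos[OF mult_pos_pos[OF 3 2] 1])
  qed
  have surj: "\<exists>t. z = (t + c) * m + b" for z
    using mpos by (intro exI[of _ "(z - b) / m - c"]) simp
  show "\<gamma> ` D = {arct \<kappa> (2 * H)} \<times> UNIV"
    unfolding arct D using surj by (auto simp: \<gamma> image_iff)
  show "gen_surface a D \<gamma> = {arct \<kappa> (2 * H)} \<times> sphere 0 1 \<times> UNIV"
  proof (intro set_eqI iffI)
    fix x assume "x \<in> gen_surface a D \<gamma>"
    then show "x \<in> {arct \<kappa> (2 * H)} \<times> sphere 0 1 \<times> UNIV"
      by (auto simp: gen_surface_def gen_point_eq \<gamma> arct)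
  next
    fix x :: "real \<times> complex \<times> real" assume "x \<in> {arct \<kappa> (2 * H)} \<times> sphere 0 1 \<times> UNIV"
    then obtain w z where x: "x = (r0, w, z)" "norm w = 1" by (auto simp: arct)
    then have w: "w = cis (Arg w)" using rcis_cmod_Arg[of w] by (simp add: rcis_def)
    obtain t where "z - a * Arg w = (t + c) * m + b" using surj by blast
    then have "x = gen_point a \<gamma> (t, Arg w)" using x(1) w by (simp add: gen_point_eq \<gamma>)
    then show "x \<in> gen_surface a D \<gamma>" unfolding gen_surface_def D by blast
  qed
qed

lemma angle_shift:
  assumes "J \<in> J_range \<kappa> H" "J \<noteq> 0"
  shows "angle J (t + cycle) - angle J t = angle J cycle - pi / 2"
    and "cis (angle J (t + cycle)) = cis (angle J t)"
proof -
  have d: "((\<lambda>t. angle J (t + cycle) - angle J t) has_real_derivative 0) (at t within UNIV)" for t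
    using DERIV_diff[OF DERIV_angle[OF assms(1), of "t + cycle", unfolded DERIV_shift] DERIV_angle[OF assms(1), of t]]
    by (simp add: lifetime_UNIV[OF assms(2)] rates_periodic)
  obtain d where "\<And>t. angle J (t + cycle) - angle J t = d"
    using has_field_derivative_zero_constant[OF convex_UNIV, of "\<lambda>t. angle J (t + cycle) - angle J t"] d by blast
  from this[of t] this[of 0] show "angle J (t + cycle) - angle J t = angle J cycle - pi / 2"
    by (simp add: angle_def)
  show "cis (angle J (t + cycle)) = cis (angle J t)"
    using angle_identities(1,2)[OF assms(1), of t] angle_identities(1,2)[OF assms(1), of "t + cycle"]
    by (simp add: complex_eq_iff lifetime_UNIV[OF assms(2)] Q_periodic Q'_periodic)
qed

lemma continuous_on_angle: "J \<in> J_range \<kappa> H \<Longrightarrow> J \<noteq> 0 \<Longrightarrow> continuous_on UNIV (angle J)"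
  using DERIV_angle[of J] by (intro continuous_at_imp_continuous_on ballI DERIV_isCont) (auto simp: lifetime_UNIV)

text \<open>
  The sine of the angle is positive, so by the intermediate value theorem the angle never leaves the interval
  \<open>(0, \<pi>)\<close> in which it starts, while in one cycle it changes by a multiple of \<open>2 \<pi>\<close>.
\<close>

lemma angle_periodic:
  assumes J: "J \<in> J_range \<kappa> H" "0 < J"
  shows "angle J (t + cycle) = angle J t"
proof -
  have J0: "J \<noteq> 0" using J by simp
  have sp: "0 < sin (angle J t)" for t using sin_angle_pos[OF J(1) less_imp_le[OF J(2)]] by (simp add: lifetime_UNIV[OF J0])
  have conn: "connected (range (angle J))"
    by (rule connected_continuous_image[OF continuous_on_angle[OF J(1) J0] connected_UNIV])
  have mid: "pi / 2 \<in> range (angle J)" by (rule image_eqI[of _ _ 0]) (simp_all add: angle_def)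
  have no: "0 \<notin> range (angle J)" "pi \<notin> range (angle J)"
    using sp by (metis imageE less_irrefl sin_zero, metis imageE less_irrefl sin_pi)
  have b: "0 < angle J t" "angle J t < pi" for t
  proof -
    have r: "angle J t \<in> range (angle J)" by simp
    show "0 < angle J t"
    proof (rule ccontr)
      assume "\<not> 0 < angle J t"
      then have "0 \<in> range (angle J)" by (intro connectedD_interval[OF conn r mid]) auto
      then show False using no(1) by simp
    qed
    show "angle J t < pi"
    proof (rule ccontr)
      assume "\<not> angle J t < pi"
      then have "pi \<in> range (angle J)" by (intro connectedD_interval[OF conn mid r]) auto
      then show False using no(2) by simp
    qed
  qed
  obtain n :: int where n: "angle J (t + cycle) = angle J t + 2 * pi * of_int n"
    using angle_shift(2)[OF J(1) J0, of t] sin_cos_eq_iff[of "angle J (t + cycle)" "angle J t"]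
    by (auto simp: complex_eq_iff)
  have "\<bar>2 * pi * of_int n\<bar> < pi" using n b[of t] b[of "t + cycle"] by linarith
  then have "\<bar>real_of_int n\<bar> * (2 * pi) < 1 * (2 * pi)" using pi_gt_zero by (simp add: abs_mult)
  then have "\<bar>real_of_int n\<bar> < 1" by (rule mult_right_less_imp_less) simp
  then have "n = 0" by linarith
  then show ?thesis using n by simp
qed

lemma unduloid_case:
  assumes J: "J \<in> J_range \<kappa> H" "0 < J" and P: "profile \<kappa> \<tau> a H J D \<gamma> \<sigma>"
  shows "D = UNIV" and "strict_mono (\<lambda>t. snd (\<gamma> t))"
    and "\<exists>T>0. \<forall>t. fst (\<gamma> (t + T)) = fst (\<gamma> t) \<and> \<sigma> (t + T) = \<sigma> t"
    and "a = 0 \<Longrightarrow> is_embedded a D \<gamma> cylinder" and "a \<noteq> 0 \<Longrightarrow> is_immersed a D \<gamma> plane"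
proof -
  obtain c b k where N: "is_normal_form \<tau> a J D \<gamma> \<sigma> c b k" by (rule normal_form_exists[OF J(1) P])
  have J0: "J \<noteq> 0" using J by simp
  show D: "D = UNIV" using N by (simp add: is_normal_form_def lifetime_UNIV[OF J0])
  note mono = profile_height_increasing[OF J(1) less_imp_le[OF J(2)] P]
  show "strict_mono (\<lambda>t. snd (\<gamma> t))" using mono D by simp
  show "\<exists>T>0. \<forall>t. fst (\<gamma> (t + T)) = fst (\<gamma> t) \<and> \<sigma> (t + T) = \<sigma> t"
  proof (rule exI[of _ cycle], intro conjI allI cycle_pos)
    fix t
    have e: "t + cycle + c = (t + c) + cycle" by simp
    show "fst (\<gamma> (t + cycle)) = fst (\<gamma> t)" "\<sigma> (t + cycle) = \<sigma> t"
      using N D by (simp_all only: is_normal_form_def UNIV_I ball_simps e Q_periodic angle_periodic[OF J])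
  qed
  note im = profile_immersion(1)[OF P]
  note np = no_period_if_height_increasing[OF mono is_solutionD(4)[OF profileD(1)[OF P]]]
  show "is_embedded a D \<gamma> cylinder" if "a = 0"
    unfolding \<open>a = 0\<close> cylinder_def
    by (rule embedded_if_height_monotone[OF im[unfolded \<open>a = 0\<close>] is_solutionD(1,2)[OF profileD(1)[OF P]] solution_derivatives(2)[OF profileD(1)[OF P]] mono])
       (unfold D, rule homeomorphism_ident)
  show "is_immersed a D \<gamma> plane" if "a \<noteq> 0"
    by (rule immersed_without_periods(1)[OF im np that, of _ "\<lambda>p. p" "\<lambda>p. p"]) (simp_all add: D plane_def homeomorphism_ident)
qed

text \<open>
  For \<open>J = 0\<close> the versine cancels in \<open>height_rate\<close>; the quotient has no singularity on the axis.
\<close>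

definition sphere_height_rate :: "real \<Rightarrow> real \<Rightarrow> real \<Rightarrow> real" where
  "sphere_height_rate \<tau> a t = 2 * H * sqrt (Q 0 t * (2 - \<kappa> * Q 0 t) + (2 * \<tau> * Q 0 t - a)\<^sup>2) / (2 - \<kappa> * Q 0 t)"

lemma zero_in_J_range: "0 \<in> J_range \<kappa> H"
  using J_max_pos H_pos by (auto simp: J_range_def divide_nonpos_pos)

lemma height_rate_sphere: "t \<in> lifetime 0 \<Longrightarrow> height_rate \<tau> a 0 t = sphere_height_rate \<tau> a t"
  using Q_pos[OF zero_in_J_range, of t] by (simp add: height_rate_def sphere_height_rate_def)

lemma continuous_on_sphere_height_rate: "continuous_on UNIV (sphere_height_rate \<tau> a)"
proof -
  have "continuous_on UNIV (Q 0)" by (intro continuous_at_imp_continuous_on ballI DERIV_isCont[OF DERIV_Q])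
  moreover have "2 - \<kappa> * Q 0 t \<noteq> 0" for t using Q_less[OF zero_in_J_range, of t] by simp
  ultimately show ?thesis unfolding sphere_height_rate_def[abs_def] by (intro continuous_intros) auto
qed

lemma prim_height_sphere: assumes "t \<in> lifetime 0"
  shows "prim (height_rate \<tau> a 0) t = prim (sphere_height_rate \<tau> a) t"
  unfolding prim_def
  by (intro arg_cong2[where f = "(*)"] refl integral_cong height_rate_sphere lifetime_star[OF assms]) auto

lemma Q_sphere: "Q 0 t = (1 + cos (freq * t)) / freq\<^sup>2" by (simp add: Q_def amp_def)

text \<open>
  After the cancellation the profile curve extends continuously to all times. The height is strictly monotone
  on the closed interval, end points included, although its derivative may vanish at the end points.
\<close>

lemma sphere_profile:
  assumes P: "profile \<kappa> \<tau> a H 0 D \<gamma> \<sigma>" and N: "is_normal_form \<tau> a 0 D \<gamma> \<sigma> c b k"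
    and A_def: "A = pi / freq"
    and \<gamma>'_def: "\<gamma>' = (\<lambda>t. (rad \<kappa> (Q 0 (t + c)), prim (sphere_height_rate \<tau> a) (t + c) + b))"
  shows "D = {- A - c<..<A - c}" and "0 < A" and "t \<in> D \<Longrightarrow> \<gamma> t = \<gamma>' t" and "continuous_on UNIV \<gamma>'"
    and "inj_on (\<lambda>t. snd (\<gamma>' t)) {- A - c..A - c}"
    and "fst (\<gamma>' (- A - c)) = 0" and "fst (\<gamma>' (A - c)) = 0"
proof -
  show A: "0 < A" using freq_pos by (simp add: A_def)
  show D: "D = {- A - c<..<A - c}" using N by (auto simp: is_normal_form_def lifetime_def A_def)
  have lifetime: "t + c \<in> lifetime 0" if "t \<in> D" for t using that N by (simp add: is_normal_form_def)
  show "\<gamma> t = \<gamma>' t" if "t \<in> D" for t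
    using N that prim_height_sphere[OF lifetime[OF that]] by (simp add: is_normal_form_def \<gamma>'_def prod_eq_iff)
  have dh: "(prim (sphere_height_rate \<tau> a) has_real_derivative sphere_height_rate \<tau> a t) (at t)" for t
    by (rule DERIV_prim[OF open_UNIV _ _ _ continuous_on_sphere_height_rate]) auto
  have ch: "continuous_on UNIV (prim (sphere_height_rate \<tau> a))"
    by (intro continuous_at_imp_continuous_on ballI DERIV_isCont[OF dh])
  have cQ: "continuous_on UNIV (Q 0)" by (intro continuous_at_imp_continuous_on ballI DERIV_isCont[OF DERIV_Q])
  have "continuous_on UNIV (\<lambda>t. rad \<kappa> (Q 0 (t + c)))"
    by (rule continuous_on_compose2[OF continuous_on_rad])
       (use Q_nonneg[OF zero_in_J_range] Q_less[OF zero_in_J_range] in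
         \<open>auto intro!: continuous_on_compose2[OF cQ] continuous_intros simp: less_imp_le\<close>)
  then show cg: "continuous_on UNIV \<gamma>'" unfolding \<gamma>'_def
    by (intro continuous_intros continuous_on_compose2[OF ch]) auto
  have mono: "snd (\<gamma>' x) < snd (\<gamma>' y)" if "x \<in> {- A - c..A - c}" "y \<in> {- A - c..A - c}" "x < y" for x y
  proof (rule DERIV_pos_imp_increasing_open[OF that(3)])
    show "continuous_on {x..y} (\<lambda>t. snd (\<gamma>' t))"
      by (intro continuous_intros continuous_on_subset[OF cg]) auto
    fix z assume "x < z" "z < y"
    then have z: "z \<in> D" using that D by auto
    have 1: "0 < 2 - \<kappa> * Q 0 (z + c)" using Q_less[OF zero_in_J_range, of "z + c"] by simp
    have "0 < sphere_height_rate \<tau> a (z + c)"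
      unfolding sphere_height_rate_def
      using Q_pos[OF zero_in_J_range lifetime[OF z]] 1 H_pos by (intro divide_pos_pos mult_pos_pos) (auto intro: add_pos_nonneg)
    moreover have "((\<lambda>t. snd (\<gamma>' t)) has_real_derivative sphere_height_rate \<tau> a (z + c)) (at z)"
      using DERIV_add[OF dh[of "z + c", unfolded DERIV_shift] DERIV_const[of b]] by (simp add: \<gamma>'_def)
    ultimately show "\<exists>d. ((\<lambda>t. snd (\<gamma>' t)) has_real_derivative d) (at z) \<and> 0 < d" by blast
  qed
  show "inj_on (\<lambda>t. snd (\<gamma>' t)) {- A - c..A - c}"
    by (rule strict_mono_on_imp_inj_on, rule strict_mono_onI) (use mono in blast)
  show "fst (\<gamma>' (- A - c)) = 0" "fst (\<gamma>' (A - c)) = 0"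
    using freq_pos by (simp_all add: \<gamma>'_def Q_sphere A_def rad_0)
qed

text \<open>
  Both the semicircle and the closed profile curve are homeomorphic to a compact interval, the semicircle by
  its second coordinate.
\<close>

lemma semicircle_closure:
  assumes P: "profile \<kappa> \<tau> a H 0 D \<gamma> \<sigma>"
  shows "\<exists>f g. homeomorphism semicircle (closure (\<gamma> ` D)) f g \<and>
             f ` {p \<in> semicircle. fst p > 0} = \<gamma> ` D \<and>
             f ` {p \<in> semicircle. fst p = 0} \<subseteq> {0} \<times> UNIV"
proof -
  obtain c b k where N: "is_normal_form \<tau> a 0 D \<gamma> \<sigma> c b k" by (rule normal_form_exists[OF zero_in_J_range P])
  define A where "A = pi / freq"
  define \<gamma>' where "\<gamma>' = (\<lambda>t. (rad \<kappa> (Q 0 (t + c)), prim (sphere_height_rate \<tau> a) (t + c) + b))"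
  note G = sphere_profile[OF P N A_def \<gamma>'_def]
  define f where "f p = \<gamma>' (A * snd p - c)" for p :: "real \<times> real"
  have sc: "p \<in> semicircle \<longleftrightarrow> fst p \<ge> 0 \<and> (fst p)\<^sup>2 + (snd p)\<^sup>2 = 1" for p
    by (auto simp: semicircle_def norm_prod_def)
  have b1: "\<bar>snd p\<bar> \<le> 1" if "p \<in> semicircle" for p
  proof -
    have "(snd p)\<^sup>2 \<le> 1" using that zero_le_power2[of "fst p"] unfolding sc by linarith
    then show ?thesis by (simp add: abs_square_le_1)
  qed
  have in_I: "A * snd p - c \<in> {- A - c..A - c}" if "p \<in> semicircle" for p
  proof -
    have "A * (-1) \<le> A * snd p" "A * snd p \<le> A * 1"
      using b1[OF that] G(2) by (intro mult_left_mono; simp add: abs_le_iff)+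
    then show ?thesis by simp
  qed
  have pt: "(sqrt (1 - ((t + c) / A)\<^sup>2), (t + c) / A) \<in> semicircle" "f (sqrt (1 - ((t + c) / A)\<^sup>2), (t + c) / A) = \<gamma>' t"
    if "t \<in> {- A - c..A - c}" for t
  proof -
    have "\<bar>(t + c) / A\<bar> \<le> 1" using that G(2) by (simp add: abs_le_iff field_simps)
    then have "((t + c) / A)\<^sup>2 \<le> 1" by (simp add: abs_square_le_1)
    then show "(sqrt (1 - ((t + c) / A)\<^sup>2), (t + c) / A) \<in> semicircle" by (simp add: sc)
    show "f (sqrt (1 - ((t + c) / A)\<^sup>2), (t + c) / A) = \<gamma>' t" using G(2) by (simp add: f_def)
  qed
  have fim: "f ` semicircle = \<gamma>' ` {- A - c..A - c}"
  proof
    show "f ` semicircle \<subseteq> \<gamma>' ` {- A - c..A - c}" using in_I by (auto simp: f_def)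
    show "\<gamma>' ` {- A - c..A - c} \<subseteq> f ` semicircle" using pt by (metis (no_types, lifting) image_eqI image_subsetI)
  qed
  have cl: "closure (\<gamma> ` D) = \<gamma>' ` {- A - c..A - c}"
  proof -
    have e: "\<gamma> ` D = \<gamma>' ` {- A - c<..<A - c}" using G(1,3) by auto
    have lt: "- A - c < A - c" using G(2) by simp
    show ?thesis
    proof
      show "closure (\<gamma> ` D) \<subseteq> \<gamma>' ` {- A - c..A - c}" unfolding e
        by (intro closure_minimal image_mono compact_imp_closed compact_continuous_image continuous_on_subset[OF G(4)]) auto
      have "\<gamma>' ` closure {- A - c<..<A - c} \<subseteq> closure (\<gamma>' ` {- A - c<..<A - c})"
        by (intro image_closure_subset continuous_on_subset[OF G(4)] closure_subset) auto
      then show "\<gamma>' ` {- A - c..A - c} \<subseteq> closure (\<gamma> ` D)" unfolding e closure_greaterThanLessThan[OF lt] .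
    qed
  qed
  have "compact semicircle"
  proof -
    have "semicircle = sphere 0 1 \<inter> {p. fst p \<ge> 0}" by (auto simp: semicircle_def)
    moreover have "closed {p :: real \<times> real. fst p \<ge> 0}" by (intro closed_Collect_le continuous_intros)
    ultimately show ?thesis using compact_Int_closed[OF compact_sphere] by metis
  qed
  moreover have "continuous_on semicircle f" unfolding f_def
    by (intro continuous_on_compose2[OF G(4)] continuous_intros) auto
  moreover have "inj_on f semicircle"
  proof (rule inj_onI)
    fix p q assume p: "p \<in> semicircle" and q: "q \<in> semicircle" and e: "f p = f q"
    have "A * snd p - c = A * snd q - c"
      by (rule inj_onD[OF G(5) _ in_I[OF p] in_I[OF q]]) (use e in \<open>simp add: f_def\<close>)
    then have s: "snd p = snd q" using G(2) by simp
    then have "(fst p)\<^sup>2 = (fst q)\<^sup>2" using p q unfolding sc by (metis add_right_cancel)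
    then have "fst p = fst q" using p q unfolding sc by (simp add: power2_eq_iff_nonneg)
    with s show "p = q" by (simp add: prod_eq_iff)
  qed
  ultimately obtain g where g: "homeomorphism semicircle (closure (\<gamma> ` D)) f g"
    using homeomorphism_compact[of semicircle f] unfolding cl fim[symmetric] by blast
  have "f ` {p \<in> semicircle. fst p > 0} = \<gamma> ` D"
  proof (intro set_eqI iffI)
    fix x assume "x \<in> f ` {p \<in> semicircle. fst p > 0}"
    then obtain p where p: "p \<in> semicircle" "fst p > 0" "x = f p" by auto
    have "(snd p)\<^sup>2 < 1" using p zero_less_power[OF p(2), of 2] unfolding sc by linarith
    then have "\<bar>snd p\<bar> < 1" by (simp add: abs_square_less_1)
    then have "A * (-1) < A * snd p" "A * snd p < A * 1"
      using G(2) by (intro mult_strict_left_mono; simp add: abs_less_iff)+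
    then have "A * snd p - c \<in> D" using G(1) by simp
    then show "x \<in> \<gamma> ` D" using G(3) p(3) by (auto simp: f_def)
  next
    fix x assume "x \<in> \<gamma> ` D"
    then obtain t where t: "t \<in> D" "x = \<gamma>' t" using G(3) by auto
    let ?p = "(sqrt (1 - ((t + c) / A)\<^sup>2), (t + c) / A)"
    have tI: "t \<in> {- A - c..A - c}" using t(1) G(1) by simp
    have "\<bar>t + c\<bar> < A" using t(1) unfolding G(1) by (simp add: abs_less_iff)
    then have "\<bar>(t + c) / A\<bar> < 1"
      by (simp only: abs_divide abs_of_pos[OF G(2)] pos_divide_less_eq[OF G(2)] mult_1)
    then have "((t + c) / A)\<^sup>2 < 1" by (simp add: abs_square_less_1)
    then have "fst ?p > 0" by simp
    then show "x \<in> f ` {p \<in> semicircle. fst p > 0}" using pt[OF tI] t(2) by (metis (mono_tags, lifting) image_eqI mem_Collect_eq)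
  qed
  moreover have "f ` {p \<in> semicircle. fst p = 0} \<subseteq> {0} \<times> UNIV"
  proof (rule image_subsetI)
    fix p assume p: "p \<in> {p \<in> semicircle. fst p = 0}"
    then have "fst p = 0" "(fst p)\<^sup>2 + (snd p)\<^sup>2 = 1" using sc[of p] by blast+
    then have "(snd p)\<^sup>2 = 1" by simp
    then have "snd p = 1 \<or> snd p = -1" by (simp add: power2_eq_1_iff)
    then have "fst (f p) = 0" using G(6,7) by (auto simp: f_def)
    then show "f p \<in> {0} \<times> UNIV" by (simp add: mem_Times_iff)
  qed
  ultimately show ?thesis using g by blast
qed

lemma sphere_case:
  assumes P: "profile \<kappa> \<tau> a H 0 D \<gamma> \<sigma>"
  shows "a = 0 \<Longrightarrow> is_embedded a D \<gamma> doubly_punctured_sphere"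
    and "a \<noteq> 0 \<Longrightarrow> is_immersed a D \<gamma> strip"
    and "\<not> complete_surface \<kappa> \<tau> a D \<gamma>"
proof -
  obtain c b k where N: "is_normal_form \<tau> a 0 D \<gamma> \<sigma> c b k" by (rule normal_form_exists[OF zero_in_J_range P])
  define A where "A = pi / freq"
  define \<gamma>' where "\<gamma>' = (\<lambda>t. (rad \<kappa> (Q 0 (t + c)), prim (sphere_height_rate \<tau> a) (t + c) + b))"
  note G = sphere_profile[OF P N A_def \<gamma>'_def]
  have D_eq: "D = {t. \<bar>t + c\<bar> < A}" using G(1) by (auto simp: abs_less_iff)
  note S = is_solutionD[OF profileD(1)[OF P]]
  note im = profile_immersion(1)[OF P]
  note mono = profile_height_increasing[OF zero_in_J_range order_refl P]
  note np = no_period_if_height_increasing[OF mono S(4)]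
  show "is_embedded a D \<gamma> doubly_punctured_sphere" if "a = 0"
  proof -
    obtain \<Phi> \<Psi> where h: "homeomorphism (sphere (0::complex) 1 \<times> D) doubly_punctured_sphere \<Phi> \<Psi>"
      unfolding D_eq by (rule doubly_punctured_sphere_homeomorphism[OF G(2)])
    show ?thesis unfolding \<open>a = 0\<close>
      by (rule embedded_if_height_monotone[OF im[unfolded \<open>a = 0\<close>] S(1,2) solution_derivatives(2)[OF profileD(1)[OF P]] mono h])
  qed
  show "is_immersed a D \<gamma> strip" if "a \<noteq> 0"
  proof (rule immersed_without_periods(1)[OF im np that])
    show "homeomorphism (D \<times> (UNIV :: real set)) strip (\<lambda>(t, \<phi>). ((t + c + A) / (2 * A), \<phi>)) (\<lambda>(s, \<phi>). (2 * A * s - A - c, \<phi>))"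
    proof (rule homeomorphismI)
      show "continuous_on (D \<times> (UNIV :: real set)) (\<lambda>(t, \<phi>). ((t + c + A) / (2 * A), \<phi>))"
        "continuous_on strip (\<lambda>(s, \<phi>). (2 * A * s - A - c, \<phi>))"
        unfolding case_prod_beta using G(2) by (intro continuous_intros; simp)+
    qed (use G(2) in \<open>auto simp: strip_def G(1) field_simps\<close>)
  qed
  show "\<not> complete_surface \<kappa> \<tau> a D \<gamma>"
  proof -
    interpret C1_curve D \<gamma> "\<lambda>t. (cos (\<sigma> t), W \<kappa> \<tau> a (fst (\<gamma> t)) * sin (\<sigma> t))"
      by (rule profile_immersion(2)[OF P])
    have "compact (sphere_height_rate \<tau> a ` {- A..A})"
      by (intro compact_continuous_image continuous_on_subset[OF continuous_on_sphere_height_rate]) auto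
    then obtain B where B: "\<And>t. t \<in> {- A..A} \<Longrightarrow> \<bar>sphere_height_rate \<tau> a t\<bar> \<le> B"
      using compact_imp_bounded bounded_iff by (metis imageI real_norm_def)
    have Wh: "W \<kappa> \<tau> a (fst (\<gamma> t)) * sin (\<sigma> t) = sphere_height_rate \<tau> a (t + c)" if t: "t \<in> D" for t
    proof -
      have d: "t + c \<in> lifetime 0" using N t by (simp add: is_normal_form_def)
      have "((\<lambda>t. prim (height_rate \<tau> a 0) (t + c) + b) has_real_derivative height_rate \<tau> a 0 (t + c)) (at t)"
        using DERIV_add[OF DERIV_height[OF zero_in_J_range d, of \<tau> a, unfolded DERIV_shift] DERIV_const[of b]] by simp
      then have "((\<lambda>t. snd (\<gamma> t)) has_real_derivative height_rate \<tau> a 0 (t + c)) (at t)"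
        by (rule has_field_derivative_transform_within_open[OF _ S(1) t]) (use N in \<open>simp add: is_normal_form_def\<close>)
      from DERIV_unique[OF S(7)[OF t] this] show ?thesis by (simp add: height_rate_sphere[OF d])
    qed
    define T where "T n = A - c - A / (real n + 2)" for n :: nat
    have Tlim: "T \<longlonglongrightarrow> A - c"
    proof -
      have "(\<lambda>n. A / (real n + 2)) \<longlonglongrightarrow> 0"
        using LIMSEQ_ignore_initial_segment[OF lim_const_over_n[of A], of 2] by (simp add: add.commute)
      from tendsto_diff[OF tendsto_const this, of "A - c"] show ?thesis by (simp add: T_def[abs_def])
    qed
    have TD: "T n \<in> D" for n
    proof -
      have "0 < A / (real n + 2)" "A / (real n + 2) < 2 * A" using G(2) by (simp_all add: field_simps add_pos_nonneg)
      then show ?thesis by (simp add: T_def G(1))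
    qed
    show ?thesis
    proof (rule not_complete_surface[of "1 + B" T "A - c"])
      fix t assume t: "t \<in> D"
      show "0 < fst (\<gamma> t)" using S(5)[OF t] by (auto simp: I_def split: if_splits)
      have "t + c \<in> {- A..A}" using t D_eq by (auto simp: abs_less_iff)
      then have "\<bar>W \<kappa> \<tau> a (fst (\<gamma> t)) * sin (\<sigma> t)\<bar> \<le> B" using B Wh[OF t] by simp
      then show "norm (cos (\<sigma> t), W \<kappa> \<tau> a (fst (\<gamma> t)) * sin (\<sigma> t)) \<le> 1 + B"
        using norm_Pair_le[of "cos (\<sigma> t)" "W \<kappa> \<tau> a (fst (\<gamma> t)) * sin (\<sigma> t)"] abs_cos_le_one[of "\<sigma> t"]
        unfolding real_norm_def by linarith
    next
      have "(\<lambda>n. fst (\<gamma>' (T n))) \<longlonglongrightarrow> fst (\<gamma>' (A - c))"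
        by (intro tendsto_fst continuous_on_tendsto_compose[OF G(4) Tlim]) auto
      then show "(\<lambda>n. fst (\<gamma> (T n))) \<longlonglongrightarrow> 0" using G(3)[OF TD] G(7) by simp
    qed (use TD Tlim in auto)
  qed
qed

end

section \<open>Nodoids and tubes\<close>

text \<open>
  Iterating a translation that adds a constant.
\<close>

lemma shift_of_int:
  fixes f :: "real \<Rightarrow> real"
  assumes "\<And>t. f (t + p) = f t + d"
  shows "f (t + of_int n * p) = f t + of_int n * d"
proof (induction n rule: int_induct[where k = 0])
  case base
  then show ?case by simp
next
  case (step1 i)
  have "t + of_int (i + 1) * p = (t + of_int i * p) + p" by (simp add: algebra_simps)
  then show ?case using assms[of "t + of_int i * p"] step1 by (simp add: algebra_simps)
next
  case (step2 i)
  have "t + of_int i * p = (t + of_int (i - 1) * p) + p" by (simp add: algebra_simps)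
  then show ?case using assms[of "t + of_int (i - 1) * p"] step2 by (simp add: algebra_simps)
qed

lemma cases_of_sign:
  fixes x :: real
  shows "(x \<noteq> 0 \<Longrightarrow> P) \<Longrightarrow> (x = 0 \<Longrightarrow> R) \<Longrightarrow> (x > 0 \<longrightarrow> P) \<and> (x = 0 \<longrightarrow> R) \<and> (x < 0 \<longrightarrow> P)"
  by auto

context cmc
begin

text \<open>
  At the smallest radius the sine of the angle is negative. This is where the sign of \<open>J\<close> enters: the values
  of \<open>\<omega>\<^sup>2 (J + 2 H Q)\<close> at the largest and the smallest radius have the product \<open>\<omega>\<^sup>2 J (4 H + \<kappa> J)\<close>.
\<close>

lemma numerator_at_bottom_neg:
  assumes J: "J \<in> J_range \<kappa> H" "J < 0"
  shows "J + 2 * H * Q J (cycle / 2) < 0"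
proof -
  have "freq * (cycle / 2) = pi" using freq_pos by simp
  then have Qh: "freq\<^sup>2 * Q J (cycle / 2) = 1 - 2 * H * J - amp J" using freq_pos by (simp add: Q_def)
  have "freq\<^sup>2 * (J + 2 * H * Q J (cycle / 2)) = freq\<^sup>2 * J + 2 * H * (freq\<^sup>2 * Q J (cycle / 2))" by (simp add: algebra_simps)
  also have "\<dots> = (2 * H + \<kappa> * J) - 2 * H * amp J"
    unfolding Qh unfolding freq_squared by (simp add: power2_eq_square algebra_simps)
  finally have e: "freq\<^sup>2 * (J + 2 * H * Q J (cycle / 2)) = (2 * H + \<kappa> * J) - 2 * H * amp J" .
  have "(2 * H + \<kappa> * J)\<^sup>2 - (2 * H * amp J)\<^sup>2 = freq\<^sup>2 * (J * (4 * H + \<kappa> * J))"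
    unfolding power_mult_distrib amp_squared[OF J(1)] freq_squared by (simp add: power2_eq_square algebra_simps)
  moreover have "freq\<^sup>2 * (J * (4 * H + \<kappa> * J)) < 0"
    using J_range_gt[OF J(1)] J(2) freq_pos by (simp add: mult_less_0_iff)
  ultimately have "(2 * H + \<kappa> * J)\<^sup>2 < (2 * H * amp J)\<^sup>2" by linarith
  moreover have "0 \<le> 2 * H * amp J" using amp_nonneg[OF J(1)] H_pos by simp
  ultimately have "2 * H + \<kappa> * J < 2 * H * amp J" by (rule power2_less_imp_less)
  then have "freq\<^sup>2 * (J + 2 * H * Q J (cycle / 2)) < 0" using e by linarith
  then show ?thesis using freq_pos by (simp add: mult_less_0_iff)
qed

lemma angle_rate_pos:
  assumes J: "J \<in> J_range \<kappa> H" "J < 0"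
  shows "0 < angle_rate J t"
proof -
  have t: "t \<in> lifetime J" using J by (simp add: lifetime_def)
  have "2 * H * Q J t - J * (1 - \<kappa> * Q J t) = (2 * H + \<kappa> * J) * Q J t - J" by (simp add: algebra_simps)
  also have "\<dots> > 0" using mult_nonneg_nonneg[OF J_range_ge[OF J(1)] Q_nonneg[OF J(1), of t]] J(2)
    by linarith
  finally show ?thesis unfolding angle_rate_def using Q_denominator[OF J(1) t] by (rule divide_pos_pos)
qed

lemma angle_strict_mono:
  assumes "J \<in> J_range \<kappa> H" "J < 0"
  shows "strict_mono (angle J)"
  by (rule strict_mono_on_if_deriv_pos[of UNIV, OF _ DERIV_angle[OF assms(1)] angle_rate_pos[OF assms]])
     (use assms(2) in \<open>simp_all add: lifetime_def\<close>)

text \<open>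
  The angle increases and gains a positive multiple of \<open>2 \<pi>\<close> in a cycle, so it takes the value \<open>5 \<pi> / 2\<close> at
  some time \<open>t2\<close> in the cycle. The curve is vertical only when the radius is extremal, and at the smallest
  radius it points downwards; hence \<open>t2\<close> is the end of the cycle and the multiple is one.
\<close>

lemma angle_cycle:
  assumes J: "J \<in> J_range \<kappa> H" "J < 0"
  shows "angle J (t + cycle) = angle J t + 2 * pi"
proof -
  have J0: "J \<noteq> 0" using J by simp
  note mono = angle_strict_mono[OF J]
  have a0: "angle J 0 = pi / 2" by (simp add: angle_def)
  have "angle J (0 + cycle) > angle J 0" using mono cycle_pos by (simp add: strict_mono_def)
  moreover obtain n :: int where n: "angle J (0 + cycle) = angle J 0 + 2 * pi * of_int n"
    using angle_shift(2)[OF J(1) J0, of 0] sin_cos_eq_iff[of "angle J (0 + cycle)" "angle J 0"]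
    by (auto simp: complex_eq_iff)
  ultimately have "0 < 2 * pi * real_of_int n" by linarith
  then have "1 \<le> real_of_int n" by (simp add: zero_less_mult_iff)
  then have "2 * pi * 1 \<le> 2 * pi * real_of_int n" by (intro mult_left_mono) auto
  then have "angle J 0 \<le> 5 * pi / 2" "5 * pi / 2 \<le> angle J cycle" using n a0 pi_gt_zero by simp_all
  then obtain t2 where t2: "0 \<le> t2" "t2 \<le> cycle" "angle J t2 = 5 * pi / 2"
    using IVT'[of "angle J" 0 "5 * pi / 2" cycle] continuous_on_subset[OF continuous_on_angle[OF J(1) J0]] cycle_pos
    by (metis less_imp_le subset_UNIV)
  have "t2 \<noteq> 0" using t2(3) a0 pi_gt_zero by auto
  have "5 * pi / 2 = pi / 2 + 2 * pi" by simp
  then have sc: "cos (angle J t2) = 0" "sin (angle J t2) = 1" unfolding t2(3) by (simp_all only: cos_periodic sin_periodic cos_pi_half sin_pi_half)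
  have d: "t2 \<in> lifetime J" by (simp add: lifetime_UNIV[OF J0])
  note R = explicit_radius(3)[OF J(1) d]
  have "Q' J t2 = 0" using angle_identities(1)[OF J(1) d] sc R by simp
  moreover have "amp J \<noteq> 0" using amp_pos[OF J(1)] J(2) J_max_pos by auto
  ultimately have "sin (freq * t2) = 0" using freq_pos by (simp add: Q'_def)
  then obtain i :: int where i: "freq * t2 = of_int i * pi" by (auto simp: sin_zero_iff_int2)
  have "0 < freq * t2" "freq * t2 \<le> 2 * pi"
    using t2 \<open>t2 \<noteq> 0\<close> freq_pos by (simp_all add: field_simps)
  then have "0 < i" "i \<le> 2" unfolding i by (simp_all add: zero_less_mult_iff)
  have "i \<noteq> 1"
  proof
    assume "i = 1"
    then have "t2 = cycle / 2" using i freq_pos by (simp add: field_simps)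
    then have "sin (angle J t2) < 0"
      unfolding angle_identities(2)[OF J(1) d] using numerator_at_bottom_neg[OF J] R by (simp add: divide_neg_pos)
    then show False using sc by simp
  qed
  then have "i = 2" using \<open>0 < i\<close> \<open>i \<le> 2\<close> by linarith
  then have "t2 = cycle" using i freq_pos by (simp add: field_simps)
  then have "angle J cycle - pi / 2 = 2 * pi" using t2(3) by simp
  then show ?thesis using angle_shift(1)[OF J(1) J0, of t] by linarith
qed

lemma angle_surj:
  assumes J: "J \<in> J_range \<kappa> H" "J < 0"
  shows "surj (angle J)"
proof (unfold surj_def, rule allI)
  fix y :: real
  have J0: "J \<noteq> 0" using J by simp
  define m where "m = \<lceil>\<bar>y\<bar>\<rceil>"
  have m: "\<bar>y\<bar> \<le> of_int m" "0 \<le> real_of_int m" by (auto simp: m_def le_of_int_ceiling)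
  have a0: "angle J 0 = pi / 2" by (simp add: angle_def)
  have up: "angle J (0 + of_int n * cycle) = pi / 2 + of_int n * (2 * pi)" for n :: int
    using shift_of_int[of "angle J" cycle "2 * pi" 0 n] angle_cycle[OF J] a0 by simp
  define X where "X = real_of_int (m + 1) * (2 * pi)"
  have "(of_int m + 1) * 4 \<le> X"
    unfolding X_def using m(2) pi_gt3 by (simp only: of_int_add of_int_1) (intro mult_left_mono, auto)
  then have "pi / 2 - X \<le> y" "y \<le> pi / 2 + X"
    using abs_le_D1[OF m(1)] abs_le_D2[OF m(1)] m(2) pi_less_4 pi_gt_zero by argo+
  moreover have "angle J (of_int (m + 1) * cycle) = pi / 2 + X" using up[of "m + 1"] by (simp only: X_def add_0)
  moreover have "angle J (of_int (- (m + 1)) * cycle) = pi / 2 - X"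
    using up[of "- (m + 1)"] by (simp only: X_def add_0 of_int_minus mult_minus_left diff_conv_add_uminus)
  ultimately have "angle J (of_int (- (m + 1)) * cycle) \<le> y" "y \<le> angle J (of_int (m + 1) * cycle)"
    by (simp_all only:)
  moreover have "of_int (- (m + 1)) * cycle \<le> of_int (m + 1) * cycle"
    using cycle_pos m(2) by (intro mult_right_mono) auto
  ultimately show "\<exists>x. y = angle J x"
    using IVT'[of "angle J" "of_int (- (m + 1)) * cycle" y "of_int (m + 1) * cycle"]
      continuous_on_subset[OF continuous_on_angle[OF J(1) J0]] by (metis subset_UNIV)
qed

text \<open>
  The vertical period.
\<close>

definition rise :: "real \<Rightarrow> real \<Rightarrow> real \<Rightarrow> real" where
  "rise \<tau> a J = prim (height_rate \<tau> a J) cycle"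

lemma height_cycle:
  assumes "J \<in> J_range \<kappa> H" "J \<noteq> 0"
  shows "prim (height_rate \<tau> a J) (t + cycle) = prim (height_rate \<tau> a J) t + rise \<tau> a J"
proof -
  let ?h = "prim (height_rate \<tau> a J)"
  have d: "((\<lambda>t. ?h (t + cycle) - ?h t) has_real_derivative 0) (at t within UNIV)" for t
    using DERIV_diff[OF DERIV_height[OF assms(1), of "t + cycle" \<tau> a, unfolded DERIV_shift] DERIV_height[OF assms(1), of t \<tau> a]]
    by (simp add: lifetime_UNIV[OF assms(2)] rates_periodic)
  obtain e where "\<And>t. ?h (t + cycle) - ?h t = e"
    using has_field_derivative_zero_constant[OF convex_UNIV, of "\<lambda>t. ?h (t + cycle) - ?h t"] d by blast
  from this[of t] this[of 0] show ?thesis by (simp add: rise_def)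
qed

lemma height_odd: "prim (height_rate \<tau> a J) (- t) = - prim (height_rate \<tau> a J) t"
  by (rule prim_odd) (rule rates_even)

lemma Q_eq_cases:
  assumes "amp J \<noteq> 0" "Q J u = Q J v"
  shows "\<exists>n :: int. u = v + of_int n * cycle \<or> u = - v + of_int n * cycle"
proof -
  have "cos (freq * u) = cos (freq * v)" using assms freq_pos by (simp add: Q_def)
  then obtain m where "m \<in> \<int>" "freq * u = freq * v + 2 * m * pi \<or> freq * u = - (freq * v) + 2 * m * pi"
    unfolding cos_eq by blast
  then obtain n :: int where "freq * u = freq * v + 2 * of_int n * pi \<or> freq * u = - (freq * v) + 2 * of_int n * pi"
    by (auto elim: Ints_cases)
  then show ?thesis using freq_pos by (intro exI[of _ n]) (auto simp: field_simps)
qed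

text \<open>
  If the vertical period is zero, the height vanishes at \<open>0\<close> and, being odd and periodic, at half a cycle. A
  further zero between them would give two critical points of the height by Rolle's theorem, but at a critical
  point \<open>Q = - J / (2 H)\<close>, and \<open>Q\<close> is injective on half a cycle.
\<close>

lemma height_zero_free:
  assumes J: "J \<in> J_range \<kappa> H" "J < 0" and r: "rise \<tau> a J = 0" and u: "0 < u" "u < cycle / 2"
  shows "prim (height_rate \<tau> a J) u \<noteq> 0"
proof
  let ?h = "prim (height_rate \<tau> a J)"
  assume hu: "?h u = 0"
  have J0: "J \<noteq> 0" using J by simp
  have "?h (- (cycle / 2) + cycle) = ?h (- (cycle / 2))" using height_cycle[OF J(1) J0, of \<tau> a "- (cycle / 2)"] r by simp
  moreover have "- (cycle / 2) + cycle = cycle / 2" by simp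
  ultimately have "?h (cycle / 2) = - ?h (cycle / 2)" using height_odd[of \<tau> a J "cycle / 2"] by simp
  then have hh: "?h (cycle / 2) = 0" by simp
  have dh: "(?h has_real_derivative height_rate \<tau> a J z) (at z)" for z
    by (rule DERIV_height[OF J(1)]) (simp add: lifetime_UNIV[OF J0])
  then have diff: "?h differentiable (at z)" for z using real_differentiable_def by blast
  have cont: "continuous_on S ?h" for S by (intro continuous_at_imp_continuous_on ballI DERIV_isCont[OF dh])
  have crit: "J + 2 * H * Q J z = 0" if "(?h has_real_derivative 0) (at z)" for z
  proof -
    have "height_rate \<tau> a J z = 0" by (rule DERIV_unique[OF dh that])
    moreover have q: "0 < Q J z * (2 - \<kappa> * Q J z)" by (rule Q_denominator[OF J(1)]) (simp add: lifetime_UNIV[OF J0])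
    moreover have "0 < Q J z * (2 - \<kappa> * Q J z) + (2 * \<tau> * Q J z - a)\<^sup>2" by (rule add_pos_nonneg[OF q]) simp
    ultimately show ?thesis unfolding height_rate_def by (simp only: divide_eq_0_iff mult_eq_0_iff real_sqrt_eq_zero_cancel_iff) auto
  qed
  obtain z1 where z1: "0 < z1" "z1 < u" "(?h has_real_derivative 0) (at z1)"
    using Rolle[of 0 u ?h] u(1) hu cont diff by auto
  obtain z2 where z2: "u < z2" "z2 < cycle / 2" "(?h has_real_derivative 0) (at z2)"
    using Rolle[of u "cycle / 2" ?h] u(2) hu hh cont diff by auto
  have "2 * H * Q J z1 = 2 * H * Q J z2" using crit[OF z1(3)] crit[OF z2(3)] by linarith
  then have "Q J z1 = Q J z2" using H_pos by simp
  moreover have "amp J \<noteq> 0" using amp_pos[OF J(1)] J(2) J_max_pos by auto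
  \<comment> \<open>Injectivity of \<open>Q\<close> on half a cycle is that of the cosine on \<open>[0, \<pi>]\<close>.\<close>
  ultimately have cos: "cos (freq * z1) = cos (freq * z2)" using freq_pos by (simp add: Q_def)
  have range: "0 \<le> freq * z \<and> freq * z \<le> pi" if "0 < z" "z < cycle / 2" for z
  proof -
    have "freq * z \<le> freq * (cycle / 2)" using that freq_pos by (intro mult_left_mono) auto
    moreover have "freq * (cycle / 2) = pi" using freq_pos by simp
    ultimately show ?thesis using that freq_pos by simp
  qed
  have "z1 < cycle / 2" "0 < z2" using z1 z2 u by linarith+
  then have "freq * z1 = freq * z2"
    using range[OF z1(1)] range[OF _ z2(2)] cos cos_inj_pi by blast
  then show False using z1(2) z2(1) freq_pos by simp
qed

lemma height_zero_cycle:
  assumes J: "J \<in> J_range \<kappa> H" "J < 0" and r: "rise \<tau> a J = 0" and h: "prim (height_rate \<tau> a J) u = 0"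
  shows "\<exists>n :: int. 2 * u = of_int n * cycle"
proof -
  let ?h = "prim (height_rate \<tau> a J)"
  have J0: "J \<noteq> 0" using J by simp
  define n where "n = \<lfloor>u / cycle\<rfloor>"
  define u0 where "u0 = u - of_int n * cycle"
  have u: "u = u0 + of_int n * cycle" by (simp add: u0_def)
  have hc: "?h (t + of_int m * cycle) = ?h t" for t and m :: int
    using shift_of_int[of ?h cycle 0 t m] height_cycle[OF J(1) J0, of \<tau> a] r by simp
  have h0: "?h u0 = 0" using h hc[of u0 n] u by simp
  have "of_int n \<le> u / cycle" "u / cycle < of_int n + 1" by (auto simp: n_def)
  then have "of_int n * cycle \<le> u" "u < (of_int n + 1) * cycle"
    using cycle_pos pos_le_divide_eq[OF cycle_pos] pos_divide_less_eq[OF cycle_pos] by blast+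
  then have b: "0 \<le> u0" "u0 < cycle" unfolding u0_def distrib_right mult_1 by linarith+
  consider "u0 = 0" | "0 < u0" "u0 < cycle / 2" | "u0 = cycle / 2" | "cycle / 2 < u0" using b by linarith
  then show ?thesis
  proof cases
    case 1
    then show ?thesis by (intro exI[of _ "2 * n"]) (simp add: u)
  next
    case 2
    then show ?thesis using height_zero_free[OF J r] h0 by blast
  next
    case 3
    have "2 * (C / 2 + x * C) = (2 * x + 1) * C" for C x :: real by (simp add: algebra_simps)
    then have "2 * u = (2 * of_int n + 1) * cycle" unfolding u 3 .
    then show ?thesis by (intro exI[of _ "2 * n + 1"]) simp
  next
    case 4
    have "- u0 + of_int 1 * cycle = cycle - u0" by simp
    then have "?h (cycle - u0) = 0" using hc[of "- u0" 1] height_odd[of \<tau> a J u0] h0 by simp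
    moreover have "0 < cycle - u0" "cycle - u0 < cycle / 2" using 4 b(2) by linarith+
    ultimately show ?thesis using height_zero_free[OF J r] by blast
  qed
qed

text \<open>
  A period of the curve is a period of the radius, hence a multiple of the cycle, and it has to preserve the
  height. So the periods are trivial or all multiples of the cycle, depending on the vertical period. In the
  second case a double point consists of two parameters with equal or with opposite time modulo the cycle; for
  opposite times the height is zero, which leaves only the two vertical points.
\<close>

lemma nodoid_case:
  assumes J: "J \<in> J_range \<kappa> H" "J < 0" and P: "profile \<kappa> \<tau> a H J D \<gamma> \<sigma>"
  shows "D = UNIV \<and> strict_mono \<sigma> \<and> bij \<sigma> \<and>
          (\<exists>T>0. \<forall>t. fst (\<gamma> (t + T)) = fst (\<gamma> t) \<and>
             deriv (\<lambda>s. snd (\<gamma> s)) (t + T) = deriv (\<lambda>s. snd (\<gamma> s)) t \<and>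
             cis (\<sigma> (t + T)) = cis (\<sigma> t)) \<and>
          (\<exists>\<Delta>. (\<forall>s. snd (\<gamma> (inv \<sigma> (s + 2 * pi))) - snd (\<gamma> (inv \<sigma> s)) = \<Delta>) \<and>
             (\<Delta> > 0 \<longrightarrow>
                (a = 0 \<longrightarrow> is_immersed a D \<gamma> cylinder) \<and>
                (a \<noteq> 0 \<longrightarrow> is_immersed a D \<gamma> plane)) \<and>
             (\<Delta> = 0 \<longrightarrow>
                (\<exists>T>0. (\<forall>t. \<gamma> (t + T) = \<gamma> t) \<and> simple_path (\<lambda>s. \<gamma> (T * s))) \<and>
                (a = 0 \<longrightarrow> is_embedded a D \<gamma> torus) \<and>
                (a \<noteq> 0 \<longrightarrow> is_immersed a D \<gamma> cylinder)) \<and>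
             (\<Delta> < 0 \<longrightarrow>
                (a = 0 \<longrightarrow> is_immersed a D \<gamma> cylinder) \<and>
                (a \<noteq> 0 \<longrightarrow> is_immersed a D \<gamma> plane)))"
proof -
  obtain c b k where N: "is_normal_form \<tau> a J D \<gamma> \<sigma> c b k" by (rule normal_form_exists[OF J(1) P])
  have J0: "J \<noteq> 0" using J by simp
  let ?h = "prim (height_rate \<tau> a J)"
  define \<Delta> where "\<Delta> = rise \<tau> a J"
  have D: "D = UNIV" using N by (simp add: is_normal_form_def lifetime_UNIV[OF J0])
  have r: "fst (\<gamma> t) = rad \<kappa> (Q J (t + c))" and h: "snd (\<gamma> t) = ?h (t + c) + b"
    and \<sigma>: "\<sigma> t = angle J (t + c) + 2 * pi * of_int k" for t
    using N by (simp_all add: is_normal_form_def D)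

  note im = profile_immersion(1)[OF P, unfolded D]
  have ampnz: "amp J \<noteq> 0" using amp_pos[OF J(1)] J(2) J_max_pos by auto
  have e: "t + cycle + c = (t + c) + cycle" for t by simp
  have \<sigma>c: "\<sigma> (t + cycle) = \<sigma> t + 2 * pi" for t
    unfolding \<sigma> e angle_cycle[OF J] by simp
  have rc: "fst (\<gamma> (t + cycle)) = fst (\<gamma> t)" for t unfolding r e Q_periodic ..
  have hc: "snd (\<gamma> (t + cycle)) = snd (\<gamma> t) + \<Delta>" for t
    unfolding h e height_cycle[OF J(1) J0] \<Delta>_def by simp
  have mono: "strict_mono \<sigma>"
  proof (rule strict_monoI)
    fix x y :: real assume "x < y"
    then show "\<sigma> x < \<sigma> y" unfolding \<sigma> using angle_strict_mono[OF J] by (simp add: strict_mono_def)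
  qed
  have "surj \<sigma>"
  proof (unfold surj_def, rule allI)
    fix y
    obtain u where "y - 2 * pi * of_int k = angle J u" using angle_surj[OF J] by (metis surjD)
    then show "\<exists>x. y = \<sigma> x" by (intro exI[of _ "u - c"]) (simp add: \<sigma>)
  qed
  then have bij: "bij \<sigma>" using strict_mono_imp_inj_on[OF mono] by (simp add: bij_def)
  have inv: "inv \<sigma> (s + 2 * pi) = inv \<sigma> s + cycle" for s
  proof (rule inv_f_eq)
    show "inj \<sigma>" using bij by (simp add: bij_def)
    have "\<sigma> (inv \<sigma> s) = s" using \<open>surj \<sigma>\<close> by (rule surj_f_inv_f)
    then show "\<sigma> (inv \<sigma> s + cycle) = s + 2 * pi" unfolding \<sigma>c by simp
  qed
  have cisc: "cis (\<sigma> (t + cycle)) = cis (\<sigma> t)" for t by (simp add: \<sigma>c complex_eq_iff)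
  have dh: "deriv (\<lambda>s. snd (\<gamma> s)) t = W \<kappa> \<tau> a (fst (\<gamma> t)) * sin (\<sigma> t)" for t
    by (rule DERIV_imp_deriv, rule is_solutionD(7)[OF profileD(1)[OF P]]) (simp add: D)
  have per: "\<exists>n :: int. T = of_int n * cycle \<and> of_int n * \<Delta> = 0" if "period UNIV \<gamma> T" for T
  proof -
    have p: "\<gamma> (s + T) = \<gamma> s" for s using that by (simp add: period_def)
    have I1: "rad \<kappa> (Q J (0 + T)) = rad \<kappa> (Q J 0)" using arg_cong[OF p[of "- c"], of fst] by (simp add: r add.commute)
    have "vers \<kappa> (rad \<kappa> (Q J (0 + T))) = vers \<kappa> (rad \<kappa> (Q J 0))" by (simp only: I1)
    then have "Q J T = Q J 0" using explicit_radius(2)[OF J(1)] by (simp add: lifetime_UNIV[OF J0])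
    then obtain n :: int where n: "T = of_int n * cycle"
      using Q_eq_cases[OF ampnz, of T 0] unfolding add_0 minus_zero by blast
    have "snd (\<gamma> (0 + of_int n * cycle)) = snd (\<gamma> 0) + of_int n * \<Delta>"
      by (rule shift_of_int[of "\<lambda>t. snd (\<gamma> t)"]) (rule hc)
    then have "of_int n * \<Delta> = 0" using p[of 0] n by simp
    with n show ?thesis by blast
  qed
  have cont: "continuous_on UNIV \<gamma>" using solution_derivatives(2)[OF profileD(1)[OF P]] D by simp
  have not_closed: "(a = 0 \<longrightarrow> is_immersed a D \<gamma> cylinder) \<and> (a \<noteq> 0 \<longrightarrow> is_immersed a D \<gamma> plane)" if "\<Delta> \<noteq> 0"
  proof (intro conjI impI)
    have np: "T = 0" if "period UNIV \<gamma> T" for T using per[OF that] \<open>\<Delta> \<noteq> 0\<close> by auto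
    show "is_immersed a D \<gamma> cylinder" if "a = 0" unfolding D cylinder_def
      by (rule immersed_without_periods(2)[OF im np that homeomorphism_ident])
    show "is_immersed a D \<gamma> plane" if "a \<noteq> 0" unfolding D plane_def
      by (rule immersed_without_periods(1)[OF im np that, of _ "\<lambda>p. p" "\<lambda>p. p"]) (simp_all add: homeomorphism_ident)
  qed
  have closed: "(\<exists>T>0. (\<forall>t. \<gamma> (t + T) = \<gamma> t) \<and> simple_path (\<lambda>s. \<gamma> (T * s))) \<and>
      (a = 0 \<longrightarrow> is_embedded a D \<gamma> torus) \<and> (a \<noteq> 0 \<longrightarrow> is_immersed a D \<gamma> cylinder)" if \<Delta>0: "\<Delta> = 0"
  proof (intro conjI impI exI[of _ cycle] allI cycle_pos)
    have gc: "\<gamma> (t + cycle) = \<gamma> t" for t using rc[of t] hc[of t] \<Delta>0 by (simp add: prod_eq_iff)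
    then show "\<gamma> (t + cycle) = \<gamma> t" for t .
    have fr: "fst (\<gamma> (t + of_int n * cycle)) = fst (\<gamma> t)" for t and n :: int
      using shift_of_int[of "\<lambda>t. fst (\<gamma> t)" cycle 0 t n] rc by simp
    have fh: "snd (\<gamma> (t + of_int n * cycle)) = snd (\<gamma> t)" for t and n :: int
      using shift_of_int[of "\<lambda>t. snd (\<gamma> t)" cycle 0 t n] hc \<Delta>0 by simp
    have per_iff: "period UNIV \<gamma> T \<longleftrightarrow> (\<exists>n :: int. T = of_int n * cycle)" for T
      using per[of T] fr fh by (auto simp: period_def prod_eq_iff)
    have inj: "\<exists>n :: int. t' - t = of_int n * cycle" if g: "\<gamma> t = \<gamma> t'" for t t'
    proof -
      have "rad \<kappa> (Q J (t' + c)) = rad \<kappa> (Q J (t + c))" and hh: "?h (t' + c) = ?h (t + c)"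
        using g r[of t] r[of t'] h[of t] h[of t'] by simp_all
      then have "vers \<kappa> (rad \<kappa> (Q J (t' + c))) = vers \<kappa> (rad \<kappa> (Q J (t + c)))" by simp
      then have "Q J (t' + c) = Q J (t + c)" using explicit_radius(2)[OF J(1)] by (simp add: lifetime_UNIV[OF J0])
      then obtain n :: int where n: "t' + c = t + c + of_int n * cycle \<or> t' + c = - (t + c) + of_int n * cycle"
        using Q_eq_cases[OF ampnz] by blast
      then show ?thesis
      proof
        assume "t' + c = t + c + of_int n * cycle"
        then show ?thesis by (intro exI[of _ n]) simp
      next
        assume t': "t' + c = - (t + c) + of_int n * cycle"
        have "?h (- (t + c) + of_int n * cycle) = ?h (- (t + c))"
          using shift_of_int[of ?h cycle 0 "- (t + c)" n] height_cycle[OF J(1) J0, of \<tau> a] \<Delta>0 by (simp add: \<Delta>_def)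
        then have "?h (t + c) = - ?h (t + c)" using hh t' height_odd[of \<tau> a J "t + c"] by simp
        then have "?h (t + c) = 0" by simp
        then obtain m :: int where m: "2 * (t + c) = of_int m * cycle"
          using height_zero_cycle[OF J] \<Delta>0 unfolding \<Delta>_def by blast
        have "t' - t = (t' + c) - 2 * (t + c) + (t + c)" by simp
        also have "\<dots> = of_int n * cycle - of_int m * cycle" unfolding t' m by simp
        also have "\<dots> = of_int (n - m) * cycle" by (simp only: of_int_diff left_diff_distrib)
        finally have "t' - t = of_int (n - m) * cycle" .
        then show ?thesis by blast
      qed
    qed
    show "simple_path (\<lambda>s. \<gamma> (cycle * s))"
      unfolding simple_path_def
    proof
      show "path (\<lambda>s. \<gamma> (cycle * s))" unfolding path_def
        by (intro continuous_on_compose2[OF cont] continuous_intros) auto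
      show "loop_free (\<lambda>s. \<gamma> (cycle * s))" unfolding loop_free_def
      proof (intro ballI impI)
        fix x y :: real assume x: "x \<in> {0..1}" and y: "y \<in> {0..1}" and g: "\<gamma> (cycle * x) = \<gamma> (cycle * y)"
        obtain n :: int where "cycle * y - cycle * x = of_int n * cycle" using inj[OF g] by blast
        then have "cycle * (y - x) = cycle * of_int n"
          by (simp only: right_diff_distrib mult.commute[of "of_int n"])
        moreover have "cycle \<noteq> 0" using cycle_pos by linarith
        ultimately have n: "y - x = of_int n" by (simp only: mult_cancel_left simp_thms)
        then have "-1 \<le> n" "n \<le> 1" using x y by simp_all
        then consider "n = -1" | "n = 0" | "n = 1" by linarith
        then show "x = y \<or> x = 0 \<and> y = 1 \<or> x = 1 \<and> y = 0"
          by cases (use n x y in auto)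
      qed
    qed
    show "is_embedded a D \<gamma> torus" if "a = 0" unfolding D \<open>a = 0\<close>
    proof (rule embedded_torus_if_simple_loop[OF im[unfolded \<open>a = 0\<close>] less_imp_neq[OF freq_pos, symmetric] per_iff _ cont])
      show "period UNIV \<gamma> (t' - t)" if "\<gamma> t = \<gamma> t'" for t t' unfolding per_iff by (rule inj[OF that])
    qed
    show "is_immersed a D \<gamma> cylinder" if "a \<noteq> 0" unfolding D
      by (rule immersed_cylinder_if_periodic[OF im that less_imp_neq[OF freq_pos, symmetric] per_iff])
  qed
  show ?thesis
  proof (intro conjI D mono bij, goal_cases)
    case 1
    show ?case
    proof (intro exI[of _ cycle] conjI allI cycle_pos)
      show "fst (\<gamma> (t + cycle)) = fst (\<gamma> t)" "cis (\<sigma> (t + cycle)) = cis (\<sigma> t)" for t by (rule rc, rule cisc)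
      show "deriv (\<lambda>s. snd (\<gamma> s)) (t + cycle) = deriv (\<lambda>s. snd (\<gamma> s)) t" for t
        unfolding dh rc \<sigma>c by simp
    qed
  next
    case 2
    have "\<forall>s. snd (\<gamma> (inv \<sigma> (s + 2 * pi))) - snd (\<gamma> (inv \<sigma> s)) = \<Delta>" by (simp add: inv hc)
    then show ?case
      by (rule exI[of _ \<Delta>, OF conjI[OF _ cases_of_sign[OF not_closed closed]]])
  qed
qed

end

theorem theorem3p1:
  fixes \<kappa> \<tau> a H :: real
  assumes "H > 0" and "4 * H\<^sup>2 + \<kappa> > 0"
  shows
    "(\<forall>J \<in> J_range \<kappa> H. \<forall>D \<gamma> \<sigma>. profile \<kappa> \<tau> a H J D \<gamma> \<sigma> \<longrightarrow>
        unit_speed_curve \<kappa> \<tau> a D \<gamma> \<and> has_cmc \<kappa> \<tau> a H D \<gamma>)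
   \<and>
     (\<forall>D \<gamma>. unit_speed_curve \<kappa> \<tau> a D \<gamma> \<and> has_cmc \<kappa> \<tau> a H D \<gamma> \<longrightarrow>
        (\<exists>J D' \<gamma>' \<sigma>'. D \<subseteq> D' \<and> (\<forall>t\<in>D. \<gamma>' t = \<gamma> t) \<and> profile \<kappa> \<tau> a H J D' \<gamma>' \<sigma>' \<and>
           (J \<in> J_range \<kappa> H \<or>
            \<kappa> > 0 \<and> J < - 2 * H / \<kappa> \<and> - J - 4 * H / \<kappa> \<in> J_range \<kappa> H \<and>
            profile \<kappa> \<tau> (4 * \<tau> / \<kappa> - a) H (- J - 4 * H / \<kappa>) D'
              (\<lambda>t. (pi / sqrt \<kappa> - fst (\<gamma>' t), - snd (\<gamma>' t))) (\<lambda>t. \<sigma>' t + pi))))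
   \<and>
     (\<forall>J \<in> J_range \<kappa> H. \<forall>D \<gamma> \<sigma> D' \<gamma>' \<sigma>'.
        profile \<kappa> \<tau> a H J D \<gamma> \<sigma> \<and> profile \<kappa> \<tau> a H J D' \<gamma>' \<sigma>' \<longrightarrow> same_profile D \<gamma> \<sigma> D' \<gamma>' \<sigma>')
   \<and>
     (\<exists>D \<gamma> \<sigma>. (\<forall>J \<in> J_range \<kappa> H. profile \<kappa> \<tau> a H J (D J) (\<gamma> J) (\<sigma> J)) \<and>
        continuous_on {(J, t). J \<in> J_range \<kappa> H \<and> t \<in> D J} (\<lambda>(J, t). (\<gamma> J t, \<sigma> J t)))
   \<and>
     (\<forall>J \<in> J_range \<kappa> H. \<forall>D \<gamma> \<sigma>. profile \<kappa> \<tau> a H J D \<gamma> \<sigma> \<longrightarrow>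
       (\<exists>R \<in> I \<kappa>. \<forall>p \<in> gen_surface a D \<gamma>. fst p \<le> R)
     \<and> (J = J_max \<kappa> H \<longrightarrow>
          \<gamma> ` D = {arct \<kappa> (2 * H)} \<times> UNIV \<and>
          gen_surface a D \<gamma> = {arct \<kappa> (2 * H)} \<times> sphere 0 1 \<times> UNIV)
     \<and> (0 < J \<and> J < J_max \<kappa> H \<longrightarrow>
          D = UNIV \<and>
          strict_mono (\<lambda>t. snd (\<gamma> t)) \<and>
          (\<exists>T>0. \<forall>t. fst (\<gamma> (t + T)) = fst (\<gamma> t) \<and> \<sigma> (t + T) = \<sigma> t) \<and>
          (a = 0 \<longrightarrow> is_embedded a D \<gamma> cylinder) \<and>
          (a \<noteq> 0 \<longrightarrow> is_immersed a D \<gamma> plane))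
     \<and> (J = 0 \<longrightarrow>
          (\<exists>f g. homeomorphism semicircle (closure (\<gamma> ` D)) f g \<and>
             f ` {p \<in> semicircle. fst p > 0} = \<gamma> ` D \<and>
             f ` {p \<in> semicircle. fst p = 0} \<subseteq> {0} \<times> UNIV) \<and>
          strict_mono_on D (\<lambda>t. snd (\<gamma> t)) \<and>
          (a = 0 \<longrightarrow> is_embedded a D \<gamma> doubly_punctured_sphere) \<and>
          (a \<noteq> 0 \<longrightarrow> is_immersed a D \<gamma> strip \<and> \<not> complete_surface \<kappa> \<tau> a D \<gamma>))
     \<and> (J < 0 \<longrightarrow>
          D = UNIV \<and>
          strict_mono \<sigma> \<and> bij \<sigma> \<and>
          (\<exists>T>0. \<forall>t. fst (\<gamma> (t + T)) = fst (\<gamma> t) \<and>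
             deriv (\<lambda>s. snd (\<gamma> s)) (t + T) = deriv (\<lambda>s. snd (\<gamma> s)) t \<and>
             cis (\<sigma> (t + T)) = cis (\<sigma> t)) \<and>
          (\<exists>\<Delta>. (\<forall>s. snd (\<gamma> (inv \<sigma> (s + 2 * pi))) - snd (\<gamma> (inv \<sigma> s)) = \<Delta>) \<and>
             (\<Delta> > 0 \<longrightarrow>
                (a = 0 \<longrightarrow> is_immersed a D \<gamma> cylinder) \<and>
                (a \<noteq> 0 \<longrightarrow> is_immersed a D \<gamma> plane)) \<and>
             (\<Delta> = 0 \<longrightarrow>
                (\<exists>T>0. (\<forall>t. \<gamma> (t + T) = \<gamma> t) \<and> simple_path (\<lambda>s. \<gamma> (T * s))) \<and>
                (a = 0 \<longrightarrow> is_embedded a D \<gamma> torus) \<and>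
                (a \<noteq> 0 \<longrightarrow> is_immersed a D \<gamma> cylinder)) \<and>
             (\<Delta> < 0 \<longrightarrow>
                (a = 0 \<longrightarrow> is_immersed a D \<gamma> cylinder) \<and>
                (a \<noteq> 0 \<longrightarrow> is_immersed a D \<gamma> plane)))))"
proof -
  interpret cmc \<kappa> H using assms by unfold_locales auto
  have members: "\<forall>J \<in> J_range \<kappa> H. \<forall>D \<gamma> \<sigma>. profile \<kappa> \<tau> a H J D \<gamma> \<sigma> \<longrightarrow>
      unit_speed_curve \<kappa> \<tau> a D \<gamma> \<and> has_cmc \<kappa> \<tau> a H D \<gamma>"
  proof (intro ballI allI impI)
    fix J D \<gamma> \<sigma> assume "profile \<kappa> \<tau> a H J D \<gamma> \<sigma>"
    then have "is_solution \<kappa> \<tau> a H D \<gamma> \<sigma>" by (rule profileD(1))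
    then show "unit_speed_curve \<kappa> \<tau> a D \<gamma> \<and> has_cmc \<kappa> \<tau> a H D \<gamma>"
      by (intro conjI solution_unit_speed solution_has_cmc)
  qed
  have continuous: "\<exists>D \<gamma> \<sigma>. (\<forall>J \<in> J_range \<kappa> H. profile \<kappa> \<tau> a H J (D J) (\<gamma> J) (\<sigma> J)) \<and>
      continuous_on {(J, t). J \<in> J_range \<kappa> H \<and> t \<in> D J} (\<lambda>(J, t). (\<gamma> J t, \<sigma> J t))"
    using explicit_profile continuous_on_explicit by blast
  show ?thesis
    apply (intro conjI members continuous)
    subgoal using cmc_curve_extends by blast
    subgoal using profile_unique by blast
    subgoal
    proof (intro ballI allI impI, goal_cases)
      case (1 J D \<gamma> \<sigma>)
      note J = 1(1) and P = 1(2)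
      show ?case
        apply (intro conjI)
        subgoal by (rule cylindrically_bounded[OF J P])
        subgoal using cylinder_case[OF _ P J] by blast
        subgoal using unduloid_case[OF J _ P] by blast
        subgoal using sphere_case[of \<tau> a D \<gamma> \<sigma>] semicircle_closure[of \<tau> a D \<gamma> \<sigma>] profile_height_increasing[OF J _ P] P by blast
        subgoal by (rule impI, rule nodoid_case[OF J _ P])
        done
    qed
    done
qed


end
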